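(* Let $n\ge 2$. If $t, t' \in \Delta_n$ are close special vertices with $t$ of type $0$, then $m(\Delta_n, t, t') = r(\Delta_{n-1})$ (independent of $t$ and $t'$), where $m(\Delta_n,t,t')$ is the number of galleries of length $1$ in $\Delta_n$ whose initial chamber contains $t$ and whose ending chamber contains $t'$. In particular, $\omega(\Delta_n) = (r(\Delta_n)\cdot q)/r(\Delta_{n-1})$.
   Context: $K$ is a (nonarchimedean) local field with discrete valuation $\mathrm{ord}$, valuation ring $\mathcal{O}$, uniformizer $\pi$ and residue field $k \cong \mathbb{F}_q$. Let $V$ be a $2n$-dimensional $K$-vector space with a non-degenerate alternating bilinear form $\langle\cdot,\cdot\rangle$. A lattice in $V$ is a free $\mathcal{O}$-submodule of rank $2n$; $[L]$ is the homothety class $\{\alpha L : \alpha\in K^\times\}$. A lattice $L$ is primitive if $\langle L,L\rangle\subseteq\mathcal{O}$ and $\langle\cdot,\cdot\rangle$ induces a non-degenerate alternating $k$-bilinear form on $L/\pi L$. The affine building $\Delta_n$ of $\mathrm{Sp}_n(K)$ (the symplectic group of $2n\times 2n$ matrices) is the following $n$-dimensional simplicial complex. A vertex is a homothety class of lattices in $V$ having a representative $L$ for which there is a primitive lattice $L_0$ with $\langle L,L\rangle\subseteq\pi\mathcal{O}$ and $\pi L_0\subseteq L\subseteq L_0$. Vertices $t,t'$ are incident if there are $L\in t$, $L'\in t'$ and a primitive lattice $L_0$ with $\langle L,L\rangle\subseteq\pi\mathcal{O}$, $\langle L',L'\rangle\subseteq\pi\mathcal{O}$, and either $\pi L_0\subseteq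 L\subseteq L'\subseteq L_0$ or $\pi L_0\subseteq L'\subseteq L\subseteq L_0$. Simplices are the finite sets of pairwise incident vertices. A chamber (maximal simplex) has $n+1$ vertices $t_0,\dots,t_n$ with representatives $L_i\in t_i$ such that $L_0$ is primitive, $\langle L_i,L_i\rangle\subseteq\pi\mathcal{O}$ for $1\le i\le n$, and $\pi L_0\subsetneq L_1\subsetneq\cdots\subsetneq L_n\subsetneq L_0$. Two chambers are adjacent if they share a codimension-one face. A gallery of length $1$ is an ordered pair $C,C'$ of adjacent chambers. Two vertices $t,t'$ of $\Delta_n$ are close if there are adjacent chambers $C,C'$ in $\Delta_n$ with $t\in C$, $t'\in C'$, but $t,t'\notin C\cap C'$. A basis $\{u_1,\dots,u_n,w_1,\dots,w_n\}$ of $V$ is symplectic if $\langle u_i,w_j\rangle=\delta_{ij}$ and $\langle u_i,u_j\rangle=0=\langle w_i,w_j\rangle$ for all $i,j$. A vertex $t$ of $\Delta_n$ is special (in the usual sense for affine buildings) if and only if there are a symplectic basis of $V$ and integers $a_1,\dots,a_n,\mu$ with $t=[\sum_i \mathcal{O}\pi^{a_i}u_i+\sum_i\mathcal{O}\pi^{\mu-a_i}w_i]$; this may be taken as the definition. Types: fix a standard symplectic basis $\{e_1,\dots,e_n,f_1,\dots,f_n\}$ of $V$ (used to identify $\mathrm{GL}_{2n}(K)$ with $\mathrm{GL}_K(V)$) and let $L_0=\sum_i\mathcal{O}e_i+\sum_i\mathcal{O}f_i$. The type of a homothety class $[L]$ of lattices in $V$ is $\mathrm{ord}(\det g) \bmod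 2n$, where $g\in\mathrm{GL}_{2n}(K)$ with $L=gL_0$. For $n\ge2$, $r(\Delta_n)$ is the number of chambers in $\Delta_n$ containing a given special vertex, $r(\Delta_1):=q+1$, and $\omega(\Delta_n)$ is the number of vertices in $\Delta_n$ close to a given special vertex; these numbers do not depend on the chosen special vertex. *)

theory Defs
  imports Complex_Main "Jordan_Normal_Form.Determinant"
begin

text \<open>
  A nonarchimedean local field with normalized discrete valuation \<open>ord\<close> and uniformizer \<open>\<pi>\<close>.
  The value \<open>ord 0\<close> is unspecified, so the convention that it is infinite is spelled out by
  treating \<open>0\<close> separately. The last axiom is completeness for the valuation.
\<close>

locale nonarch_local_field =
  fixes ord :: "'k::field \<Rightarrow> int" and \<pi> :: 'k
  assumes ord_mult: "x \<noteq> 0 \<Longrightarrow> y \<noteq> 0 \<Longrightarrow> ord (x * y) = ord x + ord y"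
    and ord_add: "x \<noteq> 0 \<Longrightarrow> y \<noteq> 0 \<Longrightarrow> x + y \<noteq> 0 \<Longrightarrow> min (ord x) (ord y) \<le> ord (x + y)"
    and uniformizer: "\<pi> \<noteq> 0" "ord \<pi> = 1"
    and finite_residue_field:
      "finite ({x. x = 0 \<or> 0 \<le> ord x} //
         {(x, y). x \<in> {x. x = 0 \<or> 0 \<le> ord x} \<and> y \<in> {x. x = 0 \<or> 0 \<le> ord x} \<and>
                  x - y \<in> (*) \<pi> ` {x. x = 0 \<or> 0 \<le> ord x}})"
    and complete:
      "(\<And>N::int. \<exists>M::nat. \<forall>i\<ge>M. \<forall>j\<ge>M. s i = s j \<or> N \<le> ord (s i - s j)) \<Longrightarrow>
       \<exists>l. \<forall>N::int. \<exists>M::nat. \<forall>i\<ge>M. s i = l \<or> N \<le> ord (s i - l)"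
begin

definition \<O> :: "'k set" where
  "\<O> = {x. x = 0 \<or> 0 \<le> ord x}"

definition \<pi>\<O> :: "'k set" where
  "\<pi>\<O> = (*) \<pi> ` \<O>"

definition residue_field :: "'k set set" where
  "residue_field = \<O> // {(x, y). x \<in> \<O> \<and> y \<in> \<O> \<and> x - y \<in> \<pi>\<O>}"

definition q :: nat where
  "q = card residue_field"

end

text \<open>
  A \<open>2n\<close>-dimensional symplectic space over a local field, \<open>n \<ge> 1\<close>. As \<open>dim\<close> is \<open>0\<close> for
  infinite-dimensional spaces, \<open>n \<ge> 1\<close> makes the dimension axiom imply finite dimension.
\<close>

locale symplectic_space = nonarch_local_field ord \<pi> + vector_space scale
  for ord :: "'k::field \<Rightarrow> int" and \<pi> :: 'k
    and scale :: "'k \<Rightarrow> 'v::ab_group_add \<Rightarrow> 'v" (infixr "*s" 75) +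
  fixes form :: "'v \<Rightarrow> 'v \<Rightarrow> 'k" and n :: nat
  assumes n_pos: "1 \<le> n"
    and dim_eq: "dim (UNIV :: 'v set) = 2 * n"
    and linear_right: "Vector_Spaces.linear scale (*) (\<lambda>y. form x y)"
    and linear_left: "Vector_Spaces.linear scale (*) (\<lambda>x. form x y)"
    and alternating: "form x x = 0"
    and nondegenerate: "(\<And>y. form x y = 0) \<Longrightarrow> x = 0"
begin

definition is_lattice :: "'v set \<Rightarrow> bool" where
  "is_lattice L \<longleftrightarrow> (\<exists>B. finite B \<and> card B = 2 * n \<and>
     L = {\<Sum>b\<in>B. c b *s b | c. \<forall>b\<in>B. c b \<in> \<O>} \<and>
     (\<forall>c. (\<forall>b\<in>B. c b \<in> \<O>) \<longrightarrow> (\<Sum>b\<in>B. c b *s b) = 0 \<longrightarrow> (\<forall>b\<in>B. c b = 0)))"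

definition smul :: "'k \<Rightarrow> 'v set \<Rightarrow> 'v set" where
  "smul a L = (\<lambda>x. a *s x) ` L"

definition hclass :: "'v set \<Rightarrow> 'v set set" where
  "hclass L = {smul a L | a. a \<noteq> 0}"

definition form_in :: "'v set \<Rightarrow> 'k set \<Rightarrow> bool" where
  "form_in L A \<longleftrightarrow> (\<forall>x\<in>L. \<forall>y\<in>L. form x y \<in> A)"

text \<open>
  If the form is \<open>\<O>\<close>-valued on \<open>L\<close>, then it always induces an alternating form
  \<open>(x + \<pi>L, y + \<pi>L) \<mapsto> form x y + \<pi>\<O>\<close> on \<open>L/\<pi>L\<close>; the last clause says that this form
  is non-degenerate, written in terms of representatives.
\<close>

definition primitive :: "'v set \<Rightarrow> bool" where
  "primitive L \<longleftrightarrow> is_lattice L \<and> form_in L \<O> \<and>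
     (\<forall>x\<in>L. (\<forall>y\<in>L. form x y \<in> \<pi>\<O>) \<longrightarrow> x \<in> smul \<pi> L)"

definition vertex :: "'v set set \<Rightarrow> bool" where
  "vertex t \<longleftrightarrow> (\<exists>L L\<^sub>0. is_lattice L \<and> t = hclass L \<and> primitive L\<^sub>0 \<and>
     form_in L \<pi>\<O> \<and> smul \<pi> L\<^sub>0 \<subseteq> L \<and> L \<subseteq> L\<^sub>0)"

definition incident :: "'v set set \<Rightarrow> 'v set set \<Rightarrow> bool" where
  "incident t t' \<longleftrightarrow> (\<exists>L\<in>t. \<exists>L'\<in>t'. \<exists>L\<^sub>0. primitive L\<^sub>0 \<and> form_in L \<pi>\<O> \<and> form_in L' \<pi>\<O> \<and>
     (smul \<pi> L\<^sub>0 \<subseteq> L \<and> L \<subseteq> L' \<and> L' \<subseteq> L\<^sub>0 \<or>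
      smul \<pi> L\<^sub>0 \<subseteq> L' \<and> L' \<subseteq> L \<and> L \<subseteq> L\<^sub>0))"

definition simplex :: "'v set set set \<Rightarrow> bool" where
  "simplex S \<longleftrightarrow> finite S \<and> (\<forall>t\<in>S. vertex t) \<and> pairwise incident S"

definition chamber :: "'v set set set \<Rightarrow> bool" where
  "chamber C \<longleftrightarrow> simplex C \<and> (\<forall>S. simplex S \<longrightarrow> C \<subseteq> S \<longrightarrow> S = C)"

text \<open>
  A chamber counts as adjacent to itself. This affects neither \<open>close\<close> nor \<open>num_galleries t t'\<close>
  for close \<open>t\<close>, \<open>t'\<close>, since no chamber contains two close vertices.
\<close>

definition adjacent :: "'v set set set \<Rightarrow> 'v set set set \<Rightarrow> bool" where
  "adjacent C C' \<longleftrightarrow> chamber C \<and> chamber C' \<and>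
     (\<exists>F. simplex F \<and> F \<subseteq> C \<and> F \<subseteq> C' \<and> card F + 1 = card C \<and> card F + 1 = card C')"

definition close :: "'v set set \<Rightarrow> 'v set set \<Rightarrow> bool" where
  "close t t' \<longleftrightarrow> vertex t \<and> vertex t' \<and>
     (\<exists>C C'. adjacent C C' \<and> t \<in> C \<and> t' \<in> C' \<and> t \<notin> C \<inter> C' \<and> t' \<notin> C \<inter> C')"

definition num_galleries :: "'v set set \<Rightarrow> 'v set set \<Rightarrow> nat" where
  "num_galleries t t' = card {(C, C'). adjacent C C' \<and> t \<in> C \<and> t' \<in> C'}"

definition symplectic_basis :: "(nat \<Rightarrow> 'v) \<Rightarrow> (nat \<Rightarrow> 'v) \<Rightarrow> bool" where
  "symplectic_basis u w \<longleftrightarrow>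
     independent (u ` {..<n} \<union> w ` {..<n}) \<and> span (u ` {..<n} \<union> w ` {..<n}) = UNIV \<and>
     (\<forall>i<n. \<forall>j<n. form (u i) (w j) = (if i = j then 1 else 0) \<and>
                   form (u i) (u j) = 0 \<and> form (w i) (w j) = 0)"

definition lattice_of :: "(nat \<Rightarrow> 'v) \<Rightarrow> (nat \<Rightarrow> 'v) \<Rightarrow> 'v set" where
  "lattice_of u w = {(\<Sum>i<n. c i *s u i) + (\<Sum>i<n. d i *s w i) | c d.
     (\<forall>i<n. c i \<in> \<O>) \<and> (\<forall>i<n. d i \<in> \<O>)}"

definition special :: "'v set set \<Rightarrow> bool" where
  "special t \<longleftrightarrow> vertex t \<and> (\<exists>u w a \<mu>. symplectic_basis u w \<and>
     t = hclass (lattice_of (\<lambda>i. (\<pi> powi a i) *s u i) (\<lambda>i. (\<pi> powi (\<mu> - a i)) *s w i)))"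

text \<open>
  \<open>acts_as e f g \<phi>\<close>: the endomorphism \<open>\<phi>\<close> has matrix \<open>g\<close> with respect to the ordered basis
  \<open>e 0, \<dots>, e (n - 1), f 0, \<dots>, f (n - 1)\<close>.
\<close>

definition acts_as :: "(nat \<Rightarrow> 'v) \<Rightarrow> (nat \<Rightarrow> 'v) \<Rightarrow> 'k mat \<Rightarrow> ('v \<Rightarrow> 'v) \<Rightarrow> bool" where
  "acts_as e f g \<phi> \<longleftrightarrow> Vector_Spaces.linear scale scale \<phi> \<and>
     (let b = (\<lambda>i. if i < n then e i else f (i - n))
      in \<forall>j<2 * n. \<phi> (b j) = (\<Sum>i<2 * n. (g $$ (i, j)) *s b i))"

definition has_type :: "(nat \<Rightarrow> 'v) \<Rightarrow> (nat \<Rightarrow> 'v) \<Rightarrow> 'v set set \<Rightarrow> int \<Rightarrow> bool" where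
  "has_type e f t \<tau> \<longleftrightarrow> (\<exists>L g \<phi>. t = hclass L \<and> g \<in> carrier_mat (2 * n) (2 * n) \<and>
     invertible_mat g \<and> acts_as e f g \<phi> \<and> L = \<phi> ` lattice_of e f \<and>
     \<tau> = ord (det g) mod int (2 * n))"

text \<open>
  The common number of chambers containing, respectively of vertices close to, any special
  vertex. The definite descriptions are meaningful because these numbers do not depend on
  the special vertex.
\<close>

definition r :: nat where
  "r = (if n = 1 then q + 1
        else (THE N. \<forall>t. special t \<longrightarrow> card {C. chamber C \<and> t \<in> C} = N))"

definition \<omega> :: nat where
  "\<omega> = (THE N. \<forall>t. special t \<longrightarrow> card {t'. vertex t' \<and> close t t'} = N)"

end

end

theory Submission
  imports Defs
begin

text \<open>
  Write \<open>L\<^sup>#\<close> for the dual of a lattice \<open>L\<close> with respect to the form. A homothety class is a vertex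
  of the building exactly if it contains a lattice \<open>X\<close> with
  \<open>\<pi>\<^sup>2 X\<^sup># \<subseteq> X \<subseteq> \<pi> X\<^sup>#\<close>; this \<open>X\<close> is then unique in its class, and two vertices are incident
  exactly if their lattices are comparable for inclusion. So the building is the order complex of the
  poset of these \<^emph>\<open>vertex lattices\<close>, and its chambers are the maximal chains. (The self-dual lattice
  \<open>L\<^sub>0\<close> that the definitions of vertex and incidence ask for always exists: below every vertex
  lattice there is one with \<open>\<pi>\<^sup>2 M\<^sup># = M\<close>, because \<open>X / \<pi>\<^sup>2 X\<^sup>#\<close> is a symplectic space over the residue
  field and every line in it is isotropic, so one can step down until that space vanishes.)

  The poset is graded: \<open>X / \<pi>\<^sup>2 X\<^sup>#\<close> and \<open>\<pi> X\<^sup># / X\<close> are symplectic of dimensions \<open>2 j\<close> and \<open>2 (n - j)\<close>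
  over the residue field, where \<open>j\<close> is the rank of \<open>X\<close>. Upper covers of \<open>X\<close> are the lines of the
  second space. Lower covers are, by duality, the lines of the first. A space of dimension \<open>2 i\<close> has
  \<open>N i = 1 + q + \<dots> + q\<^bsup>2 i - 1\<^esup>\<close> lines. Special vertices are the elements of rank \<open>0\<close> or \<open>n\<close>, and
  reversing the order exchanges the two ranks, so it is enough to treat rank \<open>0\<close>.

  Let \<open>t\<close> have rank \<open>0\<close>. Chambers through \<open>t\<close> are built by choosing successive covers, which gives
  \<open>N n \<cdot> N (n - 1) \<cdots> N 1\<close> of them. A vertex \<open>t'\<close> is close to \<open>t\<close> exactly if it has rank \<open>0\<close>, differs
  from \<open>t\<close>, and lies with \<open>t\<close> below some element \<open>y\<close> of rank \<open>1\<close>; then \<open>y\<close> is the sum of the two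
  lattices and hence unique. A gallery of length one from \<open>t\<close> to \<open>t'\<close> must exchange \<open>t\<close> for \<open>t'\<close> and keep
  everything else, so it is given by a maximal chain starting at \<open>y\<close>: there are
  \<open>N (n - 1) \<cdots> N 1\<close> of these, and this is also the number of chambers through a special vertex of the
  building with \<open>n - 1\<close> in place of \<open>n\<close>. Finally there are \<open>N n\<close> choices of \<open>y\<close> above \<open>t\<close>, each
  with \<open>N 1 - 1 = q\<close> further elements of rank \<open>0\<close> below it, whence \<open>N n \<cdot> q\<close> close vertices.

  The combinatorial half is carried out in the locale \<open>flag_poset\<close>, with conclusions
  \<open>card_maxchains\<close>, \<open>card_galleries\<close> and \<open>card_near\<close>. The lattice half rests on \<open>index_adjoin\<close>
  (enlarging a lattice by one vector has index \<open>q\<close>), \<open>index_perp\<close> (duality preserves indices) and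
  \<open>card_lines\<close>, and is assembled in \<open>vertex_poset\<close>.
\<close>

section \<open>Index of additive subgroups\<close>

definition add_subgroup :: "'a::ab_group_add set \<Rightarrow> bool" where
  "add_subgroup A \<longleftrightarrow> 0 \<in> A \<and> (\<forall>x\<in>A. \<forall>y\<in>A. x - y \<in> A)"

definition cosets :: "'a::ab_group_add set \<Rightarrow> 'a set \<Rightarrow> 'a set set" where
  "cosets A B = (\<lambda>x. (+) x ` A) ` B"

text \<open>Dimensions over the residue field are measured by the index, which for infinitely many cosets is \<open>0\<close>.\<close>

definition index :: "'a::ab_group_add set \<Rightarrow> 'a set \<Rightarrow> nat" where
  "index A B = card (cosets A B)"

lemma add_subgroup_closed:
  assumes "add_subgroup A"
  shows "0 \<in> A" "x \<in> A \<Longrightarrow> y \<in> A \<Longrightarrow> x - y \<in> A" "x \<in> A \<Longrightarrow> - x \<in> A"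
    "x \<in> A \<Longrightarrow> y \<in> A \<Longrightarrow> x + y \<in> A"
proof -
  show 0: "0 \<in> A" and d: "\<And>x y. x \<in> A \<Longrightarrow> y \<in> A \<Longrightarrow> x - y \<in> A"
    using assms by (auto simp: add_subgroup_def)
  show m: "- x \<in> A" if "x \<in> A" for x using d[OF 0 that] by simp
  show "x + y \<in> A" if "x \<in> A" "y \<in> A" using d[OF that(1) m[OF that(2)]] by simp
qed

lemma mem_coset_iff: "z \<in> (+) x ` A \<longleftrightarrow> z - x \<in> (A :: 'a::ab_group_add set)"
  by (metis add.commute diff_add_cancel imageE imageI add_diff_cancel_left')

lemma coset_eq_iff:
  assumes "add_subgroup A"
  shows "(+) x ` A = (+) y ` A \<longleftrightarrow> x - y \<in> A"
proof
  assume "(+) x ` A = (+) y ` A"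
  moreover have "x \<in> (+) x ` A"
    using add_subgroup_closed(1)[OF assms] by (simp add: mem_coset_iff)
  ultimately show "x - y \<in> A" by (simp add: mem_coset_iff)
next
  assume d: "x - y \<in> A"
  show "(+) x ` A = (+) y ` A"
  proof (rule Set.set_eqI)
    fix z
    have "z - y \<in> A" if "z - x \<in> A"
      using add_subgroup_closed(4)[OF assms that d] by simp
    moreover have "z - x \<in> A" if "z - y \<in> A"
      using add_subgroup_closed(2)[OF assms that d] by simp
    ultimately show "z \<in> (+) x ` A \<longleftrightarrow> z \<in> (+) y ` A" by (auto simp: mem_coset_iff)
  qed
qed

text \<open>
  A choice of representatives for the cosets of \<open>B\<close> in \<open>C\<close> translates the cosets of \<open>A\<close> in \<open>B\<close> to the
  cosets of \<open>A\<close> in \<open>C\<close>. The resulting bijection gives the formula in the infinite case as well.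
\<close>

lemma index_mult:
  assumes A: "add_subgroup A" and B: "add_subgroup B" and C: "add_subgroup C"
    and "A \<subseteq> B" "B \<subseteq> C"
  shows "index A C = index A B * index B C"
proof -
  define \<sigma> :: "'a set \<Rightarrow> 'a" where "\<sigma> X = (SOME x. x \<in> X)" for X
  have \<sigma>: "\<sigma> X \<in> C \<and> X = (+) (\<sigma> X) ` B" if X: "X \<in> cosets B C" for X
  proof -
    obtain x where x: "x \<in> C" "X = (+) x ` B" using X by (auto simp: cosets_def)
    have "x \<in> X" using x add_subgroup_closed(1)[OF B] by (simp add: mem_coset_iff)
    then have s: "\<sigma> X \<in> X" unfolding \<sigma>_def by (rule someI)
    then have d: "\<sigma> X - x \<in> B" using x by (simp add: mem_coset_iff)
    have "\<sigma> X = x + (\<sigma> X - x)" by simp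
    then have "\<sigma> X \<in> C"
      using add_subgroup_closed(4)[OF C x(1), of "\<sigma> X - x"] d \<open>B \<subseteq> C\<close> by auto
    then show ?thesis using coset_eq_iff[OF B, of "\<sigma> X" x] d x by simp
  qed
  have trans: "(+) a ` (+) b ` A = (+) (a + b) ` A" for a b :: 'a
    by (simp add: image_image add.assoc)
  have "bij_betw (\<lambda>(X, Y). (+) (\<sigma> X) ` Y) (cosets B C \<times> cosets A B) (cosets A C)"
    unfolding bij_betw_def
  proof
    show "inj_on (\<lambda>(X, Y). (+) (\<sigma> X) ` Y) (cosets B C \<times> cosets A B)"
    proof (rule inj_onI, clarify)
      fix X Y X' Y'
      assume X: "X \<in> cosets B C" "X' \<in> cosets B C" and Y: "Y \<in> cosets A B" "Y' \<in> cosets A B"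
        and eq: "(+) (\<sigma> X) ` Y = (+) (\<sigma> X') ` Y'"
      obtain y y' where y: "y \<in> B" "Y = (+) y ` A" "y' \<in> B" "Y' = (+) y' ` A"
        using Y by (auto simp: cosets_def)
      have d: "(\<sigma> X + y) - (\<sigma> X' + y') \<in> A"
        using eq coset_eq_iff[OF A] by (simp add: y trans)
      have "\<sigma> X - \<sigma> X' = ((\<sigma> X + y) - (\<sigma> X' + y')) - (y - y')" by simp
      then have "\<sigma> X - \<sigma> X' \<in> B"
        using d \<open>A \<subseteq> B\<close> add_subgroup_closed(2)[OF B] y by (metis subsetD)
      then have "X = X'" using \<sigma> X coset_eq_iff[OF B] by metis
      then show "X = X' \<and> Y = Y'" using d y coset_eq_iff[OF A] by simp
    qed
    show "(\<lambda>(X, Y). (+) (\<sigma> X) ` Y) ` (cosets B C \<times> cosets A B) = cosets A C"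
    proof
      show "(\<lambda>(X, Y). (+) (\<sigma> X) ` Y) ` (cosets B C \<times> cosets A B) \<subseteq> cosets A C"
      proof clarify
        fix X Y assume X: "X \<in> cosets B C" and "Y \<in> cosets A B"
        then obtain y where y: "y \<in> B" "Y = (+) y ` A" by (auto simp: cosets_def)
        have "\<sigma> X + y \<in> C" using \<sigma>[OF X] y \<open>B \<subseteq> C\<close> add_subgroup_closed(4)[OF C] by auto
        then show "(+) (\<sigma> X) ` Y \<in> cosets A C" using y by (auto simp: cosets_def trans)
      qed
      show "cosets A C \<subseteq> (\<lambda>(X, Y). (+) (\<sigma> X) ` Y) ` (cosets B C \<times> cosets A B)"
      proof
        fix Z assume "Z \<in> cosets A C"
        then obtain x where x: "x \<in> C" "Z = (+) x ` A" by (auto simp: cosets_def)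
        define X where "X = (+) x ` B"
        have X: "X \<in> cosets B C" using x by (auto simp: cosets_def X_def)
        have "x \<in> X" using add_subgroup_closed(1)[OF B] by (simp add: X_def mem_coset_iff)
        then have "x - \<sigma> X \<in> B" using \<sigma>[OF X] mem_coset_iff by metis
        then have "(+) (x - \<sigma> X) ` A \<in> cosets A B" by (auto simp: cosets_def)
        moreover have "Z = (+) (\<sigma> X) ` (+) (x - \<sigma> X) ` A" by (simp add: x trans)
        ultimately show "Z \<in> (\<lambda>(X, Y). (+) (\<sigma> X) ` Y) ` (cosets B C \<times> cosets A B)"
          using X by force
      qed
    qed
  qed
  then have "index A C = card (cosets B C \<times> cosets A B)"
    unfolding index_def by (metis bij_betw_same_card)
  then show ?thesis by (simp add: card_cartesian_product index_def mult.commute)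
qed

lemma cosets_self: "add_subgroup A \<Longrightarrow> cosets A A = {A}"
proof -
  assume A: "add_subgroup A"
  have "(+) x ` A = A" if "x \<in> A" for x
    using coset_eq_iff[OF A, of x 0] that by simp
  then show ?thesis using add_subgroup_closed(1)[OF A] by (auto simp: cosets_def)
qed

lemma index_self: "add_subgroup A \<Longrightarrow> index A A = 1"
  by (simp add: index_def cosets_self)

lemma index_eq_1:
  assumes "add_subgroup A" "A \<subseteq> B" "index A B = 1"
  shows "B = A"
proof -
  have A0: "0 \<in> A" using assms by (simp add: add_subgroup_closed)
  obtain X where X: "cosets A B = {X}" using assms(3) by (auto simp: index_def card_1_singleton_iff)
  have "(+) 0 ` A \<in> cosets A B" unfolding cosets_def using A0 assms(2) by blast
  moreover have "(+) x ` A \<in> cosets A B" if "x \<in> B" for x using that by (auto simp: cosets_def)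
  ultimately have "x \<in> A" if "x \<in> B" for x
    using X that coset_eq_iff[OF assms(1), of x 0] by auto
  then show ?thesis using assms(2) by auto
qed

text \<open>This connects the residue field, which is a quotient by a relation, with sets of cosets.\<close>

lemma card_quotient_kernel:
  "card (A // {(x, y). x \<in> A \<and> y \<in> A \<and> f x = f y}) = card (f ` A)"
proof -
  have "A // {(x, y). x \<in> A \<and> y \<in> A \<and> f x = f y} = (\<lambda>x. {y \<in> A. f x = f y}) ` A"
    unfolding quotient_def by auto
  also have "\<dots> = (\<lambda>z. {y \<in> A. z = f y}) ` f ` A" by (simp add: image_image)
  finally have "A // {(x, y). x \<in> A \<and> y \<in> A \<and> f x = f y} = (\<lambda>z. {y \<in> A. z = f y}) ` f ` A" .
  moreover have "inj_on (\<lambda>y. {x \<in> A. y = f x}) (f ` A)"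
    by (rule inj_onI) blast
  ultimately show ?thesis by (simp add: card_image)
qed

section \<open>Counting maximal chains in a graded poset\<close>

text \<open>
  The properties of the poset of vertex lattices that the count uses. They come in dual pairs, so
  that every result about elements of rank \<open>0\<close> also holds for those of rank \<open>n\<close> (theorem \<open>dual\<close>);
  the asymmetric assumption \<open>refine\<close> implies its own dual through \<open>refine_to\<close>.
\<close>

locale flag_poset =
  fixes P :: "'a set" and less :: "'a \<Rightarrow> 'a \<Rightarrow> bool" (infix "\<sqsubset>" 50)
    and rk :: "'a \<Rightarrow> nat" and n :: nat and N :: "nat \<Rightarrow> nat"
  assumes n_pos: "0 < n"
    and trans: "x \<sqsubset> y \<Longrightarrow> y \<sqsubset> z \<Longrightarrow> x \<sqsubset> z"
    and rk_le: "x \<in> P \<Longrightarrow> rk x \<le> n"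
    and rk_less: "x \<in> P \<Longrightarrow> y \<in> P \<Longrightarrow> x \<sqsubset> y \<Longrightarrow> rk x < rk y"
    and refine: "x \<in> P \<Longrightarrow> y \<in> P \<Longrightarrow> x \<sqsubset> y \<Longrightarrow>
      \<exists>z\<in>P. x \<sqsubset> z \<and> rk z = Suc (rk x) \<and> (z = y \<or> z \<sqsubset> y)"
    and card_up: "x \<in> P \<Longrightarrow> rk x < n \<Longrightarrow> card {y \<in> P. x \<sqsubset> y \<and> rk y = Suc (rk x)} = N (n - rk x)"
    and card_down: "y \<in> P \<Longrightarrow> 0 < rk y \<Longrightarrow> card {x \<in> P. x \<sqsubset> y \<and> rk y = Suc (rk x)} = N (rk y)"
    and N_pos: "0 < i \<Longrightarrow> 0 < N i"
    and join_unique: "\<lbrakk>x \<in> P; x' \<in> P; x \<noteq> x'; y \<in> P; y' \<in> P; rk x = 0; rk x' = 0; rk y = 1; rk y' = 1;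
        x \<sqsubset> y; x' \<sqsubset> y; x \<sqsubset> y'; x' \<sqsubset> y'\<rbrakk> \<Longrightarrow> y = y'"
    and meet_unique: "\<lbrakk>x \<in> P; x' \<in> P; x \<noteq> x'; y \<in> P; y' \<in> P; rk x = n; rk x' = n; Suc (rk y) = n; Suc (rk y') = n;
        y \<sqsubset> x; y \<sqsubset> x'; y' \<sqsubset> x; y' \<sqsubset> x'\<rbrakk> \<Longrightarrow> y = y'"
begin

lemma refine_to:
  assumes "x \<in> P" "y \<in> P" "x \<sqsubset> y" "rk x < i" "i < rk y"
  shows "\<exists>z\<in>P. x \<sqsubset> z \<and> rk z = i \<and> z \<sqsubset> y"
  using assms(4,5)
proof (induction i)
  case (Suc i)
  show ?case
  proof (cases "rk x = i")
    case True
    then show ?thesis using refine[OF assms(1-3)] Suc.prems by fastforce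
  next
    case False
    then obtain z where z: "z \<in> P" "x \<sqsubset> z" "rk z = i" "z \<sqsubset> y" using Suc by auto
    obtain z' where z': "z' \<in> P" "z \<sqsubset> z'" "rk z' = Suc i" "z' = y \<or> z' \<sqsubset> y"
      using refine[OF z(1) assms(2) z(4)] z(3) by auto
    then have "z' \<sqsubset> y" using Suc.prems by auto
    then show ?thesis using z' trans[OF z(2) z'(2)] by blast
  qed
qed simp

lemma up_finite_nonempty:
  assumes "x \<in> P" "rk x < n"
  shows "finite {y \<in> P. x \<sqsubset> y \<and> rk y = Suc (rk x)}" "{y \<in> P. x \<sqsubset> y \<and> rk y = Suc (rk x)} \<noteq> {}"
proof -
  have "card {y \<in> P. x \<sqsubset> y \<and> rk y = Suc (rk x)} > 0" using card_up assms N_pos by simp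
  then show "finite {y \<in> P. x \<sqsubset> y \<and> rk y = Suc (rk x)}" "{y \<in> P. x \<sqsubset> y \<and> rk y = Suc (rk x)} \<noteq> {}"
    by (simp_all add: card_gt_0_iff)
qed

lemma down_finite_nonempty:
  assumes "y \<in> P" "0 < rk y"
  shows "finite {x \<in> P. x \<sqsubset> y \<and> rk y = Suc (rk x)}" "{x \<in> P. x \<sqsubset> y \<and> rk y = Suc (rk x)} \<noteq> {}"
proof -
  have "card {x \<in> P. x \<sqsubset> y \<and> rk y = Suc (rk x)} > 0" using card_down assms N_pos by simp
  then show "finite {x \<in> P. x \<sqsubset> y \<and> rk y = Suc (rk x)}" "{x \<in> P. x \<sqsubset> y \<and> rk y = Suc (rk x)} \<noteq> {}"
    by (simp_all add: card_gt_0_iff)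
qed

theorem dual: "flag_poset P (\<lambda>x y. y \<sqsubset> x) (\<lambda>x. n - rk x) n N"
proof
  fix x y assume xy: "x \<in> P" "y \<in> P" "y \<sqsubset> x"
  show "n - rk x < n - rk y" using rk_less[OF xy(2,1,3)] rk_le[OF xy(1)] by simp
  show "\<exists>z\<in>P. z \<sqsubset> x \<and> n - rk z = Suc (n - rk x) \<and> (z = y \<or> y \<sqsubset> z)"
  proof (cases "Suc (rk y) = rk x")
    case True
    then show ?thesis using xy rk_le[OF xy(1)] by (intro bexI[of _ y]) auto
  next
    case False
    then show ?thesis
      using refine_to[OF xy(2,1,3), of "rk x - 1"] rk_less[OF xy(2,1,3)] rk_le[OF xy(1)] by fastforce
  qed
next
  fix x assume x: "x \<in> P" "n - rk x < n"
  have "{y \<in> P. y \<sqsubset> x \<and> n - rk y = Suc (n - rk x)} = {y \<in> P. y \<sqsubset> x \<and> rk x = Suc (rk y)}"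
    using rk_le[OF x(1)] x rk_less[OF _ x(1)] by fastforce
  then show "card {y \<in> P. y \<sqsubset> x \<and> n - rk y = Suc (n - rk x)} = N (n - (n - rk x))"
    using card_down[OF x(1)] x rk_le[OF x(1)] by simp
next
  fix x assume x: "x \<in> P" "0 < n - rk x"
  have "{y \<in> P. x \<sqsubset> y \<and> n - rk x = Suc (n - rk y)} = {y \<in> P. x \<sqsubset> y \<and> rk y = Suc (rk x)}"
    using rk_le x rk_less[OF x(1)] by fastforce
  then show "card {y \<in> P. x \<sqsubset> y \<and> n - rk x = Suc (n - rk y)} = N (n - rk x)"
    using card_up[OF x(1)] x by simp
next
  fix x x' y y'
  assume *: "x \<in> P" "x' \<in> P" "x \<noteq> x'" "y \<in> P" "y' \<in> P"
    and r: "n - rk x = 0" "n - rk x' = 0" "n - rk y = 1" "n - rk y' = 1"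
    and l: "y \<sqsubset> x" "y \<sqsubset> x'" "y' \<sqsubset> x" "y' \<sqsubset> x'"
  have "rk x = n" "rk x' = n" "Suc (rk y) = n" "Suc (rk y') = n"
    using r rk_le * by (auto simp: le_antisym)
  then show "y = y'" using meet_unique * l by blast
next
  fix x x' y y'
  assume *: "x \<in> P" "x' \<in> P" "x \<noteq> x'" "y \<in> P" "y' \<in> P"
    and r: "n - rk x = n" "n - rk x' = n" "Suc (n - rk y) = n" "Suc (n - rk y') = n"
    and l: "x \<sqsubset> y" "x' \<sqsubset> y" "x \<sqsubset> y'" "x' \<sqsubset> y'"
  have "rk x = 0" "rk x' = 0" "rk y = 1" "rk y' = 1"
    using r n_pos rk_le[OF *(1)] rk_le[OF *(2)] rk_le[OF *(4)] rk_le[OF *(5)] by linarith+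
  then show "y = y'" using join_unique * l by blast
qed (use n_pos trans N_pos in auto)

text \<open>
  The next four definitions copy the notions of simplex, chamber, adjacency and closeness of the
  building, with comparability in place of incidence. They are symmetric in the order relation.
\<close>

definition chain :: "'a set \<Rightarrow> bool" where
  "chain S \<longleftrightarrow> finite S \<and> S \<subseteq> P \<and> pairwise (\<lambda>x y. x \<sqsubset> y \<or> y \<sqsubset> x) S"

definition maxchain :: "'a set \<Rightarrow> bool" where
  "maxchain C \<longleftrightarrow> chain C \<and> (\<forall>S. chain S \<longrightarrow> C \<subseteq> S \<longrightarrow> S = C)"

definition adj :: "'a set \<Rightarrow> 'a set \<Rightarrow> bool" where
  "adj C C' \<longleftrightarrow> maxchain C \<and> maxchain C' \<and>
     (\<exists>F. chain F \<and> F \<subseteq> C \<and> F \<subseteq> C' \<and> card F + 1 = card C \<and> card F + 1 = card C')"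

definition near :: "'a \<Rightarrow> 'a \<Rightarrow> bool" where
  "near t t' \<longleftrightarrow> t \<in> P \<and> t' \<in> P \<and>
     (\<exists>C C'. adj C C' \<and> t \<in> C \<and> t' \<in> C' \<and> t \<notin> C \<inter> C' \<and> t' \<notin> C \<inter> C')"

lemma chain_less:
  assumes "chain C" "x \<in> C" "y \<in> C" "rk x < rk y"
  shows "x \<sqsubset> y"
proof -
  have "x \<sqsubset> y \<or> y \<sqsubset> x" using assms by (auto simp: chain_def pairwise_def)
  then show ?thesis using assms rk_less[of y x] by (auto simp: chain_def)
qed

lemma chain_inj:
  assumes "chain C"
  shows "inj_on rk C"
proof (rule inj_onI, rule ccontr)
  fix x y assume xy: "x \<in> C" "y \<in> C" "rk x = rk y" "x \<noteq> y"
  then have "x \<sqsubset> y \<or> y \<sqsubset> x" using assms by (auto simp: chain_def pairwise_def)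
  moreover have "x \<in> P" "y \<in> P" using xy assms by (auto simp: chain_def)
  ultimately show False using rk_less[of x y] rk_less[of y x] xy by auto
qed

lemma chain_subset: "chain C \<Longrightarrow> D \<subseteq> C \<Longrightarrow> chain D"
  by (meson chain_def finite_subset pairwise_subset subset_trans)

lemma chain_insert:
  assumes "chain C" "z \<in> P" "\<And>x. x \<in> C \<Longrightarrow> x \<sqsubset> z \<or> z \<sqsubset> x"
  shows "chain (insert z C)"
  using assms by (auto simp: chain_def pairwise_insert)

text \<open>
  If a chain misses rank \<open>i\<close>, an element can be inserted between its parts below and above \<open>i\<close>: strictly
  between them by refinement, or as a cover of the one part that is present. A maximal chain thus meets
  every rank, and conversely no second element of a given rank fits into a chain.
\<close>

lemma maxchain_iff:
  assumes "C \<noteq> {}"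
  shows "maxchain C \<longleftrightarrow> chain C \<and> rk ` C = {..n}"
proof
  assume *: "chain C \<and> rk ` C = {..n}"
  have "S = C" if S: "chain S" "C \<subseteq> S" for S
  proof -
    have "S \<subseteq> P" using S by (simp add: chain_def)
    then have "rk ` S \<subseteq> {..n}" using rk_le by auto
    then have "\<exists>y\<in>C. rk x = rk y" if "x \<in> S" for x using * that by (metis image_iff subsetD)
    then have "S \<subseteq> C" using chain_inj[OF S(1)] S(2) by (metis inj_onD subsetD subsetI)
    then show ?thesis using S by simp
  qed
  then show "maxchain C" using * by (simp add: maxchain_def)
next
  assume m: "maxchain C"
  then have c: "chain C" by (simp add: maxchain_def)
  then have CP: "C \<subseteq> P" and fin: "finite C" by (auto simp: chain_def)
  have "i \<in> rk ` C" if i: "i \<le> n" for i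
  proof (rule ccontr)
    assume ni: "i \<notin> rk ` C"
    define lo where "lo = {x \<in> C. rk x < i}"
    define hi where "hi = {x \<in> C. i < rk x}"
    have C: "C = lo \<union> hi" using ni by (auto simp: lo_def hi_def)
    have lo: "\<exists>x\<in>lo. \<forall>x'\<in>lo. x' = x \<or> x' \<sqsubset> x" if ne: "lo \<noteq> {}"
    proof -
      have "finite lo" using fin by (simp add: lo_def)
      then have f: "finite (rk ` lo)" "rk ` lo \<noteq> {}" using ne by auto
      obtain x where x: "x \<in> lo" "rk x = Max (rk ` lo)" using Max_in[OF f] by auto
      have "\<forall>x'\<in>lo. rk x' \<le> rk x" using x(2) Max_ge[OF f(1)] by simp
      note x = x(1) this
      have "x' = x \<or> x' \<sqsubset> x" if "x' \<in> lo" for x'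
        using x that chain_less[OF c, of x' x] chain_inj[OF c] by (force simp: lo_def inj_on_def)
      then show ?thesis using x by blast
    qed
    have hi: "\<exists>x\<in>hi. \<forall>x'\<in>hi. x' = x \<or> x \<sqsubset> x'" if ne: "hi \<noteq> {}"
    proof -
      have "finite hi" using fin by (simp add: hi_def)
      then have f: "finite (rk ` hi)" "rk ` hi \<noteq> {}" using ne by auto
      obtain x where x: "x \<in> hi" "rk x = Min (rk ` hi)" using Min_in[OF f] by auto
      have "\<forall>x'\<in>hi. rk x \<le> rk x'" using x(2) Min_le[OF f(1)] by simp
      note x = x(1) this
      have "x' = x \<or> x \<sqsubset> x'" if "x' \<in> hi" for x'
        using x that chain_less[OF c, of x x'] chain_inj[OF c] by (force simp: hi_def inj_on_def)
      then show ?thesis using x by blast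
    qed
    have "\<exists>z\<in>P. (\<forall>x\<in>lo. x \<sqsubset> z) \<and> (\<forall>y\<in>hi. z \<sqsubset> y)"
    proof (cases "lo = {}")
      case True
      then have "hi \<noteq> {}" using C assms by auto
      from hi[OF this] obtain y where y: "y \<in> hi" "\<forall>y'\<in>hi. y' = y \<or> y \<sqsubset> y'" ..
      then have "y \<in> P" "0 < rk y" using CP by (auto simp: hi_def)
      then have "{x \<in> P. x \<sqsubset> y \<and> rk y = Suc (rk x)} \<noteq> {}"
        by (rule down_finite_nonempty)
      then obtain z where z: "z \<in> P" "z \<sqsubset> y" by auto
      have "z \<sqsubset> y'" if "y' \<in> hi" for y' using y(2) that z(2) trans[OF z(2)] by metis
      then show ?thesis using True z(1) by auto
    next
      case False
      from lo[OF this] obtain x where x: "x \<in> lo" "\<forall>x'\<in>lo. x' = x \<or> x' \<sqsubset> x" ..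
      then have xP: "x \<in> P" "rk x < i" using CP by (auto simp: lo_def)
      show ?thesis
      proof (cases "hi = {}")
        case True
        have "{y \<in> P. x \<sqsubset> y \<and> rk y = Suc (rk x)} \<noteq> {}"
          using up_finite_nonempty(2)[OF xP(1)] xP(2) i by simp
        then obtain z where z: "z \<in> P" "x \<sqsubset> z" by auto
        have "x' \<sqsubset> z" if "x' \<in> lo" for x' using x(2) that z(2) trans[OF _ z(2)] by metis
        then show ?thesis using True z(1) by auto
      next
        case False
        from hi[OF this] obtain y where y: "y \<in> hi" "\<forall>y'\<in>hi. y' = y \<or> y \<sqsubset> y'" ..
        then have yP: "y \<in> P" "i < rk y" using CP by (auto simp: hi_def)
        have "x \<sqsubset> y" using chain_less[OF c, of x y] x(1) y(1) by (auto simp: lo_def hi_def)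
        from refine_to[OF xP(1) yP(1) this xP(2) yP(2)]
        obtain z where z: "z \<in> P" "x \<sqsubset> z" "z \<sqsubset> y" by auto
        have "x' \<sqsubset> z" if "x' \<in> lo" for x' using x(2) that z(2) trans[OF _ z(2)] by metis
        moreover have "z \<sqsubset> y'" if "y' \<in> hi" for y' using y(2) that z(3) trans[OF z(3)] by metis
        ultimately show ?thesis using z(1) by auto
      qed
    qed
    then obtain z where z: "z \<in> P" "\<forall>x\<in>lo. x \<sqsubset> z" "\<forall>y\<in>hi. z \<sqsubset> y" by blast
    then have "chain (insert z C)" using chain_insert[OF c z(1)] C by blast
    then have "z \<in> C" using m by (auto simp: maxchain_def)
    moreover have "\<not> z \<sqsubset> z" using rk_less[OF z(1,1)] by blast
    then have "z \<notin> lo" "z \<notin> hi" using z(2,3) by auto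
    ultimately show False using C by auto
  qed
  then show "chain C \<and> rk ` C = {..n}" using c CP rk_le by auto
qed

definition flags :: "'a \<Rightarrow> 'a set set" where
  "flags x = {C. chain C \<and> x \<in> C \<and> rk ` C = {rk x..n}}"

lemma flags_rank_0: "rk t = 0 \<Longrightarrow> {C. maxchain C \<and> t \<in> C} = flags t"
proof -
  assume "rk t = 0"
  moreover have "maxchain C \<longleftrightarrow> chain C \<and> rk ` C = {0..n}" if "t \<in> C" for C
    using maxchain_iff[of C] that by (auto simp: atMost_atLeast0)
  ultimately show ?thesis by (auto simp: flags_def)
qed

lemma flags_member:
  assumes "C \<in> flags x" "z \<in> C"
  shows "z = x \<or> x \<sqsubset> z"
proof -
  have "rk x \<le> rk z" using assms by (auto simp: flags_def)
  then show ?thesis using chain_less[of C x z] chain_inj[of C] assms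
    by (auto simp: flags_def inj_on_def le_less)
qed

lemma flags_insert:
  assumes "C \<in> flags y" "x \<in> P" "x \<sqsubset> y" "rk y = Suc (rk x)"
  shows "insert x C \<in> flags x" "x \<notin> C"
proof -
  have le: "rk x \<le> n" using rk_le assms by simp
  have "x \<sqsubset> z" if "z \<in> C" for z using flags_member[OF assms(1) that] assms trans by blast
  then have "chain (insert x C)" using chain_insert assms by (auto simp: flags_def)
  moreover have "rk ` insert x C = {rk x..n}" using assms le by (auto simp: flags_def)
  ultimately show "insert x C \<in> flags x" by (simp add: flags_def)
  have "rk x \<notin> rk ` C" using assms by (simp add: flags_def)
  then show "x \<notin> C" by blast
qed

lemma flags_remove:
  assumes "C \<in> flags x" "rk x < n"
  obtains y where "y \<in> P" "x \<sqsubset> y" "rk y = Suc (rk x)" "C - {x} \<in> flags y" "C = insert x (C - {x})"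
proof -
  have c: "chain C" "x \<in> C" "rk ` C = {rk x..n}" using assms by (auto simp: flags_def)
  then have "Suc (rk x) \<in> rk ` C" using assms by simp
  then obtain y where y: "y \<in> C" "rk y = Suc (rk x)" by auto
  have "rk ` (C - {x}) = rk ` C - {rk x}" using c inj_on_image_set_diff[OF chain_inj[OF c(1)], of C "{x}"] by simp
  then have "rk ` (C - {x}) = {rk y..n}" using c y by auto
  moreover have "chain (C - {x})" using c chain_subset by blast
  ultimately have "C - {x} \<in> flags y" using y by (auto simp: flags_def)
  moreover have "y \<in> P" "x \<sqsubset> y" using y c chain_less[OF c(1,2) y(1)] by (auto simp: chain_def)
  ultimately show ?thesis using that y c by blast
qed

text \<open>
  A maximal chain starting at \<open>x\<close> is determined by its second element, a cover \<open>y\<close> of \<open>x\<close>, and a maximal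
  chain starting at \<open>y\<close>.
\<close>

lemma card_flags:
  assumes "x \<in> P"
  shows "card (flags x) = (\<Prod>i=1..n - rk x. N i)"
  using assms
proof (induction "n - rk x" arbitrary: x)
  case 0
  then have x: "rk x = n" using rk_le[of x] by simp
  have "C = {x}" if C: "C \<in> flags x" for C
  proof -
    have "z = x" if "z \<in> C" for z
      using C that x chain_inj[of C] by (auto simp: flags_def inj_on_def)
    then show ?thesis using C by (auto simp: flags_def)
  qed
  moreover have "{x} \<in> flags x" using 0 x by (simp add: flags_def chain_def)
  ultimately have "flags x = {{x}}" by blast
  then show ?case using x by simp
next
  case (Suc d)
  then have x: "rk x < n" by simp
  define U where "U = {y \<in> P. x \<sqsubset> y \<and> rk y = Suc (rk x)}"
  have cU: "card U = N (n - rk x)" using card_up[OF Suc.prems x] by (simp add: U_def)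
  have fU: "finite U" unfolding U_def by (rule up_finite_nonempty[OF Suc.prems x])
  have fl: "flags x = (\<Union>y\<in>U. insert x ` flags y)"
  proof (intro equalityI subsetI)
    fix C assume C: "C \<in> flags x"
    obtain y where y: "y \<in> P" "x \<sqsubset> y" "rk y = Suc (rk x)" "C - {x} \<in> flags y" "C = insert x (C - {x})"
      by (rule flags_remove[OF C x])
    have "y \<in> U" using y by (simp add: U_def)
    moreover have "C \<in> insert x ` flags y" using y(4,5) by (rule rev_image_eqI)
    ultimately show "C \<in> (\<Union>y\<in>U. insert x ` flags y)" by blast
  next
    fix C assume "C \<in> (\<Union>y\<in>U. insert x ` flags y)"
    then obtain y D where "y \<in> U" "D \<in> flags y" "C = insert x D" by blast
    then show "C \<in> flags x" using flags_insert(1)[of D y x] Suc.prems by (simp add: U_def)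
  qed
  have card: "card (insert x ` flags y) = (\<Prod>i=1..d. N i)" if y: "y \<in> U" for y
  proof -
    have "x \<notin> C" if "C \<in> flags y" for C
      using flags_insert(2)[OF that Suc.prems] y by (simp add: U_def)
    then have "inj_on (insert x) (flags y)" by (intro inj_onI) (metis insert_ident)
    moreover have "card (flags y) = (\<Prod>i=1..n - rk y. N i)" using Suc y by (simp add: U_def)
    moreover have "n - rk y = d" using Suc y by (simp add: U_def)
    ultimately show ?thesis by (simp add: card_image)
  qed
  have pos: "(\<Prod>i=1..d. N i) > 0" using N_pos by (auto intro: prod_pos)
  have disj: "insert x ` flags y \<inter> insert x ` flags y' = {}" if "y \<in> U" "y' \<in> U" "y \<noteq> y'" for y y'
  proof (rule ccontr)
    assume "insert x ` flags y \<inter> insert x ` flags y' \<noteq> {}"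
    then obtain C C' where C: "C \<in> flags y" "C' \<in> flags y'" "insert x C = insert x C'" by blast
    then have "insert x C \<in> flags x" "y \<in> insert x C" "y' \<in> insert x C"
      using flags_insert[OF C(1) Suc.prems] that by (auto simp: U_def flags_def)
    then show False using that chain_inj[of "insert x C"] by (auto simp: U_def flags_def inj_on_def)
  qed
  have "card (flags x) = (\<Sum>y\<in>U. card (insert x ` flags y))"
    unfolding fl
  proof (rule card_UN_disjoint[OF fU])
    show "\<forall>y\<in>U. finite (insert x ` flags y)" using card pos by (simp add: card_ge_0_finite)
    show "\<forall>y\<in>U. \<forall>y'\<in>U. y \<noteq> y' \<longrightarrow> insert x ` flags y \<inter> insert x ` flags y' = {}"
      using disj by blast
  qed
  also have "\<dots> = N (Suc d) * (\<Prod>i=1..d. N i)" using card cU Suc by simp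
  finally show ?case unfolding Suc(2)[symmetric] by (simp add: mult.commute)
qed

theorem card_maxchains:
  assumes "t \<in> P" "rk t = 0"
  shows "card {C. maxchain C \<and> t \<in> C} = (\<Prod>i=1..n. N i)"
proof -
  have "n - rk t = n" using assms(2) by simp
  then show ?thesis using card_flags[OF assms(1)] flags_rank_0[OF assms(2)] by metis
qed

text \<open>
  The common face \<open>F\<close> of two adjacent chambers omits one element of each. If \<open>C'\<close> does not contain \<open>t\<close>, the
  element omitted from \<open>C\<close> is \<open>t\<close>, and the one omitted from \<open>C'\<close> must fill the same gap in rank.
\<close>

lemma adj_exchange:
  assumes "adj C C'" "t \<in> C" "t' \<in> C'" "t \<notin> C'" "rk t = 0"
  shows "rk t' = 0 \<or> t' \<in> C"
    and "\<exists>s y F. y \<in> P \<and> rk y = 1 \<and> F \<in> flags y \<and> C = insert t F \<and> C' = insert s F \<and>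
      rk s = 0 \<and> t \<sqsubset> y \<and> s \<sqsubset> y \<and> t \<notin> F \<and> s \<notin> F"
proof -
  obtain F where F: "chain F" "F \<subseteq> C" "F \<subseteq> C'" "card F + 1 = card C" "card F + 1 = card C'"
    and m: "maxchain C" "maxchain C'" using assms(1) by (auto simp: adj_def)
  have c: "chain C" "rk ` C = {..n}" "chain C'" "rk ` C' = {..n}"
    using m assms maxchain_iff by blast+
  have fin: "finite C" "finite C'" using c by (auto simp: chain_def)
  have fF: "finite F" using F(1) by (simp add: chain_def)
  have "card (C - F) = 1" using F(4) card_Diff_subset[OF fF F(2)] by linarith
  moreover have "t \<in> C - F" using assms F by auto
  ultimately have CF: "C - F = {t}" by (metis card_1_singletonE singletonD)
  have "card (C' - F) = 1" using F(5) card_Diff_subset[OF fF F(3)] by linarith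
  then obtain s where s: "C' - F = {s}" by (rule card_1_singletonE)
  have F1: "F = C - {t}" "C = insert t F" "t \<notin> F" using CF F by auto
  have F2: "F = C' - {s}" "C' = insert s F" "s \<notin> F" using s F by auto
  have "C \<in> flags t" using c(1,2) assms(2,5) by (auto simp: flags_def)
  then obtain y where y: "y \<in> P" "t \<sqsubset> y" "rk y = Suc (rk t)" "F \<in> flags y"
    using flags_remove[of C t] n_pos assms(5) F1(1) by metis
  have rs: "rk s = 0"
  proof (rule ccontr)
    assume "rk s \<noteq> 0"
    moreover have "0 \<in> rk ` C'" using c by simp
    ultimately have "0 \<in> rk ` F" using F2(2) by auto
    then show False using F1(2,3) chain_inj[OF c(1)] assms(5) by (auto simp: inj_on_def)
  qed
  have "y \<in> F" using y by (simp add: flags_def)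
  then have sy: "s \<sqsubset> y" using chain_less[OF c(3), of s y] F2(2) y(3) rs by simp
  show "\<exists>s y F. y \<in> P \<and> rk y = 1 \<and> F \<in> flags y \<and> C = insert t F \<and> C' = insert s F \<and>
      rk s = 0 \<and> t \<sqsubset> y \<and> s \<sqsubset> y \<and> t \<notin> F \<and> s \<notin> F" 
  proof (intro exI conjI)
    show "rk y = 1" using y(3) assms(5) by simp
  qed (fact y F1(2,3) F2(2,3) rs sy)+
  show "rk t' = 0 \<or> t' \<in> C" using assms(3) F1(2) F2(2) rs by auto
qed

lemma flags_adj:
  assumes "F \<in> flags y" "y \<in> P" "rk y = 1" "t \<in> P" "t' \<in> P" "rk t = 0" "rk t' = 0" "t \<sqsubset> y" "t' \<sqsubset> y"
  shows "adj (insert t F) (insert t' F)"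
proof -
  have fl: "insert t F \<in> flags t" "insert t' F \<in> flags t'" "t \<notin> F" "t' \<notin> F"
    using flags_insert[OF assms(1)] assms by auto
  then have "maxchain (insert t F)" "maxchain (insert t' F)"
    using flags_rank_0 assms(6,7) by blast+
  moreover have "chain F" "finite F" using assms(1) by (auto simp: flags_def chain_def)
  ultimately show ?thesis using fl unfolding adj_def by (metis One_nat_def Suc_eq_plus1 card_insert_disjoint subset_insertI)
qed

lemma flags_nonempty:
  assumes "y \<in> P"
  shows "flags y \<noteq> {}"
proof -
  have "(\<Prod>i=1..n - rk y. N i) > 0" using N_pos by (intro prod_pos) auto
  then show ?thesis using card_flags[OF assms] by (metis card.empty less_irrefl)
qed

lemma near_iff:
  assumes "rk t = 0"
  shows "near t t' \<longleftrightarrow> t \<in> P \<and> t' \<in> P \<and> t' \<noteq> t \<and> rk t' = 0 \<and> (\<exists>y\<in>P. rk y = 1 \<and> t \<sqsubset> y \<and> t' \<sqsubset> y)"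
proof
  assume "near t t'"
  then obtain C C' where C: "t \<in> P" "t' \<in> P" "adj C C'" "t \<in> C" "t' \<in> C'" "t \<notin> C'" "t' \<notin> C"
    by (auto simp: near_def)
  obtain s y F where y: "y \<in> P" "rk y = 1" "F \<in> flags y" "C = insert t F" "C' = insert s F"
      "t \<sqsubset> y" "s \<sqsubset> y"
    using adj_exchange(2)[OF C(3-6) assms] by blast
  then have "s = t'" using C by auto
  then show "t \<in> P \<and> t' \<in> P \<and> t' \<noteq> t \<and> rk t' = 0 \<and> (\<exists>y\<in>P. rk y = 1 \<and> t \<sqsubset> y \<and> t' \<sqsubset> y)"
    using C y adj_exchange(1)[OF C(3-6) assms] by blast
next
  assume *: "t \<in> P \<and> t' \<in> P \<and> t' \<noteq> t \<and> rk t' = 0 \<and> (\<exists>y\<in>P. rk y = 1 \<and> t \<sqsubset> y \<and> t' \<sqsubset> y)"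
  then obtain y where y: "y \<in> P" "rk y = 1" "t \<sqsubset> y" "t' \<sqsubset> y" by blast
  obtain F where F: "F \<in> flags y" using flags_nonempty y by blast
  have "t \<notin> F" "t' \<notin> F" using flags_insert(2)[OF F] * assms y by auto
  then show "near t t'"
    using flags_adj[OF F y(1,2)] * assms y unfolding near_def by blast
qed

text \<open>
  The chamber ending the gallery contains \<open>t'\<close> and so, by rank, not \<open>t\<close>. Both chambers then arise from
  one maximal chain \<open>F\<close> above an element of rank \<open>1\<close>, which is the same for all galleries because
  \<open>t\<close> and \<open>t'\<close> have at most one common upper cover.
\<close>

theorem card_galleries:
  assumes "near t t'" "rk t = 0"
  shows "card {(C, C'). adj C C' \<and> t \<in> C \<and> t' \<in> C'} = (\<Prod>i=1..n - 1. N i)"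
proof -
  obtain y where t: "t \<in> P" "t' \<in> P" "t' \<noteq> t" "rk t' = 0" and y: "y \<in> P" "rk y = 1" "t \<sqsubset> y" "t' \<sqsubset> y"
    using assms(1) unfolding near_iff[OF assms(2)] by auto
  have "{(C, C'). adj C C' \<and> t \<in> C \<and> t' \<in> C'} = (\<lambda>F. (insert t F, insert t' F)) ` flags y"
  proof (intro equalityI subsetI)
    fix z assume "z \<in> {(C, C'). adj C C' \<and> t \<in> C \<and> t' \<in> C'}"
    then obtain C C' where z: "z = (C, C')" "adj C C'" "t \<in> C" "t' \<in> C'" by blast
    have "maxchain C'" using z by (simp add: adj_def)
    then have "inj_on rk C'" using chain_inj by (simp add: maxchain_def)
    then have "t \<notin> C'" using z t assms(2) by (auto simp: inj_on_def)
    from adj_exchange(2)[OF z(2-4) this assms(2)]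
    obtain s y' F where F: "y' \<in> P" "rk y' = 1" "F \<in> flags y'" "C = insert t F" "C' = insert s F"
      "rk s = 0" "t \<sqsubset> y'" "s \<sqsubset> y'"
      by auto
    have "rk t' \<notin> rk ` F" using F(2,3) t(4) by (simp add: flags_def)
    then have "t' \<notin> F" by blast
    then have "s = t'" using z(4) unfolding F(5) by simp
    then have "y' = y" using join_unique[of t t' y' y] t y F assms(2) by simp
    then show "z \<in> (\<lambda>F. (insert t F, insert t' F)) ` flags y"
      using F(3) unfolding z(1) F(4,5) \<open>s = t'\<close> by (intro image_eqI[of _ _ F]) simp_all
  next
    fix z assume "z \<in> (\<lambda>F. (insert t F, insert t' F)) ` flags y"
    then show "z \<in> {(C, C'). adj C C' \<and> t \<in> C \<and> t' \<in> C'}"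
      using flags_adj[OF _ y(1,2) t(1,2) assms(2) t(4) y(3,4)] by auto
  qed
  moreover have "t \<notin> F" if "F \<in> flags y" for F
    using flags_insert(2)[OF that t(1) y(3)] y(2) assms(2) by simp
  then have "inj_on (\<lambda>F. (insert t F, insert t' F)) (flags y)"
    by (intro inj_onI) (metis Pair_inject insert_ident)
  ultimately show ?thesis using card_flags[OF y(1)] y(2) by (simp add: card_image)
qed

text \<open>
  The close vertices are sorted by the common upper cover; \<open>join_unique\<close> makes this a partition.
\<close>

theorem card_near:
  assumes "t \<in> P" "rk t = 0"
  shows "card {t'. t' \<in> P \<and> near t t'} = N n * (N 1 - 1)"
proof -
  define U where "U = {y \<in> P. t \<sqsubset> y \<and> rk y = 1}"
  define V where "V y = {x \<in> P. x \<sqsubset> y \<and> rk x = 0}" for y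
  have cU: "card U = N n" using card_up[OF assms(1)] n_pos assms(2) by (simp add: U_def)
  have fU: "finite U" using cU N_pos[OF n_pos] by (metis card.infinite less_irrefl)
  have cV: "card (V y) = N 1 \<and> finite (V y)" if "y \<in> U" for y
  proof -
    have "V y = {x \<in> P. x \<sqsubset> y \<and> rk y = Suc (rk x)}" using that by (auto simp: V_def U_def)
    then have "card (V y) = N 1" using card_down[of y] that by (simp add: U_def)
    then show ?thesis using N_pos[of 1] by (auto intro: card_ge_0_finite)
  qed
  have "{t'. t' \<in> P \<and> near t t'} = (\<Union>y\<in>U. V y - {t})"
    using near_iff[OF assms(2)] assms by (auto simp: U_def V_def)
  moreover have "card (\<Union>y\<in>U. V y - {t}) = (\<Sum>y\<in>U. card (V y - {t}))"
  proof (rule card_UN_disjoint[OF fU])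
    show "\<forall>y\<in>U. finite (V y - {t})" using cV by simp
    show "\<forall>y\<in>U. \<forall>y'\<in>U. y \<noteq> y' \<longrightarrow> (V y - {t}) \<inter> (V y' - {t}) = {}"
    proof (intro ballI impI, rule ccontr)
      fix y y' assume "y \<in> U" "y' \<in> U" "y \<noteq> y'" "(V y - {t}) \<inter> (V y' - {t}) \<noteq> {}"
      then obtain x where "x \<in> V y" "x \<in> V y'" "x \<noteq> t" by blast
      then show False using join_unique[of t x y y'] \<open>y \<in> U\<close> \<open>y' \<in> U\<close> \<open>y \<noteq> y'\<close> assms
        by (auto simp: U_def V_def)
    qed
  qed
  moreover have "card (V y - {t}) = N 1 - 1" if "y \<in> U" for y
  proof -
    have "t \<in> V y" using that assms by (simp add: U_def V_def)
    then show ?thesis using cV[OF that] by simp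
  qed
  ultimately show ?thesis using cU by simp
qed

end

section \<open>Valuations and fractional ideals\<close>

context nonarch_local_field
begin

text \<open>The fractional ideal \<open>\<pi>\<^sup>m \<O>\<close>. Working with all of these at once absorbs every rescaling.\<close>

definition ideal :: "int \<Rightarrow> 'k set" where
  "ideal m = {x. x = 0 \<or> m \<le> ord x}"

lemma ord_1: "ord 1 = 0"
  using ord_mult[of 1 1] by simp

lemma ord_minus: "ord (- x) = ord x"
proof (cases "x = 0")
  case False
  have "ord (-1) = 0" using ord_mult[of "-1" "-1"] by (simp add: ord_1)
  then show ?thesis using ord_mult[of "-1" x] False by simp
qed simp

lemma ord_inverse: "x \<noteq> 0 \<Longrightarrow> ord (inverse x) = - ord x"
  using ord_mult[of x "inverse x"] by (simp add: ord_1)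

lemma ord_power: "ord (\<pi> ^ k) = int k"
  by (induction k) (use uniformizer in \<open>simp_all add: ord_1 ord_mult\<close>)

lemma ord_power_int: "ord (\<pi> powi m) = m"
  by (cases m rule: int_cases2) (use uniformizer(1) in \<open>simp_all add: ord_power power_int_minus ord_inverse\<close>)

lemma power_int_nonzero: "\<pi> powi m \<noteq> 0"
  using uniformizer by simp

lemma zero_in_ideal: "0 \<in> ideal m"
  by (simp add: ideal_def)

lemma ideal_add: "x \<in> ideal m \<Longrightarrow> y \<in> ideal m \<Longrightarrow> x + y \<in> ideal m"
  using ord_add[of x y] by (cases "x = 0"; cases "y = 0"; cases "x + y = 0") (auto simp: ideal_def)

lemma ideal_minus: "x \<in> ideal m \<Longrightarrow> - x \<in> ideal m"
  by (simp add: ideal_def ord_minus)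

lemma ideal_diff: "x \<in> ideal m \<Longrightarrow> y \<in> ideal m \<Longrightarrow> x - y \<in> ideal m"
  using ideal_add[of x m "- y"] ideal_minus by simp

lemma ideal_mult: "x \<in> ideal i \<Longrightarrow> y \<in> ideal j \<Longrightarrow> x * y \<in> ideal (i + j)"
  using ord_mult[of x y] by (cases "x = 0"; cases "y = 0") (auto simp: ideal_def)

lemma ideal_mono: "i \<le> j \<Longrightarrow> ideal j \<subseteq> ideal i"
  by (auto simp: ideal_def)

lemma scale_in_ideal_iff: "a \<noteq> 0 \<Longrightarrow> a * x \<in> ideal m \<longleftrightarrow> x \<in> ideal (m - ord a)"
  using ord_mult[of a x] by (cases "x = 0") (auto simp: ideal_def)

lemma \<O>_eq: "\<O> = ideal 0"
  by (simp add: \<O>_def ideal_def)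

lemma \<pi>\<O>_eq: "\<pi>\<O> = ideal 1"
proof
  show "\<pi>\<O> \<subseteq> ideal 1"
    using uniformizer by (auto simp: \<pi>\<O>_def \<O>_eq scale_in_ideal_iff)
  show "ideal 1 \<subseteq> \<pi>\<O>"
  proof
    fix x assume "x \<in> ideal 1"
    then have "\<pi> * (x / \<pi>) \<in> ideal 1" using uniformizer by simp
    then have "x / \<pi> \<in> \<O>" using scale_in_ideal_iff[OF uniformizer(1), of "x / \<pi>" 1] uniformizer(2) by (simp add: \<O>_eq)
    then show "x \<in> \<pi>\<O>" unfolding \<pi>\<O>_def using uniformizer by (intro image_eqI[of _ _ "x / \<pi>"]) auto
  qed
qed

lemma one_in_\<O>: "1 \<in> ideal 0" and \<pi>_in_\<O>: "\<pi> \<in> ideal 0"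
  using uniformizer by (auto simp: ideal_def ord_1)

lemma unit_inverse: "c \<in> ideal 0 \<Longrightarrow> c \<notin> ideal 1 \<Longrightarrow> c \<noteq> 0 \<and> inverse c \<in> ideal 0"
  by (auto simp: ideal_def ord_inverse)

lemma common_denominator:
  assumes "finite A"
  shows "\<exists>a. a \<noteq> 0 \<and> (\<forall>x\<in>A. a * x \<in> ideal 0)"
  using assms
proof (induction A)
  case empty
  then show ?case by (intro exI[of _ 1]) simp
next
  case (insert y A)
  then obtain a where a: "a \<noteq> 0" "\<forall>x\<in>A. a * x \<in> ideal 0" by auto
  show ?case
  proof (cases "a * y \<in> ideal 0")
    case True
    then show ?thesis using a by auto
  next
    case False
    then have ay: "a * y \<noteq> 0" "ord (a * y) < 0" by (auto simp: ideal_def)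
    define c where "c = inverse (a * y)"
    have c: "c \<noteq> 0" "c \<in> ideal 0" "c * a * y = 1"
      using ay by (auto simp: c_def ideal_def ord_inverse mult.assoc simp del: inverse_mult_distrib)
    have "c * a * x \<in> ideal 0" if "x \<in> A" for x
      using ideal_mult[OF c(2), of "a * x" 0] a that by (simp add: mult.assoc)
    then show ?thesis using a c one_in_\<O> by (intro exI[of _ "c * a"]) auto
  qed
qed

lemma card_residue:
  assumes "\<And>c d. c \<in> ideal 0 \<Longrightarrow> d \<in> ideal 0 \<Longrightarrow> f c = f d \<longleftrightarrow> c - d \<in> ideal 1"
  shows "card (f ` ideal 0) = q"
proof -
  have "{(x, y). x \<in> \<O> \<and> y \<in> \<O> \<and> x - y \<in> \<pi>\<O>} = {(x, y). x \<in> \<O> \<and> y \<in> \<O> \<and> f x = f y}"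
    using assms by (auto simp: \<O>_eq \<pi>\<O>_eq)
  then show ?thesis
    unfolding q_def residue_field_def by (simp only: card_quotient_kernel) (simp add: \<O>_eq)
qed

lemma two_le_q: "2 \<le> q"
proof -
  define f :: "'k \<Rightarrow> 'k set" where "f c = (+) c ` ideal 1" for c
  have sub: "add_subgroup (ideal 1)"
    by (simp add: add_subgroup_def zero_in_ideal ideal_diff)
  have f: "f c = f d \<longleftrightarrow> c - d \<in> ideal 1" for c d
    unfolding f_def by (rule coset_eq_iff[OF sub])
  have "ideal 0 // {(x, y). x \<in> ideal 0 \<and> y \<in> ideal 0 \<and> x - y \<in> ideal 1} \<noteq> {}"
    using one_in_\<O> by (auto simp: quotient_def)
  moreover have "finite (ideal 0 // {(x, y). x \<in> ideal 0 \<and> y \<in> ideal 0 \<and> x - y \<in> ideal 1})"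
    using finite_residue_field by (simp flip: \<O>_eq \<pi>\<O>_eq add: \<O>_def \<pi>\<O>_def)
  ultimately have "q > 0" by (simp add: q_def residue_field_def card_gt_0_iff \<O>_eq \<pi>\<O>_eq)
  then have "finite (f ` ideal 0)" using card_residue[of f] f by (metis card_ge_0_finite)
  moreover have "{f 0, f 1} \<subseteq> f ` ideal 0" using one_in_\<O> zero_in_ideal by auto
  ultimately have "card {f 0, f 1} \<le> q" using card_residue[of f] f by (metis card_mono)
  moreover have "f 1 \<noteq> f 0" using f[of 1 0] by (simp add: ideal_def ord_1)
  ultimately show ?thesis by simp
qed

text \<open>
  The number of lines in a space of dimension \<open>2 i\<close> over the residue field, that is
  \<open>(q\<^bsup>2 i\<^esup> - 1) / (q - 1)\<close>, as a geometric sum.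
\<close>

definition num_lines :: "nat \<Rightarrow> nat" where
  "num_lines i = (\<Sum>j<2 * i. q ^ j)"

lemma num_lines_mult: "num_lines i * (q - 1) = q ^ (2 * i) - 1"
proof -
  obtain p where p: "q = Suc p" using two_le_q by (cases q) auto
  have "(\<Sum>j<k. q ^ j) * p + 1 = q ^ k" for k
    by (induction k) (simp_all add: p algebra_simps)
  from this[of "2 * i"] show ?thesis by (simp add: num_lines_def p)
qed

lemma num_lines_eqI: "k * (q - 1) = q ^ (2 * i) - 1 \<Longrightarrow> k = num_lines i"
  using num_lines_mult[of i] two_le_q by (metis One_nat_def Suc_1 mult_right_cancel diff_is_0_eq not_less_eq_eq)

lemma num_lines_pos: "0 < i \<Longrightarrow> 0 < num_lines i"
  unfolding num_lines_def using two_le_q by (intro sum_pos) (auto simp: lessThan_empty_iff bot_nat_def)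

lemma num_lines_1: "num_lines 1 = q + 1"
  by (simp add: num_lines_def numeral_2_eq_2)

text \<open>The number of complete isotropic flags in a symplectic space of dimension \<open>2 m\<close> over the residue field.\<close>

definition flag_number :: "nat \<Rightarrow> nat" where
  "flag_number m = (\<Prod>i=1..m. num_lines i)"

end

section \<open>Symplectic linear algebra\<close>

context symplectic_space
begin

lemma form_add_right: "form x (y + z) = form x y + form x z"
  and form_scale_right: "form x (a *s y) = a * form x y"
  using linear_right[of x] by (simp_all add: Vector_Spaces.linear_def module_hom_iff)

lemma form_add_left: "form (x + y) z = form x z + form y z"
  and form_scale_left: "form (a *s x) z = a * form x z"
  using linear_left[of z] by (simp_all add: Vector_Spaces.linear_def module_hom_iff)

lemma form_zero [simp]: "form x 0 = 0" "form 0 x = 0"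
  using form_scale_right[of x 0 0] form_scale_left[of 0 0 x] by simp_all

lemma form_minus_left: "form (- x) y = - form x y"
  using form_add_left[of x "- x" y] by (simp add: minus_unique)

lemma form_minus_right: "form x (- y) = - form x y"
  using form_add_right[of x y "- y"] by (simp add: minus_unique)

lemma form_diff_left: "form (x - y) z = form x z - form y z"
  using form_add_left[of x "- y" z] by (simp add: form_minus_left)

lemma form_diff_right: "form x (y - z) = form x y - form x z"
  using form_add_right[of x y "- z"] by (simp add: form_minus_right)

lemma form_sum_left: "form (sum g S) y = (\<Sum>i\<in>S. form (g i) y)"
  by (induction S rule: infinite_finite_induct) (auto simp: form_add_left)

lemma form_sum_right: "form y (sum g S) = (\<Sum>i\<in>S. form y (g i))"
  by (induction S rule: infinite_finite_induct) (auto simp: form_add_right)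

lemma form_swap: "form y x = - form x y"
proof -
  have "0 = form (x + y) (x + y)" by (simp only: alternating)
  also have "\<dots> = form y x + form x y"
    by (simp only: form_add_left form_add_right) (simp add: alternating)
  finally show ?thesis by (simp add: eq_neg_iff_add_eq_0)
qed

lemma finite_basis: "\<exists>B. finite B \<and> independent B \<and> span B = UNIV \<and> card B = 2 * n"
proof -
  obtain B where B: "independent B" "UNIV \<subseteq> span B" "card B = dim (UNIV :: 'v set)"
    by (rule basis_exists[of UNIV]) auto
  then have "finite B" using n_pos dim_eq by (intro card_ge_0_finite) simp
  then show ?thesis using B dim_eq by auto
qed

text \<open>
  The vector space locale does not fix a finite basis; finiteness is read off from the dimension.
\<close>

lemma spanning_if_card:
  assumes "independent B" "card B = 2 * n"
  shows "finite B" "span B = UNIV"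
proof -
  show fin: "finite B" using assms n_pos by (intro card_ge_0_finite) simp
  obtain C where C: "finite C" "span C = UNIV" "card C = 2 * n" using finite_basis by blast
  show "span B = UNIV"
  proof (rule ccontr)
    assume "span B \<noteq> UNIV"
    then obtain v where v: "v \<notin> span B" by auto
    then have "independent (insert v B)" using assms by (simp add: independent_insertI)
    then have "card (insert v B) \<le> card C" using independent_span_bound[OF C(1)] C by simp
    moreover have "v \<notin> B" using v span_base by blast
    ultimately show False using fin assms C by simp
  qed
qed

lemma eq_if_form_eq:
  assumes "span B = UNIV" "\<And>b. b \<in> B \<Longrightarrow> form x b = form y b"
  shows "x = y"
proof -
  have "subspace {z. form (x - y) z = 0}"
    by (auto simp: subspace_def form_add_right form_scale_right)
  moreover have "B \<subseteq> {z. form (x - y) z = 0}" using assms(2) by (auto simp: form_diff_left)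
  ultimately have "span B \<subseteq> {z. form (x - y) z = 0}" by (simp add: span_minimal)
  then have "form (x - y) z = 0" for z using assms(1) by auto
  then have "x - y = 0" by (rule nondegenerate)
  then show ?thesis by simp
qed

text \<open>The first \<open>m\<close> pairs of a symplectic basis, for the construction of one by induction on \<open>m\<close>.\<close>

definition hyperbolic :: "nat \<Rightarrow> (nat \<Rightarrow> 'v) \<Rightarrow> (nat \<Rightarrow> 'v) \<Rightarrow> bool" where
  "hyperbolic m u w \<longleftrightarrow> (\<forall>i<m. \<forall>j<m. form (u i) (w j) = (if i = j then 1 else 0) \<and>
                   form (u i) (u j) = 0 \<and> form (w i) (w j) = 0)"

text \<open>The orthogonal projection to the span of the hyperbolic pairs.\<close>

definition hyperbolic_part :: "nat \<Rightarrow> (nat \<Rightarrow> 'v) \<Rightarrow> (nat \<Rightarrow> 'v) \<Rightarrow> 'v \<Rightarrow> 'v" where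
  "hyperbolic_part m u w x = (\<Sum>i<m. form x (w i) *s u i - form x (u i) *s w i)"

lemma hyperbolic_part_form:
  assumes "hyperbolic m u w" "j < m"
  shows "form (hyperbolic_part m u w x) (u j) = form x (u j)"
    and "form (hyperbolic_part m u w x) (w j) = form x (w j)"
proof -
  have wu: "form (w i) (u j) = (if i = j then -1 else 0)" if "i < m" for i
    by (subst form_swap) (use assms that in \<open>auto simp: hyperbolic_def\<close>)
  have "form (hyperbolic_part m u w x) (u j) = (\<Sum>i<m. if i = j then form x (u i) else 0)"
    unfolding hyperbolic_part_def form_sum_left using assms wu
    by (intro sum.cong) (auto simp: form_diff_left form_scale_left hyperbolic_def)
  then show "form (hyperbolic_part m u w x) (u j) = form x (u j)" using assms by simp
  have "form (hyperbolic_part m u w x) (w j) = (\<Sum>i<m. if i = j then form x (w i) else 0)"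
    unfolding hyperbolic_part_def form_sum_left using assms
    by (intro sum.cong) (auto simp: form_diff_left form_scale_left hyperbolic_def)
  then show "form (hyperbolic_part m u w x) (w j) = form x (w j)" using assms by simp
qed

text \<open>
  As \<open>2 m < 2 n\<close> there is a vector outside the span of the given pairs. What remains of it after
  subtracting its projection is nonzero, and non-degeneracy provides a partner for it.
\<close>

lemma hyperbolic_extend:
  assumes h: "hyperbolic m u w" and m: "m < n"
  shows "\<exists>u' w'. hyperbolic (Suc m) u' w'"
proof -
  define S where "S = u ` {..<m} \<union> w ` {..<m}"
  have fin: "finite S" by (simp add: S_def)
  have "card S \<le> card (u ` {..<m}) + card (w ` {..<m})" unfolding S_def by (rule card_Un_le)
  also have "\<dots> \<le> m + m" using card_image_le[of "{..<m}" u] card_image_le[of "{..<m}" w] by simp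
  finally have cS: "card S < 2 * n" using m by simp
  have "span S \<noteq> UNIV"
  proof
    assume "span S = UNIV"
    then have "dim (UNIV :: 'v set) \<le> card S" using fin by (intro dim_le_card) auto
    then show False using cS dim_eq by simp
  qed
  then obtain v where v: "v \<notin> span S" by auto
  define p where "p x = x - hyperbolic_part m u w x" for x
  have p: "form (p x) (u j) = 0" "form (p x) (w j) = 0" if "j < m" for x j
    using hyperbolic_part_form[OF h that] by (simp_all add: p_def form_diff_left)
  have "hyperbolic_part m u w v \<in> span S"
    unfolding hyperbolic_part_def
    by (intro span_sum span_diff span_scale span_base) (auto simp: S_def)
  then have "p v \<noteq> 0" using v by (auto simp: p_def)
  then obtain y where y: "form (p v) y \<noteq> 0" using nondegenerate by blast
  define z where "z = p (inverse (form (p v) y) *s y)"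
  have "form (p v) (hyperbolic_part m u w x) = 0" for x
    unfolding hyperbolic_part_def form_sum_right
    by (intro sum.neutral) (auto simp: form_diff_right form_scale_right p)
  then have vz: "form (p v) z = 1"
    using y by (simp add: z_def p_def form_diff_right form_scale_right)
  have r: "form (u j) (p x) = 0" "form (w j) (p x) = 0" if "j < m" for x j
    using p[OF that, of x] form_swap[of "p x" "u j"] form_swap[of "p x" "w j"] by simp_all
  have "hyperbolic (Suc m) (u(m := p v)) (w(m := z))"
    unfolding hyperbolic_def
  proof (intro allI impI)
    fix i j assume "i < Suc m" "j < Suc m"
    then consider "i < m" "j < m" | "i = m" "j < m" | "i < m" "j = m" | "i = m" "j = m" by linarith
    then show "form ((u(m := p v)) i) ((w(m := z)) j) = (if i = j then 1 else 0) \<and>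
        form ((u(m := p v)) i) ((u(m := p v)) j) = 0 \<and> form ((w(m := z)) i) ((w(m := z)) j) = 0"
      by cases (use h p r vz alternating in \<open>auto simp: hyperbolic_def z_def\<close>)
  qed
  then show ?thesis by blast
qed

lemma hyperbolic_exists: "m \<le> n \<Longrightarrow> \<exists>u w. hyperbolic m u w"
proof (induction m)
  case 0
  then show ?case by (simp add: hyperbolic_def)
next
  case (Suc m)
  then show ?case using hyperbolic_extend[of m] by auto
qed

lemma symplectic_basis_iff: "symplectic_basis u w \<longleftrightarrow> hyperbolic n u w"
proof
  assume h: "hyperbolic n u w"
  define S where "S = u ` {..<n} \<union> w ` {..<n}"
  have fin: "finite S" by (simp add: S_def)
  have uw: "form (u i) (w j) = (if i = j then 1 else 0)" "form (u i) (u j) = 0" "form (w i) (w j) = 0"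
    if "i < n" "j < n" for i j using h that by (auto simp: hyperbolic_def)
  have wu: "form (w i) (u j) = (if i = j then -1 else 0)" if "i < n" "j < n" for i j
    by (subst form_swap) (use uw(1)[OF that(2,1)] in auto)
  have ind: "independent S"
  proof (rule independent_if_scalars_zero[OF fin])
    fix f x assume s: "(\<Sum>x\<in>S. f x *s x) = 0" and x: "x \<in> S"
    have pair: "(\<Sum>x\<in>S. f x * form x y) = 0" for y
      using arg_cong[OF s, of "\<lambda>x. form x y"] by (simp add: form_sum_left form_scale_left)
    have ex: "\<exists>y c. c \<noteq> 0 \<and> (\<forall>z\<in>S. form z y = (if z = x then c else 0))"
    proof -
      from x consider i where "i < n" "x = u i" | i where "i < n" "x = w i" by (auto simp: S_def)
      then show ?thesis
      proof cases
        case 1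
        have "\<forall>z\<in>S. form z (w i) = (if z = x then 1 else 0)"
          using 1 uw by (fastforce simp: S_def)
        then show ?thesis by (intro exI[of _ "w i"] exI[of _ 1]) simp
      next
        case 2
        have "\<forall>z\<in>S. form z (u i) = (if z = x then -1 else 0)"
          using 2 uw wu by (fastforce simp: S_def)
        then show ?thesis by (intro exI[of _ "u i"] exI[of _ "-1"]) simp
      qed
    qed
    then obtain y c where y: "c \<noteq> 0" "\<forall>z\<in>S. form z y = (if z = x then c else 0)" by blast
    have "(\<Sum>z\<in>S. f z * form z y) = (\<Sum>z\<in>S. if z = x then f x * c else 0)"
      using y(2) by (intro sum.cong) auto
    then show "f x = 0" using pair[of y] x fin y(1) by simp
  qed
  have inj: "inj_on u {..<n}" "inj_on w {..<n}"
    using uw by (intro inj_onI; metis lessThan_iff one_neq_zero)+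
  have "u i \<noteq> w j" if "i < n" "j < n" for i j
    using uw(1)[OF that(1,1)] uw(3)[OF that(2,1)] by auto
  then have "u ` {..<n} \<inter> w ` {..<n} = {}" by auto
  then have "card S = 2 * n" unfolding S_def using inj by (simp add: card_Un_disjoint card_image)
  then have "span S = UNIV" using spanning_if_card ind by blast
  then show "symplectic_basis u w" using ind h by (auto simp: symplectic_basis_def hyperbolic_def S_def)
qed (auto simp: symplectic_basis_def hyperbolic_def)

lemma symplectic_basis_exists: "\<exists>u w. symplectic_basis u w"
  using hyperbolic_exists[of n] symplectic_basis_iff by auto

lemma symplectic_expansion:
  assumes "symplectic_basis u w"
  shows "x = (\<Sum>i<n. form x (w i) *s u i) + (\<Sum>i<n. - form x (u i) *s w i)"
proof -
  have "hyperbolic_part n u w x = x"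
  proof (rule eq_if_form_eq)
    show "span (u ` {..<n} \<union> w ` {..<n}) = UNIV" using assms by (simp add: symplectic_basis_def)
    show "form (hyperbolic_part n u w x) b = form x b" if "b \<in> u ` {..<n} \<union> w ` {..<n}" for b
      using that hyperbolic_part_form assms symplectic_basis_iff by auto
  qed
  then show ?thesis
    by (simp add: hyperbolic_part_def sum_subtractf sum_negf scale_minus_left)
qed

text \<open>
  Representing functionals by the form makes coordinates with respect to any basis available as values
  of the form, and thereby the dual basis of a lattice.
\<close>

lemma functional_represented:
  assumes add: "\<And>x y. l (x + y) = l x + l y" and scale: "\<And>a x. l (a *s x) = a * l x"
  shows "\<exists>z. \<forall>x. form z x = l x"
proof -
  obtain u w where b: "symplectic_basis u w" using symplectic_basis_exists by blast
  have l0: "l 0 = 0" using scale[of 0 0] by simp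
  have lminus: "l (- x) = - l x" for x using scale[of "- 1" x] by simp
  have lsum: "l (sum g S) = (\<Sum>i\<in>S. l (g i))" for g and S :: "nat set"
    by (induction S rule: infinite_finite_induct) (auto simp: l0 add)
  define z where "z = (\<Sum>i<n. l (w i) *s u i) + (\<Sum>i<n. - l (u i) *s w i)"
  have "form z x = l x" for x
  proof -
    have "l x = (\<Sum>i<n. form x (w i) * l (u i)) + (\<Sum>i<n. - form x (u i) * l (w i))"
      by (subst symplectic_expansion[OF b, of x]) (simp add: add lsum scale lminus)
    also have "\<dots> = (\<Sum>i<n. l (w i) * form (u i) x) + (\<Sum>i<n. - l (u i) * form (w i) x)"
      using form_swap[of x] by (simp add: sum_negf mult.commute)
    also have "\<dots> = form z x"
      by (simp add: z_def form_add_left form_sum_left form_scale_left form_minus_left)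
    finally show ?thesis by simp
  qed
  then show ?thesis by blast
qed

section \<open>Lattices and their duals\<close>

definition O_submodule :: "'v set \<Rightarrow> bool" where
  "O_submodule L \<longleftrightarrow> 0 \<in> L \<and> (\<forall>x\<in>L. \<forall>y\<in>L. x + y \<in> L) \<and> (\<forall>a\<in>ideal 0. \<forall>x\<in>L. a *s x \<in> L)"

text \<open>
  The multiple \<open>\<pi>\<^sup>m L\<^sup>#\<close> of the dual lattice. Orders \<open>0\<close>, \<open>1\<close> and \<open>2\<close> are the ones that matter:
  primitive lattices are those with \<open>L\<^sup># = L\<close>, and vertices live between \<open>\<pi>\<^sup>2 L\<^sup>#\<close> and \<open>\<pi> L\<^sup>#\<close>.
\<close>

definition perp :: "int \<Rightarrow> 'v set \<Rightarrow> 'v set" where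
  "perp m L = {x. \<forall>y\<in>L. form x y \<in> ideal m}"

definition O_span :: "'v set \<Rightarrow> 'v set" where
  "O_span B = {\<Sum>b\<in>B. c b *s b | c. \<forall>b\<in>B. c b \<in> ideal 0}"

definition lattice_basis :: "'v set \<Rightarrow> 'v set \<Rightarrow> bool" where
  "lattice_basis L B \<longleftrightarrow> independent B \<and> card B = 2 * n \<and> L = O_span B"

definition adjoin :: "'v set \<Rightarrow> 'v \<Rightarrow> 'v set" where
  "adjoin A y = {x + c *s y | x c. x \<in> A \<and> c \<in> ideal 0}"

lemma O_submodule_closed:
  assumes "O_submodule L"
  shows "0 \<in> L" "x \<in> L \<Longrightarrow> y \<in> L \<Longrightarrow> x + y \<in> L" "a \<in> ideal 0 \<Longrightarrow> x \<in> L \<Longrightarrow> a *s x \<in> L"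
    "x \<in> L \<Longrightarrow> - x \<in> L" "x \<in> L \<Longrightarrow> y \<in> L \<Longrightarrow> x - y \<in> L"
proof -
  show "0 \<in> L" and add: "x \<in> L \<Longrightarrow> y \<in> L \<Longrightarrow> x + y \<in> L"
    and sc: "a \<in> ideal 0 \<Longrightarrow> x \<in> L \<Longrightarrow> a *s x \<in> L" for x y a
    using assms by (auto simp: O_submodule_def)
  show neg: "x \<in> L \<Longrightarrow> - x \<in> L" for x
    using sc[of "- 1" x] ideal_minus[OF one_in_\<O>] by simp
  show "x \<in> L \<Longrightarrow> y \<in> L \<Longrightarrow> x - y \<in> L" using add[of x "- y"] neg by simp
qed

lemma O_submodule_sum:
  "O_submodule L \<Longrightarrow> (\<And>i. i \<in> S \<Longrightarrow> g i \<in> L) \<Longrightarrow> sum g S \<in> L"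
proof (induction S rule: infinite_finite_induct)
  case (insert i S)
  then have "g i + sum g S \<in> L" by (intro O_submodule_closed(2)) auto
  then show ?case using insert by simp
qed (auto intro: O_submodule_closed(1))

lemma add_subgroup_O_submodule: "O_submodule L \<Longrightarrow> add_subgroup L"
  by (simp add: add_subgroup_def O_submodule_closed)

lemma perp_submodule: "O_submodule (perp m L)"
  using ideal_mult[of _ 0 _ m]
  by (auto simp: O_submodule_def perp_def zero_in_ideal form_add_left form_scale_left intro: ideal_add)

lemma perp_antimono: "A \<subseteq> B \<Longrightarrow> perp m B \<subseteq> perp m A"
  by (auto simp: perp_def)

lemma perp_mono_index: "i \<le> j \<Longrightarrow> perp j L \<subseteq> perp i L"
  using ideal_mono[of i j] by (auto simp: perp_def)

lemma subset_perp_swap: "A \<subseteq> perp m B \<longleftrightarrow> B \<subseteq> perp m A"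
proof -
  have "form y x \<in> ideal m" if "form x y \<in> ideal m" for x y
    using that ideal_minus[OF that] form_swap[of y x] by simp
  then show ?thesis by (auto simp: perp_def subset_iff)
qed

lemma smul_submodule: "O_submodule L \<Longrightarrow> O_submodule (smul a L)"
proof -
  assume L: "O_submodule L"
  have "c *s (a *s x) \<in> (\<lambda>x. a *s x) ` L" if "c \<in> ideal 0" "x \<in> L" for c x
  proof -
    have "c *s (a *s x) = a *s (c *s x)" by (rule scale_left_commute)
    then show ?thesis by (rule image_eqI) (rule O_submodule_closed(3)[OF L that])
  qed
  moreover have "0 \<in> (\<lambda>x. a *s x) ` L"
    using O_submodule_closed(1)[OF L] by (intro image_eqI[of _ _ 0]) simp_all
  moreover have "a *s x + a *s y \<in> (\<lambda>x. a *s x) ` L" if "x \<in> L" "y \<in> L" for x y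
    unfolding scale_right_distrib[symmetric] by (rule imageI) (rule O_submodule_closed(2)[OF L that])
  ultimately show ?thesis unfolding O_submodule_def smul_def by blast
qed

lemma smul_smul: "smul a (smul b L) = smul (a * b) L"
  by (simp add: smul_def image_image)

lemma smul_1: "smul 1 L = L"
  by (simp add: smul_def)

lemma mem_smul: "a \<noteq> 0 \<Longrightarrow> x \<in> smul a L \<longleftrightarrow> inverse a *s x \<in> L"
proof -
  assume a: "a \<noteq> 0"
  have "x = a *s (inverse a *s x)" using a by simp
  then have "x \<in> smul a L" if "inverse a *s x \<in> L" using that unfolding smul_def by (rule image_eqI)
  moreover have "inverse a *s x \<in> L" if "x \<in> smul a L" using a that by (auto simp: smul_def)
  ultimately show "x \<in> smul a L \<longleftrightarrow> inverse a *s x \<in> L" by blast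
qed

lemma smul_mono: "A \<subseteq> B \<Longrightarrow> smul a A \<subseteq> smul a B"
  by (auto simp: smul_def)

lemma smul_subset_iff: "a \<noteq> 0 \<Longrightarrow> smul a A \<subseteq> smul a B \<longleftrightarrow> A \<subseteq> B"
  unfolding smul_def by (rule inj_image_subset_iff) (simp add: inj_def)

lemma smul_subset: "O_submodule L \<Longrightarrow> a \<in> ideal 0 \<Longrightarrow> smul a L \<subseteq> L"
  by (auto simp: smul_def O_submodule_closed)

lemma smul_unit:
  assumes "O_submodule L" "a \<noteq> 0" "ord a = 0"
  shows "smul a L = L"
proof
  have a: "a \<in> ideal 0" "inverse a \<in> ideal 0" using assms by (auto simp: ideal_def ord_inverse)
  show "smul a L \<subseteq> L" by (rule smul_subset[OF assms(1) a(1)])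
  have "smul (inverse a) L \<subseteq> L" by (rule smul_subset[OF assms(1) a(2)])
  then have "smul a (smul (inverse a) L) \<subseteq> smul a L" by (rule smul_mono)
  then show "L \<subseteq> smul a L" using assms by (simp add: smul_smul smul_1)
qed

lemma perp_smul: "a \<noteq> 0 \<Longrightarrow> perp m (smul a L) = perp (m - ord a) L"
  by (auto simp: perp_def smul_def form_scale_right scale_in_ideal_iff)

lemma smul_perp: "a \<noteq> 0 \<Longrightarrow> smul a (perp m L) = perp (m + ord a) L"
  by (auto simp: mem_smul perp_def form_scale_left scale_in_ideal_iff ord_inverse)

lemma O_span_submodule: "O_submodule (O_span B)"
  unfolding O_submodule_def
proof (intro conjI ballI)
  show "0 \<in> O_span B" unfolding O_span_def
    by (intro CollectI exI[of _ "\<lambda>_. 0"]) (simp add: zero_in_ideal)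
  fix x y assume "x \<in> O_span B" "y \<in> O_span B"
  then obtain c d where "x = (\<Sum>b\<in>B. c b *s b)" "\<forall>b\<in>B. c b \<in> ideal 0"
    "y = (\<Sum>b\<in>B. d b *s b)" "\<forall>b\<in>B. d b \<in> ideal 0" by (auto simp: O_span_def)
  then show "x + y \<in> O_span B" unfolding O_span_def
    by (intro CollectI exI[of _ "\<lambda>b. c b + d b"])
      (simp add: scale_left_distrib sum.distrib ideal_add)
next
  fix a x assume a: "a \<in> ideal 0" and "x \<in> O_span B"
  then obtain c where "x = (\<Sum>b\<in>B. c b *s b)" "\<forall>b\<in>B. c b \<in> ideal 0" by (auto simp: O_span_def)
  then show "a *s x \<in> O_span B" unfolding O_span_def using a ideal_mult[of _ 0 _ 0]
    by (intro CollectI exI[of _ "\<lambda>b. a * c b"]) (auto simp: scale_sum_right)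
qed

lemma O_span_superset: "finite B \<Longrightarrow> b \<in> B \<Longrightarrow> b \<in> O_span B"
  unfolding O_span_def
proof (intro CollectI exI conjI)
  assume "finite B" "b \<in> B"
  have "(\<Sum>x\<in>B. (if x = b then 1 else 0) *s x) = (\<Sum>x\<in>B. if x = b then b else 0)"
    by (intro sum.cong) auto
  then show "b = (\<Sum>x\<in>B. (if x = b then 1 else 0) *s x)" using \<open>finite B\<close> \<open>b \<in> B\<close> by simp
qed (simp add: one_in_\<O> zero_in_ideal)

lemma O_span_minimal: "B \<subseteq> L \<Longrightarrow> O_submodule L \<Longrightarrow> O_span B \<subseteq> L"
  by (auto simp: O_span_def intro!: O_submodule_sum O_submodule_closed)

lemma lattice_basis_span:
  assumes "lattice_basis L B"
  shows "finite B" "span B = UNIV" "independent B"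
  using assms spanning_if_card by (auto simp: lattice_basis_def)

lemma representation_sum_eq:
  assumes "lattice_basis L B"
  shows "(\<Sum>b\<in>B. representation B x b *s b) = x"
  using lattice_basis_span[OF assms] by (intro sum_representation_eq) auto

lemma representation_linear:
  assumes "lattice_basis L B"
  shows "representation B (x + y) b = representation B x b + representation B y b"
    and "representation B (a *s x) b = a * representation B x b"
  using lattice_basis_span[OF assms] by (simp_all add: representation_add representation_scale)

lemma representation_unique:
  assumes "lattice_basis L B" "x = (\<Sum>b\<in>B. c b *s b)" "b \<in> B"
  shows "representation B x b = c b"
proof -
  note B = lattice_basis_span[OF assms(1)]
  have "representation B x b = (\<Sum>i\<in>B. representation B (c i *s i) b)"
    unfolding assms(2) by (subst representation_sum) (use B in auto)
  also have "\<dots> = (\<Sum>i\<in>B. if i = b then c b else 0)"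
    using B by (intro sum.cong) (auto simp: representation_scale representation_basis)
  finally show ?thesis using B assms(3) by simp
qed

lemma mem_lattice_iff:
  assumes "lattice_basis L B"
  shows "x \<in> L \<longleftrightarrow> (\<forall>b\<in>B. representation B x b \<in> ideal 0)"
proof
  assume "x \<in> L"
  then obtain c where "x = (\<Sum>b\<in>B. c b *s b)" "\<forall>b\<in>B. c b \<in> ideal 0"
    using assms by (auto simp: lattice_basis_def O_span_def)
  then show "\<forall>b\<in>B. representation B x b \<in> ideal 0" using representation_unique[OF assms] by simp
next
  assume "\<forall>b\<in>B. representation B x b \<in> ideal 0"
  moreover have "x = (\<Sum>b\<in>B. representation B x b *s b)" using representation_sum_eq[OF assms] by simp
  ultimately have "x \<in> O_span B" unfolding O_span_def by blast
  then show "x \<in> L" using assms by (simp add: lattice_basis_def)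
qed

text \<open>Clearing denominators turns a linear relation over the field into one over \<open>\<O>\<close>.\<close>

lemma is_lattice_iff: "is_lattice L \<longleftrightarrow> (\<exists>B. lattice_basis L B)"
proof
  assume "is_lattice L"
  then obtain B where B: "finite B" "card B = 2 * n" "L = O_span B"
    and ind: "\<And>c. (\<forall>b\<in>B. c b \<in> ideal 0) \<Longrightarrow> (\<Sum>b\<in>B. c b *s b) = 0 \<Longrightarrow> (\<forall>b\<in>B. c b = 0)"
    unfolding is_lattice_def O_span_def \<O>_eq by blast
  have "independent B"
  proof (rule independent_if_scalars_zero[OF B(1)])
    fix f x assume s: "(\<Sum>x\<in>B. f x *s x) = 0" and x: "x \<in> B"
    have "finite (f ` B)" using B by simp
    from common_denominator[OF this]
    obtain a where a: "a \<noteq> 0" "\<forall>x\<in>B. a * f x \<in> ideal 0" by auto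
    have "(\<Sum>x\<in>B. (a * f x) *s x) = a *s (\<Sum>x\<in>B. f x *s x)" by (simp add: scale_sum_right)
    then have "a * f x = 0" using ind[of "\<lambda>x. a * f x"] a s x by simp
    then show "f x = 0" using a by simp
  qed
  then show "\<exists>B. lattice_basis L B" using B by (auto simp: lattice_basis_def)
next
  assume "\<exists>B. lattice_basis L B"
  then obtain B where B: "lattice_basis L B" by blast
  note B' = lattice_basis_span[OF B]
  have "\<forall>b\<in>B. c b = 0" if "(\<Sum>b\<in>B. c b *s b) = 0" for c
    using representation_unique[OF B that[symmetric]] by (simp add: representation_zero)
  then show "is_lattice L" unfolding is_lattice_def \<O>_eq
    using B B'(1) unfolding lattice_basis_def O_span_def by (intro exI[of _ B]) auto
qed

lemma lattice_submodule: "is_lattice L \<Longrightarrow> O_submodule L"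
  by (auto simp: is_lattice_iff lattice_basis_def O_span_submodule)

lemma dual_basis:
  assumes "lattice_basis L B"
  shows "\<exists>d. \<forall>x. \<forall>b\<in>B. form (d b) x = representation B x b"
proof -
  have "\<exists>z. \<forall>x. form z x = representation B x b" for b
    by (rule functional_represented) (simp_all add: representation_linear[OF assms])
  then show ?thesis by metis
qed

text \<open>
  The functionals reading off the coordinates in \<open>B\<close>, viewed as vectors, form a basis of the dual lattice.
  A vector in the double dual pairs integrally with them, so its coordinates in \<open>B\<close> are integral.
\<close>

lemma perp_basis:
  assumes B: "lattice_basis L B" and d: "\<forall>x. \<forall>b\<in>B. form (d b) x = representation B x b"
  shows "lattice_basis (perp 0 L) (d ` B)" "perp 0 (perp 0 L) = L"
proof -
  note B' = lattice_basis_span[OF B]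
  have \<delta>: "form (d b) b' = (if b = b' then 1 else 0)" if "b \<in> B" "b' \<in> B" for b b'
    using d that B' by (simp add: representation_basis)
  have inj: "inj_on d B"
    by (rule inj_onI) (metis \<delta> one_neq_zero)
  have lin: "form (\<Sum>z\<in>d ` B. f z *s z) b = f (d b)" if "b \<in> B" for f b
  proof -
    have "form (\<Sum>z\<in>d ` B. f z *s z) b = (\<Sum>i\<in>B. f (d i) * form (d i) b)"
      using inj by (simp add: sum.reindex form_sum_left form_scale_left)
    also have "\<dots> = (\<Sum>i\<in>B. if i = b then f (d b) else 0)"
      using that \<delta> by (intro sum.cong) auto
    finally show ?thesis using that B' by simp
  qed
  have "independent (d ` B)"
  proof (rule independent_if_scalars_zero)
    fix f x assume s: "(\<Sum>x\<in>d ` B. f x *s x) = 0" and "x \<in> d ` B"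
    then obtain b where b: "b \<in> B" "x = d b" by auto
    then show "f x = 0" using lin[OF b(1), of f] s by simp
  qed (use B' in simp)
  moreover have "card (d ` B) = 2 * n" using inj B by (simp add: card_image lattice_basis_def)
  moreover have "perp 0 L = O_span (d ` B)"
  proof
    show "O_span (d ` B) \<subseteq> perp 0 L"
      using d mem_lattice_iff[OF B] by (intro O_span_minimal perp_submodule) (auto simp: perp_def)
    show "perp 0 L \<subseteq> O_span (d ` B)"
    proof
      fix x assume x: "x \<in> perp 0 L"
      have BL: "B \<subseteq> L" using B O_span_superset B'(1) by (auto simp: lattice_basis_def)
      define f where "f z = form x (inv_into B d z)" for z
      have fd: "f (d b) = form x b" if "b \<in> B" for b using inj that by (simp add: f_def)
      have "x = (\<Sum>z\<in>d ` B. f z *s z)"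
        by (rule eq_if_form_eq[OF B'(2)]) (simp add: lin fd)
      moreover have "\<forall>z\<in>d ` B. f z \<in> ideal 0" using fd x BL by (auto simp: perp_def)
      ultimately show "x \<in> O_span (d ` B)" unfolding O_span_def by blast
    qed
  qed
  ultimately show "lattice_basis (perp 0 L) (d ` B)" by (simp add: lattice_basis_def)
  show "perp 0 (perp 0 L) = L"
  proof
    show "L \<subseteq> perp 0 (perp 0 L)" using subset_perp_swap[of L 0 "perp 0 L"] by simp
    show "perp 0 (perp 0 L) \<subseteq> L"
    proof
      fix x assume x: "x \<in> perp 0 (perp 0 L)"
      have "representation B x b \<in> ideal 0" if b: "b \<in> B" for b
      proof -
        have "d b \<in> perp 0 L" using d b mem_lattice_iff[OF B] by (simp add: perp_def)
        then have "form x (d b) \<in> ideal 0" using x by (simp add: perp_def)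
        then have "form (d b) x \<in> ideal 0" using form_swap[of "d b" x] ideal_minus by simp
        then show ?thesis using d b by simp
      qed
      then show "x \<in> L" using mem_lattice_iff[OF B] by simp
    qed
  qed
qed

lemma smul_lattice:
  assumes "is_lattice L" "a \<noteq> 0"
  shows "is_lattice (smul a L)"
proof -
  obtain B where B: "lattice_basis L B" using assms is_lattice_iff by blast
  note B' = lattice_basis_span[OF B]
  have inj: "inj_on (\<lambda>x. a *s x) B" using assms by (simp add: inj_on_def)
  have s: "(\<Sum>x\<in>(\<lambda>x. a *s x) ` B. f x *s x) = a *s (\<Sum>b\<in>B. f (a *s b) *s b)" for f
    using inj by (simp add: sum.reindex scale_sum_right mult.commute)
  have "independent ((\<lambda>x. a *s x) ` B)"
  proof (rule independent_if_scalars_zero)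
    fix f x assume "(\<Sum>x\<in>(\<lambda>x. a *s x) ` B. f x *s x) = 0" and "x \<in> (\<lambda>x. a *s x) ` B"
    then obtain b where b: "b \<in> B" "x = a *s b" "0 = (\<Sum>b\<in>B. f (a *s b) *s b)" using s assms by auto
    from representation_unique[OF B b(3) b(1)] show "f x = 0" using b by (simp add: representation_zero)
  qed (use B' in simp)
  moreover have "card ((\<lambda>x. a *s x) ` B) = 2 * n" using inj B by (simp add: card_image lattice_basis_def)
  moreover have "smul a L = O_span ((\<lambda>x. a *s x) ` B)"
  proof
    have L: "O_submodule L" by (rule lattice_submodule[OF assms(1)])
    have "B \<subseteq> L" using B O_span_superset B'(1) by (auto simp: lattice_basis_def)
    then show "O_span ((\<lambda>x. a *s x) ` B) \<subseteq> smul a L"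
      by (intro O_span_minimal smul_submodule L) (auto simp: smul_def)
    show "smul a L \<subseteq> O_span ((\<lambda>x. a *s x) ` B)"
    proof
      fix x assume "x \<in> smul a L"
      then obtain c where c: "\<forall>b\<in>B. c b \<in> ideal 0" "x = a *s (\<Sum>b\<in>B. c b *s b)"
        using B by (auto simp: smul_def lattice_basis_def O_span_def)
      have "x = (\<Sum>b\<in>B. c b *s (a *s b))" by (simp add: c scale_sum_right mult.commute)
      moreover have "a *s b \<in> O_span ((\<lambda>x. a *s x) ` B)" if "b \<in> B" for b
        using that B' by (intro O_span_superset) auto
      then have "c b *s (a *s b) \<in> O_span ((\<lambda>x. a *s x) ` B)" if "b \<in> B" for b
        using that c(1) O_submodule_closed(3)[OF O_span_submodule, of "c b" "a *s b"] by blast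
      then have "(\<Sum>b\<in>B. c b *s (a *s b)) \<in> O_span ((\<lambda>x. a *s x) ` B)"
        by (rule O_submodule_sum[OF O_span_submodule])
      ultimately show "x \<in> O_span ((\<lambda>x. a *s x) ` B)" by (simp only:)
    qed
  qed
  ultimately show ?thesis unfolding is_lattice_iff lattice_basis_def by blast
qed

lemma perp_power: "perp m L = smul (\<pi> powi m) (perp 0 L)"
  by (simp add: smul_perp[OF power_int_nonzero] ord_power_int)

lemma perp_lattice:
  assumes "is_lattice L"
  shows "is_lattice (perp m L)" "perp m (perp m L) = L"
proof -
  obtain B where B: "lattice_basis L B" using assms is_lattice_iff by blast
  obtain d where d: "\<forall>x. \<forall>b\<in>B. form (d b) x = representation B x b" using dual_basis[OF B] by blast
  have "is_lattice (perp 0 L)" using perp_basis(1)[OF B d] is_lattice_iff by blast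
  then show "is_lattice (perp m L)" unfolding perp_power[of m] by (rule smul_lattice[OF _ power_int_nonzero])
  have "perp m (perp m L) = perp 0 (perp 0 L)"
    by (subst perp_power[of m L]) (simp add: perp_smul[OF power_int_nonzero] ord_power_int)
  then show "perp m (perp m L) = L" using perp_basis(2)[OF B d] by simp
qed

lemma adjoin_submodule:
  assumes "O_submodule A"
  shows "O_submodule (adjoin A y)"
  unfolding O_submodule_def
proof (intro conjI ballI)
  show "0 \<in> adjoin A y" unfolding adjoin_def
    by (intro CollectI exI[of _ 0]) (simp add: O_submodule_closed[OF assms] zero_in_ideal)
  fix u v assume "u \<in> adjoin A y" "v \<in> adjoin A y"
  then obtain x c x' c' where "u = x + c *s y" "v = x' + c' *s y" "x \<in> A" "x' \<in> A" "c \<in> ideal 0" "c' \<in> ideal 0"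
    by (auto simp: adjoin_def)
  then show "u + v \<in> adjoin A y" unfolding adjoin_def
    by (intro CollectI exI[of _ "x + x'"] exI[of _ "c + c'"])
      (simp add: O_submodule_closed[OF assms] ideal_add scale_left_distrib algebra_simps)
next
  fix a u assume a: "a \<in> ideal 0" and "u \<in> adjoin A y"
  then obtain x c where "u = x + c *s y" "x \<in> A" "c \<in> ideal 0" by (auto simp: adjoin_def)
  then show "a *s u \<in> adjoin A y" unfolding adjoin_def
    using O_submodule_closed(3)[OF assms a] ideal_mult[OF a, of c 0]
    by (intro CollectI exI[of _ "a *s x"] exI[of _ "a * c"]) (simp add: scale_right_distrib)
qed

lemma adjoin_superset: "O_submodule A \<Longrightarrow> A \<subseteq> adjoin A y" "O_submodule A \<Longrightarrow> y \<in> adjoin A y"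
proof -
  assume A: "O_submodule A"
  show "A \<subseteq> adjoin A y"
  proof
    fix x assume "x \<in> A"
    then show "x \<in> adjoin A y" unfolding adjoin_def
      by (intro CollectI exI[of _ x] exI[of _ 0]) (simp add: zero_in_ideal)
  qed
  show "y \<in> adjoin A y" unfolding adjoin_def
    by (intro CollectI exI[of _ 0] exI[of _ 1]) (simp add: one_in_\<O> O_submodule_closed[OF A])
qed

lemma adjoin_subset: "O_submodule M \<Longrightarrow> A \<subseteq> M \<Longrightarrow> y \<in> M \<Longrightarrow> adjoin A y \<subseteq> M"
  by (auto simp: adjoin_def intro!: O_submodule_closed)

lemma multiple_mem_iff:
  assumes A: "O_submodule A" and y: "y \<notin> A" "\<pi> *s y \<in> A" and c: "c \<in> ideal 0"
  shows "c *s y \<in> A \<longleftrightarrow> c \<in> ideal 1"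
proof
  assume cy: "c *s y \<in> A"
  show "c \<in> ideal 1"
  proof (rule ccontr)
    assume "c \<notin> ideal 1"
    then have "c \<noteq> 0" "inverse c \<in> ideal 0" using unit_inverse[OF c] by auto
    then have "inverse c *s (c *s y) \<in> A" using cy O_submodule_closed(3)[OF A] by blast
    then show False using y \<open>c \<noteq> 0\<close> by simp
  qed
next
  assume "c \<in> ideal 1"
  then obtain d where d: "d \<in> ideal 0" "c = \<pi> * d" unfolding \<pi>\<O>_eq[symmetric] \<pi>\<O>_def \<O>_eq by auto
  have "c *s y = d *s (\<pi> *s y)" unfolding d(2) by (simp only: scale_scale mult.commute)
  then show "c *s y \<in> A" using O_submodule_closed(3)[OF A d(1) y(2)] by (simp only:)
qed

text \<open>
  The quotient \<open>(A + \<O> y) / A\<close> is generated by \<open>y\<close> and annihilated by \<open>\<pi>\<close> but not by \<open>1\<close>, so it is a copy of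
  the residue field.
\<close>

lemma index_adjoin:
  assumes A: "O_submodule A" and y: "y \<notin> A" "\<pi> *s y \<in> A"
  shows "index A (adjoin A y) = q"
proof -
  note sub = add_subgroup_O_submodule[OF A]
  have "cosets A (adjoin A y) = (\<lambda>c. (+) (c *s y) ` A) ` ideal 0"
  proof -
    have "(+) (x + c *s y) ` A = (+) (c *s y) ` A" if "x \<in> A" for x c
      using that by (simp add: coset_eq_iff[OF sub])
    then have "cosets A (adjoin A y) \<subseteq> (\<lambda>c. (+) (c *s y) ` A) ` ideal 0"
      by (auto simp: cosets_def adjoin_def)
    moreover have "c *s y \<in> adjoin A y" if "c \<in> ideal 0" for c
      by (intro O_submodule_closed(3)[OF adjoin_submodule[OF A] that] adjoin_superset(2)[OF A])
    then have "(\<lambda>c. (+) (c *s y) ` A) ` ideal 0 \<subseteq> cosets A (adjoin A y)"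
      by (auto simp: cosets_def)
    ultimately show ?thesis by (rule equalityI)
  qed
  moreover have "card ((\<lambda>c. (+) (c *s y) ` A) ` ideal 0) = q"
  proof (rule card_residue)
    fix c d assume "c \<in> ideal 0" "d \<in> ideal 0"
    then have "c - d \<in> ideal 0" by (rule ideal_diff)
    then show "(+) (c *s y) ` A = (+) (d *s y) ` A \<longleftrightarrow> c - d \<in> ideal 1"
      using multiple_mem_iff[OF A y] by (simp add: coset_eq_iff[OF sub] scale_left_diff_distrib[symmetric])
  qed
  ultimately show ?thesis by (simp add: index_def)
qed

text \<open>
  An exchange argument: some coordinate of \<open>\<pi> y\<close> is a unit, since otherwise \<open>y\<close> would lie in \<open>L\<close>, and \<open>y\<close> can
  replace the corresponding basis vector.
\<close>

lemma adjoin_lattice: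
  assumes "is_lattice L" "y \<notin> L" "\<pi> *s y \<in> L"
  shows "is_lattice (adjoin L y)"
proof -
  obtain B where B: "lattice_basis L B" using assms is_lattice_iff by blast
  note B' = lattice_basis_span[OF B]
  have L: "O_submodule L" using assms by (simp add: lattice_submodule)
  define g where "g = representation B (\<pi> *s y)"
  have g: "g b \<in> ideal 0" if "b \<in> B" for b using mem_lattice_iff[OF B] assms that by (simp add: g_def)
  have gy: "g b = \<pi> * representation B y b" for b
    unfolding g_def by (rule representation_linear[OF B])
  obtain b0 where b0: "b0 \<in> B" "g b0 \<notin> ideal 1"
  proof -
    obtain b where b: "b \<in> B" "representation B y b \<notin> ideal 0" using mem_lattice_iff[OF B] assms by blast
    then have "g b \<notin> ideal 1" using uniformizer by (simp add: gy scale_in_ideal_iff)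
    then show ?thesis using that b by blast
  qed
  define C where "C = B - {b0}"
  have BC: "B = insert b0 C" "b0 \<notin> C" "finite C" using b0 B' by (auto simp: C_def)
  have unit: "g b0 \<noteq> 0" "inverse (g b0) \<in> ideal 0" using unit_inverse[OF g[OF b0(1)] b0(2)] by auto
  have "\<pi> *s y = (\<Sum>b\<in>B. g b *s b)" using representation_sum_eq[OF B] by (simp add: g_def)
  then have e: "\<pi> *s y = g b0 *s b0 + (\<Sum>b\<in>C. g b *s b)" using BC by simp
  have b0_eq: "b0 = inverse (g b0) *s (\<pi> *s y - (\<Sum>b\<in>C. g b *s b))"
    unfolding e using unit by simp
  have yC: "y \<notin> span C"
  proof
    assume "y \<in> span C"
    then have "\<pi> *s y - (\<Sum>b\<in>C. g b *s b) \<in> span C"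
      by (intro span_diff span_scale span_sum) (auto intro: span_base)
    then have "b0 \<in> span C" by (subst b0_eq) (rule span_scale)
    then show False using B'(3) BC by (simp add: independent_insert)
  qed
  moreover have "independent C" using B'(3) BC by (simp add: independent_insert)
  ultimately have "independent (insert y C)" by (simp add: independent_insertI)
  moreover have "card (insert y C) = 2 * n"
  proof -
    have "y \<notin> C" using yC span_base by blast
    then show ?thesis using BC B by (simp add: lattice_basis_def)
  qed
  moreover have "adjoin L y = O_span (insert y C)"
  proof
    have fin: "finite (insert y C)" using BC by simp
    have sp: "O_submodule (O_span (insert y C))" by (rule O_span_submodule)
    have yO: "y \<in> O_span (insert y C)" using O_span_superset[OF fin] by simp
    have CO: "c \<in> O_span (insert y C)" if "c \<in> C" for c using O_span_superset[OF fin] that by simp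
    have gC: "g b \<in> ideal 0" if "b \<in> C" for b using g that by (simp add: C_def)
    have "b0 \<in> O_span (insert y C)"
      by (subst b0_eq)
        (intro O_submodule_closed[OF sp] O_submodule_sum[OF sp] unit \<pi>_in_\<O> yO gC CO)
    then have "B \<subseteq> O_span (insert y C)" using CO BC(1) by auto
    then have "L \<subseteq> O_span (insert y C)"
      using O_span_minimal[OF _ sp] B by (simp add: lattice_basis_def)
    then show "adjoin L y \<subseteq> O_span (insert y C)" by (rule adjoin_subset[OF sp _ yO])
    have "C \<subseteq> L" using B O_span_superset[of B] B'(1) by (auto simp: lattice_basis_def C_def)
    then show "O_span (insert y C) \<subseteq> adjoin L y"
      using adjoin_superset[OF L] by (intro O_span_minimal adjoin_submodule L) auto
  qed
  ultimately show ?thesis unfolding is_lattice_iff lattice_basis_def by blast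
qed

text \<open>
  Starting from \<open>\<pi> L\<close>, the basis vectors of \<open>L\<close> are adjoined one at a time, each with index \<open>q\<close>.
\<close>

lemma index_smul_\<pi>:
  assumes "is_lattice L"
  shows "index (smul \<pi> L) L = q ^ (2 * n)"
proof -
  obtain B where B: "lattice_basis L B" using assms is_lattice_iff by blast
  note B' = lattice_basis_span[OF B]
  have \<pi>L: "x \<in> smul \<pi> L \<longleftrightarrow> (\<forall>b\<in>B. representation B x b \<in> ideal 1)" for x
    using mem_lattice_iff[OF B] uniformizer
    by (simp add: mem_smul representation_linear[OF B] scale_in_ideal_iff ord_inverse)
  \<comment> \<open>the lattice spanned by \<open>S\<close> and \<open>\<pi> (B - S)\<close>\<close>
  define A where "A S = {x. \<forall>b\<in>B. representation B x b \<in> ideal (if b \<in> S then 0 else 1)}" for S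
  have sub: "O_submodule (A S)" for S
    using ideal_mult[of _ 0] by (auto simp: O_submodule_def A_def representation_linear[OF B]
        representation_zero zero_in_ideal intro: ideal_add)
  have "index (smul \<pi> L) (A S) = q ^ card S" if "S \<subseteq> B" for S
    using finite_subset[OF that B'(1)] that
  proof (induction S rule: finite_induct)
    case empty
    have "A {} = smul \<pi> L" using \<pi>L by (auto simp: A_def)
    then show ?case using index_self[OF add_subgroup_O_submodule[OF sub]] by (metis card.empty power_0)
  next
    case (insert b S)
    have rb: "representation B b b' = (if b' = b then 1 else 0)" for b'
      using representation_basis[OF B'(3)] insert.prems by simp
    have bA: "b \<notin> A S" using insert rb by (auto simp: A_def ideal_def ord_1)
    have \<pi>b: "\<pi> *s b \<in> A S"
      using uniformizer rb by (auto simp: A_def representation_linear[OF B] ideal_def)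
    have "adjoin (A S) b = A (insert b S)"
    proof
      have "A S \<subseteq> A (insert b S)"
      proof
        fix x assume x: "x \<in> A S"
        show "x \<in> A (insert b S)" unfolding A_def
        proof (intro CollectI ballI)
          fix b' assume "b' \<in> B"
          then have "representation B x b' \<in> ideal (if b' \<in> S then 0 else 1)" using x by (simp add: A_def)
          then show "representation B x b' \<in> ideal (if b' \<in> insert b S then 0 else 1)"
            using ideal_mono[of 0 1] by (auto split: if_splits)
        qed
      qed
      moreover have "b \<in> A (insert b S)" using rb one_in_\<O> zero_in_ideal by (simp add: A_def)
      ultimately show "adjoin (A S) b \<subseteq> A (insert b S)" by (rule adjoin_subset[OF sub])
      show "A (insert b S) \<subseteq> adjoin (A S) b"
      proof
        fix x assume x: "x \<in> A (insert b S)"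
        define c where "c = representation B x b"
        have "b \<in> B" using insert.prems by simp
        then have "c \<in> ideal (if b \<in> insert b S then 0 else 1)" using x unfolding A_def c_def by blast
        then have c: "c \<in> ideal 0" by simp
        have "representation B (x + (- c) *s b) b' \<in> ideal (if b' \<in> S then 0 else 1)" if "b' \<in> B" for b'
          using x that rb insert.hyps
          by (simp only: representation_linear[OF B]) (auto simp: A_def c_def zero_in_ideal)
        then have "x + (- c) *s b \<in> A S" by (simp add: A_def)
        moreover have "x = (x + (- c) *s b) + c *s b" by simp
        ultimately show "x \<in> adjoin (A S) b" unfolding adjoin_def using c by blast
      qed
    qed
    then have "index (A S) (A (insert b S)) = q" using index_adjoin[OF sub bA \<pi>b] by simp
    moreover have "index (smul \<pi> L) (A (insert b S)) = index (smul \<pi> L) (A S) * index (A S) (A (insert b S))"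
    proof (rule index_mult)
      show "smul \<pi> L \<subseteq> A S" unfolding A_def using \<pi>L ideal_mono[of 0 1] by auto
      show "A S \<subseteq> A (insert b S)" using \<open>adjoin (A S) b = A (insert b S)\<close> adjoin_superset[OF sub] by blast
    qed (use sub assms smul_submodule lattice_submodule add_subgroup_O_submodule in blast)+
    ultimately show ?case using insert by simp
  qed
  moreover have "A B = L" using mem_lattice_iff[OF B] by (auto simp: A_def)
  ultimately show ?thesis using B by (metis lattice_basis_def order_refl)
qed

section \<open>Indices between lattices\<close>

lemma smul_\<pi>_perp: "smul \<pi> (perp m L) = perp (m + 1) L"
  using smul_perp[OF uniformizer(1)] uniformizer(2) by simp

lemma smul_\<pi>D: "smul \<pi> B \<subseteq> A \<Longrightarrow> y \<in> B \<Longrightarrow> \<pi> *s y \<in> A"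
  by (auto simp: smul_def)

lemma index_pos:
  assumes "is_lattice B" "O_submodule A" "smul \<pi> B \<subseteq> A" "A \<subseteq> B"
  shows "0 < index A B"
proof -
  have B: "O_submodule B" using assms(1) by (rule lattice_submodule)
  have "index (smul \<pi> B) B = index (smul \<pi> B) A * index A B"
    by (intro index_mult add_subgroup_O_submodule smul_submodule B assms)
  moreover have "0 < index (smul \<pi> B) B" using index_smul_\<pi>[OF assms(1)] two_le_q by simp
  ultimately show ?thesis by (metis gr0I mult_0_right less_irrefl)
qed

lemma smul_\<pi>_proper:
  assumes "is_lattice L"
  shows "\<not> L \<subseteq> smul \<pi> L"
proof
  assume "L \<subseteq> smul \<pi> L"
  moreover have L: "O_submodule L" using assms by (rule lattice_submodule)
  ultimately have "smul \<pi> L = L" using smul_subset[OF L \<pi>_in_\<O>] by blast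
  then have "q ^ (2 * n) = 1"
    using index_smul_\<pi>[OF assms] index_self[OF add_subgroup_O_submodule[OF L]] by simp
  then show False using two_le_q n_pos by simp
qed

text \<open>
  Pairing with \<open>y\<close> maps the dual of \<open>A\<close> to \<open>\<pi>\<^bsup>m - 1\<^esup> \<O>\<close>, and the dual of \<open>A + \<O> y\<close> is the preimage of
  \<open>\<pi>\<^sup>m \<O>\<close>. A vector \<open>x\<close> whose value has order exactly \<open>m - 1\<close> generates the former over the latter.
\<close>

lemma index_perp_adjoin:
  assumes A: "is_lattice A" and y: "y \<notin> A" "\<pi> *s y \<in> A"
  shows "index (perp m (adjoin A y)) (perp m A) = q"
proof -
  have As: "O_submodule A" using A by (rule lattice_submodule)
  have A': "is_lattice (adjoin A y)" using adjoin_lattice[OF A y] .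
  have "\<not> perp m A \<subseteq> perp m (adjoin A y)"
  proof
    assume "perp m A \<subseteq> perp m (adjoin A y)"
    then have "perp m (perp m (adjoin A y)) \<subseteq> perp m (perp m A)" by (rule perp_antimono)
    then have "adjoin A y \<subseteq> A" using perp_lattice(2)[OF A] perp_lattice(2)[OF A'] by simp
    then show False using adjoin_superset(2)[OF As, of y] y(1) by blast
  qed
  then obtain x where x: "x \<in> perp m A" "x \<notin> perp m (adjoin A y)" by blast
  have mem: "z \<in> perp m (adjoin A y) \<longleftrightarrow> form z y \<in> ideal m" if z: "z \<in> perp m A" for z
  proof
    assume "form z y \<in> ideal m"
    then show "z \<in> perp m (adjoin A y)"
      using z ideal_mult[of _ 0 "form z y" m]
      by (auto simp: perp_def adjoin_def form_add_right form_scale_right intro!: ideal_add)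
  qed (use adjoin_superset[OF As] in \<open>auto simp: perp_def\<close>)
  have fy: "form z y \<in> ideal (m - 1)" if "z \<in> perp m A" for z
  proof -
    have "\<pi> * form z y \<in> ideal m" using that y by (simp add: perp_def form_scale_right[symmetric])
    then show ?thesis using uniformizer by (simp add: scale_in_ideal_iff)
  qed
  have xy: "form x y \<noteq> 0" "ord (form x y) = m - 1"
    using fy[OF x(1)] x(2) mem[OF x(1)] by (auto simp: ideal_def)
  have \<pi>x: "\<pi> *s x \<in> perp m (adjoin A y)"
  proof -
    have "\<pi> *s x \<in> perp m A" using O_submodule_closed(3)[OF perp_submodule \<pi>_in_\<O> x(1)] .
    moreover have "form (\<pi> *s x) y \<in> ideal m"
      using fy[OF x(1)] uniformizer by (simp add: form_scale_left scale_in_ideal_iff)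
    ultimately show ?thesis using mem by simp
  qed
  have "adjoin (perp m (adjoin A y)) x = perp m A"
  proof
    show "adjoin (perp m (adjoin A y)) x \<subseteq> perp m A"
      by (rule adjoin_subset[OF perp_submodule perp_antimono[OF adjoin_superset(1)[OF As]] x(1)])
    show "perp m A \<subseteq> adjoin (perp m (adjoin A y)) x"
    proof
      fix z assume z: "z \<in> perp m A"
      define c where "c = form z y * inverse (form x y)"
      have "inverse (form x y) \<in> ideal (1 - m)" using xy by (simp add: ideal_def ord_inverse)
      then have c: "c \<in> ideal 0" using ideal_mult[OF fy[OF z]] by (force simp: c_def)
      have "z - c *s x \<in> perp m A"
        by (intro O_submodule_closed(5)[OF perp_submodule] z O_submodule_closed(3)[OF perp_submodule] c x)
      moreover have "form (z - c *s x) y = 0"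
        using xy by (simp add: form_diff_left form_scale_left c_def)
      ultimately have "z - c *s x \<in> perp m (adjoin A y)" using mem zero_in_ideal by simp
      moreover have "z = (z - c *s x) + c *s x" by simp
      ultimately show "z \<in> adjoin (perp m (adjoin A y)) x" unfolding adjoin_def using c by blast
    qed
  qed
  then show ?thesis using index_adjoin[OF perp_submodule x(2) \<pi>x] by simp
qed

text \<open>
  For \<open>\<pi> B \<subseteq> A \<subseteq> B\<close>, adjoining vectors one at a time leads from \<open>A\<close> to \<open>B\<close> in steps of index \<open>q\<close>, and each
  step is mirrored by one of the dual lattices.
\<close>

lemma index_perp:
  assumes "is_lattice A" "is_lattice B" "smul \<pi> B \<subseteq> A" "A \<subseteq> B"
  shows "(\<exists>j. index A B = q ^ j) \<and> index (perp m B) (perp m A) = index A B"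
  using assms
proof (induction "index A B" arbitrary: A rule: less_induct)
  case less
  have As: "O_submodule A" and Bs: "O_submodule B" using less.prems lattice_submodule by auto
  show ?case
  proof (cases "A = B")
    case True
    then show ?thesis
      using index_self[OF add_subgroup_O_submodule[OF Bs]]
        index_self[OF add_subgroup_O_submodule[OF perp_submodule]] power_0 by metis
  next
    case False
    then obtain y where y: "y \<in> B" "y \<notin> A" using less.prems by blast
    then have \<pi>y: "\<pi> *s y \<in> A" using smul_\<pi>D less.prems by blast
    define A' where "A' = adjoin A y"
    have A': "is_lattice A'" "A \<subseteq> A'" "A' \<subseteq> B" "smul \<pi> B \<subseteq> A'"
      using adjoin_lattice[OF less.prems(1) y(2) \<pi>y] adjoin_superset[OF As]
        adjoin_subset[OF Bs less.prems(4) y(1)] less.prems(3) unfolding A'_def by blast+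
    have A's: "O_submodule A'" using A' lattice_submodule by blast
    have e: "index A B = q * index A' B"
      using index_mult[of A A' B] index_adjoin[OF As y(2) \<pi>y] A' add_subgroup_O_submodule As Bs A's
      unfolding A'_def by simp
    moreover have "0 < index A' B" using index_pos[OF less.prems(2) A's A'(4,3)] .
    ultimately have "index A' B < index A B" using two_le_q by simp
    from less.hyps[OF this A'(1) less.prems(2) A'(4,3)]
    obtain j where j: "index A' B = q ^ j" "index (perp m B) (perp m A') = index A' B" by blast
    have "index (perp m B) (perp m A) = index (perp m B) (perp m A') * index (perp m A') (perp m A)"
      by (intro index_mult add_subgroup_O_submodule perp_submodule perp_antimono A')
    also have "index (perp m A') (perp m A) = q"
      unfolding A'_def by (rule index_perp_adjoin[OF less.prems(1) y(2) \<pi>y])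
    finally show ?thesis using e j by (auto intro: exI[of _ "Suc j"])
  qed
qed

text \<open>An extension of index \<open>q\<close> leaves no room for a lattice strictly in between.\<close>

lemma adjoin_eq_of_index:
  assumes "O_submodule A" "O_submodule Y" "A \<subseteq> Y" "smul \<pi> Y \<subseteq> A" "index A Y = q" "y \<in> Y" "y \<notin> A"
  shows "Y = adjoin A y"
proof -
  have sub: "A \<subseteq> adjoin A y" "adjoin A y \<subseteq> Y"
    using adjoin_superset[OF assms(1)] adjoin_subset[OF assms(2,3,6)] by auto
  have "index A Y = index A (adjoin A y) * index (adjoin A y) Y"
    by (intro index_mult add_subgroup_O_submodule adjoin_submodule assms sub)
  also have "index A (adjoin A y) = q" using index_adjoin[OF assms(1,7)] smul_\<pi>D[OF assms(4,6)] .
  finally have "index (adjoin A y) Y = 1" using assms(5) two_le_q by simp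
  then show ?thesis
    using index_eq_1[OF add_subgroup_O_submodule[OF adjoin_submodule[OF assms(1)]] sub(2)] by blast
qed

text \<open>
  The nonzero vectors of \<open>B / A\<close> are distributed over its lines, \<open>q - 1\<close> to each.
\<close>

lemma card_lines:
  assumes A: "O_submodule A" and B: "O_submodule B" and AB: "A \<subseteq> B" "smul \<pi> B \<subseteq> A" and pos: "0 < index A B"
  shows "card {Y. O_submodule Y \<and> A \<subseteq> Y \<and> Y \<subseteq> B \<and> index A Y = q} * (q - 1) = index A B - 1"
proof -
  define Z where "Z = {Y. O_submodule Y \<and> A \<subseteq> Y \<and> Y \<subseteq> B \<and> index A Y = q}"
  have Asub: "add_subgroup A" using A by (rule add_subgroup_O_submodule)
  have A0: "A = (+) 0 ` A" by simp
  have coset_A: "(+) x ` A = A \<longleftrightarrow> x \<in> A" for x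
    using coset_eq_iff[OF Asub, of x 0] by simp
  have fin: "finite (cosets A B)" using pos by (simp add: index_def card_ge_0_finite)
  have ZD: "O_submodule Y" "A \<subseteq> Y" "Y \<subseteq> B" "index A Y = q" "smul \<pi> Y \<subseteq> A" if "Y \<in> Z" for Y
    using that AB(2) smul_mono[of Y B \<pi>] by (auto simp: Z_def)
  have sub: "cosets A Y \<subseteq> cosets A B" if "Y \<in> Z" for Y using ZD(3)[OF that] by (auto simp: cosets_def)
  have U: "Y = \<Union> (cosets A Y)" if "Y \<in> Z" for Y
  proof
    show "Y \<subseteq> \<Union> (cosets A Y)"
      using O_submodule_closed(1)[OF A] by (auto simp: cosets_def mem_coset_iff)
    show "\<Union> (cosets A Y) \<subseteq> Y"
      using ZD(1,2)[OF that] by (auto simp: cosets_def intro!: O_submodule_closed(2))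
  qed
  have "Z \<subseteq> Union ` Pow (cosets A B)"
  proof
    fix Y assume "Y \<in> Z"
    then show "Y \<in> Union ` Pow (cosets A B)" using U sub by (intro image_eqI[of _ _ "cosets A Y"]) auto
  qed
  moreover have "finite (Union ` Pow (cosets A B))" using fin by simp
  ultimately have finZ: "finite Z" by (rule finite_subset)
  have Amem: "A \<in> cosets A Y" if "A \<subseteq> Y" for Y
    unfolding cosets_def using that O_submodule_closed(1)[OF A] by (intro image_eqI[of _ _ 0]) auto
  have "cosets A B - {A} = (\<Union>Y\<in>Z. cosets A Y - {A})"
  proof
    show "(\<Union>Y\<in>Z. cosets A Y - {A}) \<subseteq> cosets A B - {A}" using sub by blast
    show "cosets A B - {A} \<subseteq> (\<Union>Y\<in>Z. cosets A Y - {A})"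
    proof
      fix X assume X: "X \<in> cosets A B - {A}"
      then obtain x where x: "x \<in> B" "X = (+) x ` A" by (auto simp: cosets_def)
      then have xA: "x \<notin> A" using X coset_A by auto
      have "adjoin A x \<in> Z" unfolding Z_def
        using adjoin_submodule[OF A] adjoin_superset[OF A] adjoin_subset[OF B AB(1) x(1)]
          index_adjoin[OF A xA smul_\<pi>D[OF AB(2) x(1)]] by blast
      moreover have "X \<in> cosets A (adjoin A x)"
        using adjoin_superset(2)[OF A] x by (auto simp: cosets_def)
      ultimately show "X \<in> (\<Union>Y\<in>Z. cosets A Y - {A})" using X by blast
    qed
  qed
  then have "card (cosets A B - {A}) = (\<Sum>Y\<in>Z. card (cosets A Y - {A}))"
  proof (simp only:, intro card_UN_disjoint[OF finZ])
    show "\<forall>Y\<in>Z. finite (cosets A Y - {A})" using sub fin finite_subset by blast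
    show "\<forall>Y\<in>Z. \<forall>Y'\<in>Z. Y \<noteq> Y' \<longrightarrow> (cosets A Y - {A}) \<inter> (cosets A Y' - {A}) = {}"
    proof (intro ballI impI, rule ccontr)
      fix Y Y' assume Y: "Y \<in> Z" "Y' \<in> Z" "Y \<noteq> Y'" "(cosets A Y - {A}) \<inter> (cosets A Y' - {A}) \<noteq> {}"
      then obtain X where X: "X \<in> cosets A Y" "X \<in> cosets A Y'" "X \<noteq> A" by blast
      then obtain x where x: "X = (+) x ` A" "x \<in> Y" by (auto simp: cosets_def)
      have xA: "x \<notin> A" using x X coset_A by auto
      have "x \<in> X" using x O_submodule_closed(1)[OF A] by (simp add: mem_coset_iff)
      then have "x \<in> Y'" using X(2) by (subst U[OF Y(2)]) (rule UnionI)
      have "Y = adjoin A x" by (rule adjoin_eq_of_index[OF A ZD(1,2,5,4)[OF Y(1)] x(2) xA])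
      moreover have "Y' = adjoin A x" by (rule adjoin_eq_of_index[OF A ZD(1,2,5,4)[OF Y(2)] \<open>x \<in> Y'\<close> xA])
      ultimately show False using Y by simp
    qed
  qed
  also have "\<dots> = card Z * (q - 1)"
  proof -
    have "card (cosets A Y - {A}) = q - 1" if "Y \<in> Z" for Y
      using Amem[OF ZD(2)[OF that]] ZD(4)[OF that] by (simp add: index_def)
    then show ?thesis by simp
  qed
  finally show ?thesis using Amem[OF AB(1)] by (simp add: index_def Z_def)
qed

section \<open>The poset of vertex lattices\<close>

text \<open>
  The distinguished representatives of the vertices. The first inclusion is what
  remains of \<open>\<pi> L\<^sub>0 \<subseteq> X\<close> when \<open>L\<^sub>0\<close> is eliminated; the second says that the form takes values in \<open>\<pi>\<O>\<close>.
\<close>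

definition vertex_lattice :: "'v set \<Rightarrow> bool" where
  "vertex_lattice X \<longleftrightarrow> is_lattice X \<and> perp 2 X \<subseteq> X \<and> X \<subseteq> perp 1 X"

lemma vertex_latticeD:
  assumes "vertex_lattice X"
  shows "is_lattice X" "O_submodule X" "perp 2 X \<subseteq> X" "X \<subseteq> perp 1 X" "smul \<pi> X \<subseteq> perp 2 X"
    "smul \<pi> (perp 1 X) \<subseteq> X"
proof -
  show *: "is_lattice X" "perp 2 X \<subseteq> X" "X \<subseteq> perp 1 X" using assms by (auto simp: vertex_lattice_def)
  show "O_submodule X" using * lattice_submodule by blast
  have "smul \<pi> (perp 1 X) = perp 2 X" by (simp add: smul_\<pi>_perp)
  then show "smul \<pi> X \<subseteq> perp 2 X" "smul \<pi> (perp 1 X) \<subseteq> X"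
    using smul_mono[OF *(3)] *(2) by metis+
qed

lemma smul_\<pi>_between:
  assumes "vertex_lattice X" "vertex_lattice Y" "X \<subseteq> Y"
  shows "smul \<pi> Y \<subseteq> X"
  by (rule order_trans[OF vertex_latticeD(5)[OF assms(2)]
        order_trans[OF perp_antimono[OF assms(3)] vertex_latticeD(3)[OF assms(1)]]])

text \<open>The order of the symplectic space \<open>X / \<pi>\<^sup>2 X\<^sup>#\<close>.\<close>

definition depth :: "'v set \<Rightarrow> nat" where
  "depth X = index (perp 2 X) X"

text \<open>Enlarging \<open>X\<close> to \<open>Y\<close> shrinks the dual by the same index, which is why the square appears.\<close>

lemma depth_mult:
  assumes X: "vertex_lattice X" and Y: "vertex_lattice Y" and XY: "X \<subseteq> Y"
  shows "depth Y = depth X * (index X Y)\<^sup>2"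
proof -
  note XD = vertex_latticeD[OF X] and YD = vertex_latticeD[OF Y]
  have "index (perp 2 Y) Y = index (perp 2 Y) X * index X Y"
    by (intro index_mult add_subgroup_O_submodule perp_submodule XD YD XY
        order_trans[OF perp_antimono[OF XY] XD(3)])
  also have "index (perp 2 Y) X = index (perp 2 Y) (perp 2 X) * index (perp 2 X) X"
    by (intro index_mult add_subgroup_O_submodule perp_submodule XD perp_antimono XY)
  also have "index (perp 2 Y) (perp 2 X) = index X Y"
    using index_perp[OF XD(1) YD(1) smul_\<pi>_between[OF X Y XY] XY] by blast
  finally show ?thesis by (simp add: depth_def power2_eq_square)
qed

lemma depth_codepth:
  assumes X: "vertex_lattice X"
  shows "depth X * index X (perp 1 X) = q ^ (2 * n)"
proof -
  note XD = vertex_latticeD[OF X]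
  have "index (perp 2 X) (perp 1 X) = index (perp 2 X) X * index X (perp 1 X)"
    by (intro index_mult add_subgroup_O_submodule perp_submodule XD)
  moreover have "perp 2 X = smul \<pi> (perp 1 X)" by (simp add: smul_\<pi>_perp)
  ultimately show ?thesis using index_smul_\<pi>[OF perp_lattice(1)[OF XD(1)]] by (simp add: depth_def)
qed

text \<open>Every line is isotropic because the form is alternating: adjoining one vector costs nothing.\<close>

lemma isotropic_adjoin:
  assumes "\<And>x x'. x \<in> A \<Longrightarrow> x' \<in> A \<Longrightarrow> form x x' \<in> ideal m" "\<And>x. x \<in> A \<Longrightarrow> form y x \<in> ideal m"
  shows "adjoin A y \<subseteq> perp m (adjoin A y)"
proof -
  have sw: "form x y \<in> ideal m" if "x \<in> A" for x
    using assms(2)[OF that] form_swap[of x y] ideal_minus by simp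
  have "form (x + c *s y) (x' + d *s y) \<in> ideal m"
    if x: "x \<in> A" "x' \<in> A" and c: "c \<in> ideal 0" "d \<in> ideal 0" for x x' c d
    using assms(1)[OF x] ideal_mult[OF c(1) assms(2)[OF x(2)]] ideal_mult[OF c(2) sw[OF x(1)]]
    by (simp add: form_add_left form_add_right form_scale_left form_scale_right alternating ideal_add)
  then show ?thesis by (auto simp: perp_def adjoin_def)
qed

lemma up_step:
  assumes X: "vertex_lattice X" and y: "y \<in> perp 1 X" "y \<notin> X"
  shows "vertex_lattice (adjoin X y)" "index X (adjoin X y) = q"
proof -
  note XD = vertex_latticeD[OF X]
  have \<pi>y: "\<pi> *s y \<in> X" using smul_\<pi>D[OF XD(6) y(1)] .
  show "index X (adjoin X y) = q" by (rule index_adjoin[OF XD(2) y(2) \<pi>y])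
  have sup: "X \<subseteq> adjoin X y" by (rule adjoin_superset(1)[OF XD(2)])
  then have "perp 2 (adjoin X y) \<subseteq> adjoin X y" using perp_antimono[OF sup, of 2] XD(3) by blast
  moreover have "adjoin X y \<subseteq> perp 1 (adjoin X y)"
    using XD(4) y(1) by (intro isotropic_adjoin) (auto simp: perp_def)
  ultimately show "vertex_lattice (adjoin X y)"
    using adjoin_lattice[OF XD(1) y(2) \<pi>y] by (simp add: vertex_lattice_def)
qed

text \<open>
  In the symplectic space \<open>X / \<pi>\<^sup>2 X\<^sup>#\<close> this replaces \<open>X\<close> by the orthogonal complement of the line spanned by
  \<open>y\<close>, a hyperplane that contains the line.
\<close>

lemma down_step:
  assumes X: "vertex_lattice X" and y: "y \<in> X" "y \<notin> perp 2 X"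
  defines "Y \<equiv> perp 2 (adjoin (perp 2 X) y)"
  shows "vertex_lattice Y" "Y \<subseteq> X" "index Y X = q" "perp 2 Y = adjoin (perp 2 X) y"
proof -
  note XD = vertex_latticeD[OF X]
  define Z where "Z = adjoin (perp 2 X) y"
  have EX: "is_lattice (perp 2 X)" "perp 2 (perp 2 X) = X" using perp_lattice[OF XD(1)] by auto
  have \<pi>y: "\<pi> *s y \<in> perp 2 X" using smul_\<pi>D[OF XD(5) y(1)] .
  have Z: "is_lattice Z" unfolding Z_def by (rule adjoin_lattice[OF EX(1) y(2) \<pi>y])
  have sup: "perp 2 X \<subseteq> Z" unfolding Z_def by (rule adjoin_superset(1)[OF perp_submodule])
  have YZ: "Y = perp 2 Z" by (simp add: Y_def Z_def)
  have Y: "is_lattice Y" "perp 2 Y = Z" unfolding YZ using perp_lattice[OF Z] by auto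
  then show "perp 2 Y = adjoin (perp 2 X) y" by (simp add: Z_def)
  show YX: "Y \<subseteq> X" unfolding YZ using perp_antimono[OF sup] EX(2) by metis
  have "Z \<subseteq> perp 2 Z" unfolding Z_def
  proof (rule isotropic_adjoin)
    show "form x x' \<in> ideal 2" if "x \<in> perp 2 X" "x' \<in> perp 2 X" for x x'
      using that XD(3) by (auto simp: perp_def)
    show "form y x \<in> ideal 2" if "x \<in> perp 2 X" for x
      using y(1) EX(2) that by (auto simp: perp_def)
  qed
  moreover have "Y \<subseteq> perp 1 Y" using YX XD(4) perp_antimono[OF YX, of 1] by blast
  ultimately show "vertex_lattice Y" using Y by (simp add: vertex_lattice_def YZ)
  have "index (perp 2 (adjoin (perp 2 X) y)) (perp 2 (perp 2 X)) = q"
    by (rule index_perp_adjoin[OF EX(1) y(2) \<pi>y])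
  then show "index Y X = q" using EX(2) by (simp add: Y_def)
qed

text \<open>
  Repeated downward steps divide the depth by \<open>q\<^sup>2\<close> until it is \<open>1\<close>. This shows at once that the depth is an
  even power of \<open>q\<close> and that a lattice with \<open>\<pi>\<^sup>2 M\<^sup># = M\<close> is reached.
\<close>

lemma depth_power_and_self_dual_below:
  assumes "vertex_lattice X"
  shows "(\<exists>j\<le>n. depth X = q ^ (2 * j)) \<and> (\<exists>M. vertex_lattice M \<and> M \<subseteq> X \<and> perp 2 M = M)"
proof -
  have "(\<exists>j. depth X = q ^ (2 * j)) \<and> (\<exists>M. vertex_lattice M \<and> M \<subseteq> X \<and> perp 2 M = M)"
    using assms
  proof (induction "depth X" arbitrary: X rule: less_induct)
    case less
    note XD = vertex_latticeD[OF less.prems]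
    show ?case
    proof (cases "perp 2 X = X")
      case True
      then have "depth X = q ^ (2 * 0)"
        using index_self[OF add_subgroup_O_submodule[OF XD(2)]] by (simp add: depth_def)
      then show ?thesis using True less.prems by blast
    next
      case False
      then obtain y where y: "y \<in> X" "y \<notin> perp 2 X" using XD(3) by blast
      define Y where "Y = perp 2 (adjoin (perp 2 X) y)"
      have Y: "vertex_lattice Y" "Y \<subseteq> X" "index Y X = q"
        using down_step[OF less.prems y] by (auto simp: Y_def)
      have e: "depth X = depth Y * q\<^sup>2" using depth_mult[OF Y(1) less.prems Y(2)] Y(3) by simp
      have "0 < depth X" unfolding depth_def by (rule index_pos[OF XD(1) perp_submodule XD(5,3)])
      then have "0 < depth Y" using e by simp
      moreover have "1 < q\<^sup>2" using two_le_q by (intro one_less_power) auto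
      ultimately have "depth Y < depth X" using e by simp
      from less.hyps[OF this Y(1)] obtain j M where
        "depth Y = q ^ (2 * j)" "vertex_lattice M" "M \<subseteq> Y" "perp 2 M = M" by blast
      moreover have "q ^ (2 * j) * q\<^sup>2 = q ^ (2 * Suc j)" by (simp add: power_add[symmetric] add.commute)
      ultimately show ?thesis using e Y(2) by (metis order_trans)
    qed
  qed
  then obtain j where j: "depth X = q ^ (2 * j)"
    and M: "\<exists>M. vertex_lattice M \<and> M \<subseteq> X \<and> perp 2 M = M" by blast
  have "q ^ (2 * j) dvd q ^ (2 * n)" using depth_codepth[OF assms] j by (metis dvd_triv_left)
  then have "q ^ (2 * j) \<le> q ^ (2 * n)" using two_le_q by (intro dvd_imp_le) auto
  then have "j \<le> n" using two_le_q by simp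
  then show ?thesis using j M by blast
qed

definition rank :: "'v set \<Rightarrow> nat" where
  "rank X = (THE j. depth X = q ^ (2 * j))"

lemma depth_eq:
  assumes "vertex_lattice X"
  shows "depth X = q ^ (2 * rank X)" "rank X \<le> n"
proof -
  obtain j where j: "j \<le> n" "depth X = q ^ (2 * j)"
    using depth_power_and_self_dual_below[OF assms] by blast
  have "rank X = j" unfolding rank_def
  proof (rule the_equality[where P = "\<lambda>j. depth X = q ^ (2 * j)", OF j(2)])
    fix i assume "depth X = q ^ (2 * i)"
    then have "q ^ (2 * i) = q ^ (2 * j)" using j by simp
    then show "i = j" using two_le_q by simp
  qed
  then show "depth X = q ^ (2 * rank X)" "rank X \<le> n" using j by auto
qed

lemma codepth_eq:
  assumes "vertex_lattice X"
  shows "index X (perp 1 X) = q ^ (2 * (n - rank X))"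
proof -
  have "q ^ (2 * rank X) * index X (perp 1 X) = q ^ (2 * rank X) * q ^ (2 * (n - rank X))"
    using depth_codepth[OF assms] depth_eq[OF assms]
    by (simp add: power_add[symmetric] right_diff_distrib')
  then show ?thesis using two_le_q by simp
qed

lemma index_eq_rank:
  assumes X: "vertex_lattice X" and Y: "vertex_lattice Y" and XY: "X \<subseteq> Y"
  shows "rank X \<le> rank Y" "index X Y = q ^ (rank Y - rank X)"
proof -
  note XD = vertex_latticeD[OF X] and YD = vertex_latticeD[OF Y]
  obtain j where j: "index X Y = q ^ j"
    using index_perp[OF XD(1) YD(1) smul_\<pi>_between[OF X Y XY] XY] by blast
  have "q ^ (2 * rank Y) = q ^ (2 * rank X) * (q ^ j)\<^sup>2"
    using depth_mult[OF X Y XY] depth_eq(1)[OF X] depth_eq(1)[OF Y] j by simp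
  also have "\<dots> = q ^ (2 * (rank X + j))" by (simp add: power_mult[symmetric] power_add[symmetric] algebra_simps)
  finally have "rank Y = rank X + j" using two_le_q by simp
  then show "rank X \<le> rank Y" "index X Y = q ^ (rank Y - rank X)" using j by auto
qed

lemma rank_less:
  assumes X: "vertex_lattice X" and Y: "vertex_lattice Y" and XY: "X \<subset> Y"
  shows "rank X < rank Y"
proof (rule ccontr)
  assume "\<not> rank X < rank Y"
  then have "index X Y = 1" using index_eq_rank[OF X Y] XY by auto
  then show False
    using index_eq_1[OF add_subgroup_O_submodule[OF vertex_latticeD(2)[OF X]]] XY by blast
qed

lemma rank_Suc_iff:
  assumes X: "vertex_lattice X" and Y: "vertex_lattice Y" and XY: "X \<subseteq> Y"
  shows "rank Y = Suc (rank X) \<longleftrightarrow> index X Y = q"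
proof -
  have "index X Y = q ^ (rank Y - rank X)" "rank X \<le> rank Y" using index_eq_rank[OF X Y XY] by auto
  moreover have "q ^ i = q \<longleftrightarrow> i = 1" for i
    using two_le_q power_inject_exp[of q i 1] by simp
  ultimately have "index X Y = q \<longleftrightarrow> rank Y - rank X = 1" by metis
  then show ?thesis using \<open>rank X \<le> rank Y\<close> by linarith
qed

lemma rank_0_iff:
  assumes X: "vertex_lattice X"
  shows "rank X = 0 \<longleftrightarrow> perp 2 X = X"
proof
  assume "rank X = 0"
  then have "index (perp 2 X) X = 1" using depth_eq(1)[OF X] by (simp add: depth_def)
  then show "perp 2 X = X"
    using index_eq_1[OF add_subgroup_O_submodule[OF perp_submodule] vertex_latticeD(3)[OF X]] by simp
next
  assume "perp 2 X = X"
  then have "depth X = 1"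
    using index_self[OF add_subgroup_O_submodule[OF vertex_latticeD(2)[OF X]]] by (simp add: depth_def)
  then show "rank X = 0" using depth_eq(1)[OF X] two_le_q by simp
qed

lemma rank_n_iff:
  assumes X: "vertex_lattice X"
  shows "rank X = n \<longleftrightarrow> perp 1 X = X"
proof
  assume "rank X = n"
  then have "index X (perp 1 X) = 1" using codepth_eq[OF X] by simp
  then show "perp 1 X = X"
    by (rule index_eq_1[OF add_subgroup_O_submodule[OF vertex_latticeD(2)[OF X]] vertex_latticeD(4)[OF X]])
next
  assume "perp 1 X = X"
  then have "index X (perp 1 X) = 1"
    using index_self[OF add_subgroup_O_submodule[OF vertex_latticeD(2)[OF X]]] by simp
  then have "q ^ (2 * (n - rank X)) = 1" using codepth_eq[OF X] by simp
  then show "rank X = n" using two_le_q depth_eq(2)[OF X] by simp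
qed

text \<open>Covers of \<open>X\<close> correspond to the lines of \<open>\<pi> X\<^sup># / X\<close>.\<close>

lemma upper_covers:
  assumes X: "vertex_lattice X"
  shows "card {Y. vertex_lattice Y \<and> X \<subset> Y \<and> rank Y = Suc (rank X)} = num_lines (n - rank X)"
proof (rule num_lines_eqI)
  note XD = vertex_latticeD[OF X]
  have "{Y. vertex_lattice Y \<and> X \<subset> Y \<and> rank Y = Suc (rank X)} =
      {Y. O_submodule Y \<and> X \<subseteq> Y \<and> Y \<subseteq> perp 1 X \<and> index X Y = q}"
  proof (intro equalityI subsetI)
    fix Y assume "Y \<in> {Y. vertex_lattice Y \<and> X \<subset> Y \<and> rank Y = Suc (rank X)}"
    then have Y: "vertex_lattice Y" "X \<subset> Y" "rank Y = Suc (rank X)" by auto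
    have "Y \<subseteq> perp 1 X" using vertex_latticeD(4)[OF Y(1)] perp_antimono[of X Y 1] Y(2) by blast
    then show "Y \<in> {Y. O_submodule Y \<and> X \<subseteq> Y \<and> Y \<subseteq> perp 1 X \<and> index X Y = q}"
      using Y vertex_latticeD(2)[OF Y(1)] rank_Suc_iff[OF X Y(1)] by blast
  next
    fix Y assume "Y \<in> {Y. O_submodule Y \<and> X \<subseteq> Y \<and> Y \<subseteq> perp 1 X \<and> index X Y = q}"
    then have Y: "O_submodule Y" "X \<subseteq> Y" "Y \<subseteq> perp 1 X" "index X Y = q" by auto
    have "X \<noteq> Y" using Y(4) index_self[OF add_subgroup_O_submodule[OF XD(2)]] two_le_q by auto
    then obtain y where y: "y \<in> Y" "y \<notin> X" using Y(2) by blast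
    have "smul \<pi> Y \<subseteq> X" using smul_mono[OF Y(3)] XD(6) by blast
    then have "Y = adjoin X y" by (intro adjoin_eq_of_index XD Y y)
    then have "vertex_lattice Y" using up_step(1)[OF X _ y(2)] y(1) Y(3) by auto
    then show "Y \<in> {Y. vertex_lattice Y \<and> X \<subset> Y \<and> rank Y = Suc (rank X)}"
      using rank_Suc_iff[OF X _ Y(2)] Y \<open>X \<noteq> Y\<close> by blast
  qed
  moreover have "card {Y. O_submodule Y \<and> X \<subseteq> Y \<and> Y \<subseteq> perp 1 X \<and> index X Y = q} * (q - 1)
      = index X (perp 1 X) - 1"
    by (intro card_lines XD perp_submodule index_pos perp_lattice)
  ultimately show "card {Y. vertex_lattice Y \<and> X \<subset> Y \<and> rank Y = Suc (rank X)} * (q - 1) =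
      q ^ (2 * (n - rank X)) - 1"
    using codepth_eq[OF X] by simp
qed

text \<open>
  A lower cover \<open>Y\<close> corresponds to the line \<open>\<pi>\<^sup>2 Y\<^sup># / \<pi>\<^sup>2 X\<^sup>#\<close> in \<open>X / \<pi>\<^sup>2 X\<^sup>#\<close>, its orthogonal complement there.
\<close>

lemma lower_covers:
  assumes X: "vertex_lattice X"
  shows "card {Y. vertex_lattice Y \<and> Y \<subset> X \<and> rank X = Suc (rank Y)} = num_lines (rank X)"
proof (rule num_lines_eqI)
  note XD = vertex_latticeD[OF X]
  define S where "S = {Y. vertex_lattice Y \<and> Y \<subset> X \<and> rank X = Suc (rank Y)}"
  define T where "T = {Z. O_submodule Z \<and> perp 2 X \<subseteq> Z \<and> Z \<subseteq> X \<and> index (perp 2 X) Z = q}"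
  have dd: "perp 2 (perp 2 Y) = Y" if "Y \<in> S" for Y
    using that vertex_latticeD(1) perp_lattice(2) by (auto simp: S_def)
  have "perp 2 ` S = T"
  proof
    show "perp 2 ` S \<subseteq> T"
    proof clarify
      fix Y assume "Y \<in> S"
      then have Y: "vertex_lattice Y" "Y \<subseteq> X" "index Y X = q"
        using rank_Suc_iff[OF _ X] by (auto simp: S_def)
      have "index (perp 2 X) (perp 2 Y) = index Y X"
        using index_perp[OF vertex_latticeD(1)[OF Y(1)] XD(1) smul_\<pi>_between[OF Y(1) X Y(2)] Y(2)] by blast
      then show "perp 2 Y \<in> T"
        unfolding T_def using perp_submodule perp_antimono[OF Y(2)] vertex_latticeD(3)[OF Y(1)] Y by auto
    qed
    show "T \<subseteq> perp 2 ` S"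
    proof
      fix Z assume "Z \<in> T"
      then have Z: "O_submodule Z" "perp 2 X \<subseteq> Z" "Z \<subseteq> X" "index (perp 2 X) Z = q" by (auto simp: T_def)
      have "perp 2 X \<noteq> Z" using Z(4) index_self[OF add_subgroup_O_submodule[OF perp_submodule]] two_le_q
        by (metis One_nat_def Suc_1 Suc_n_not_le_n)
      then obtain y where y: "y \<in> Z" "y \<notin> perp 2 X" using Z(2) by blast
      have "smul \<pi> Z \<subseteq> perp 2 X" using smul_mono[OF Z(3)] XD(5) by blast
      then have Zy: "Z = adjoin (perp 2 X) y" by (intro adjoin_eq_of_index perp_submodule Z y)
      define Y where "Y = perp 2 Z"
      have yX: "y \<in> X" using y Z by blast
      have Y: "vertex_lattice Y" "Y \<subseteq> X" "index Y X = q" "perp 2 Y = Z"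
        using down_step[OF X yX y(2)] by (auto simp: Y_def Zy)
      then have "rank X = Suc (rank Y)" using rank_Suc_iff[OF Y(1) X Y(2)] by simp
      then have "Y \<in> S" using Y by (auto simp: S_def)
      then show "Z \<in> perp 2 ` S" using Y(4) by blast
    qed
  qed
  moreover have "inj_on (perp 2) S" by (rule inj_onI) (metis dd)
  ultimately have "card S = card T" by (metis card_image)
  moreover have "card T * (q - 1) = index (perp 2 X) X - 1"
    unfolding T_def by (intro card_lines XD perp_submodule index_pos)
  ultimately show "card S * (q - 1) = q ^ (2 * rank X) - 1"
    using depth_eq(1)[OF X] by (simp add: depth_def)
qed

text \<open>A common cover of \<open>X\<close> and \<open>X'\<close> is generated by \<open>X\<close> and any vector of \<open>X'\<close> outside \<open>X\<close>.\<close>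

lemma join_unique_lattice:
  assumes "vertex_lattice X" "vertex_lattice X'" "X \<noteq> X'" "vertex_lattice Y" "vertex_lattice Y'"
    and "rank X = rank X'" "rank Y = Suc (rank X)" "rank Y' = Suc (rank X)"
    and "X \<subset> Y" "X' \<subset> Y" "X \<subset> Y'" "X' \<subset> Y'"
  shows "Y = Y'"
proof -
  have "\<not> X' \<subseteq> X" using rank_less[OF assms(2,1)] assms(3,6) by auto
  then obtain x where x: "x \<in> X'" "x \<notin> X" by blast
  have "Z = adjoin X x" if Z: "vertex_lattice Z" "X \<subset> Z" "X' \<subset> Z" "rank Z = Suc (rank X)" for Z
    using x Z smul_\<pi>_between[OF assms(1) Z(1)] rank_Suc_iff[OF assms(1) Z(1)]
      vertex_latticeD(2)[OF assms(1)] vertex_latticeD(2)[OF Z(1)]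
    by (intro adjoin_eq_of_index) auto
  then show ?thesis using assms by metis
qed

text \<open>The same argument, applied to the dual lattices.\<close>

lemma meet_unique_lattice:
  assumes "vertex_lattice X" "vertex_lattice X'" "X \<noteq> X'" "vertex_lattice Y" "vertex_lattice Y'"
    and "rank X = rank X'" "rank X = Suc (rank Y)" "rank X = Suc (rank Y')"
    and "Y \<subset> X" "Y \<subset> X'" "Y' \<subset> X" "Y' \<subset> X'"
  shows "Y = Y'"
proof -
  note XD = vertex_latticeD[OF assms(1)] and XD' = vertex_latticeD[OF assms(2)]
  have "\<not> perp 2 X' \<subseteq> perp 2 X"
  proof
    assume "perp 2 X' \<subseteq> perp 2 X"
    then have "X \<subseteq> X'"
      using perp_antimono[of "perp 2 X'" "perp 2 X" 2] perp_lattice(2)[OF XD(1)] perp_lattice(2)[OF XD'(1)] by simp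
    then show False using rank_less[OF assms(1,2)] assms(3,6) by auto
  qed
  then obtain x where x: "x \<in> perp 2 X'" "x \<notin> perp 2 X" by blast
  have "perp 2 Z = adjoin (perp 2 X) x"
    if Z: "vertex_lattice Z" "Z \<subset> X" "Z \<subset> X'" "rank X = Suc (rank Z)" for Z
  proof (rule adjoin_eq_of_index[OF perp_submodule perp_submodule _ _ _ _ x(2)])
    note ZD = vertex_latticeD[OF Z(1)]
    have ZX: "Z \<subseteq> X" using Z by blast
    show "perp 2 X \<subseteq> perp 2 Z" by (rule perp_antimono[OF ZX])
    show "smul \<pi> (perp 2 Z) \<subseteq> perp 2 X" using smul_mono[of "perp 2 Z" X \<pi>] ZD(3) ZX XD(5) by blast
    show "index (perp 2 X) (perp 2 Z) = q"
      using index_perp[OF ZD(1) XD(1) smul_\<pi>_between[OF Z(1) assms(1) ZX] ZX, of 2]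
        rank_Suc_iff[OF Z(1) assms(1) ZX] Z(4) by simp
    show "x \<in> perp 2 Z" using x(1) perp_antimono[of Z X' 2] Z(3) by blast
  qed
  then have "perp 2 Y = perp 2 Y'" using assms by metis
  then show ?thesis using perp_lattice(2) vertex_latticeD(1) assms by metis
qed

section \<open>The building as an order complex\<close>

text \<open>
  Non-degeneracy modulo \<open>\<pi>\<close> is unimodularity: if \<open>x\<close> is in the dual and \<open>\<pi>\<^sup>k x \<in> L\<close> with \<open>k > 0\<close>, then \<open>\<pi>\<^sup>k x\<close>
  pairs with \<open>L\<close> into \<open>\<pi>\<O>\<close>, hence lies in \<open>\<pi> L\<close>, and \<open>k\<close> can be lowered.
\<close>

lemma primitive_iff: "primitive L \<longleftrightarrow> is_lattice L \<and> perp 0 L = L"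
proof
  assume p: "primitive L"
  then have L: "is_lattice L" by (simp add: primitive_def)
  have Ls: "O_submodule L" using L by (rule lattice_submodule)
  have sub: "L \<subseteq> perp 0 L" using p by (auto simp: primitive_def form_in_def perp_def \<O>_eq)
  have nd: "x \<in> smul \<pi> L" if "x \<in> L" "\<And>y. y \<in> L \<Longrightarrow> form x y \<in> ideal 1" for x
    using p that by (auto simp: primitive_def \<pi>\<O>_eq)
  have down: "x \<in> L" if "x \<in> perp 0 L" "(\<pi> ^ k) *s x \<in> L" for x k
    using that(2)
  proof (induction k)
    case (Suc k)
    define z where "z = (\<pi> ^ k) *s x"
    have z: "\<pi> *s z \<in> L" using Suc.prems by (simp add: z_def)
    have "z \<in> perp 0 L"
      unfolding z_def using that(1) ord_power[of k]
      by (intro O_submodule_closed(3)[OF perp_submodule]) (auto simp: ideal_def)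
    then have "form (\<pi> *s z) y \<in> ideal 1" if "y \<in> L" for y
      using that uniformizer by (simp add: perp_def form_scale_left scale_in_ideal_iff)
    then have "\<pi> *s z \<in> smul \<pi> L" using nd z by blast
    then have "z \<in> L" using uniformizer by (simp add: mem_smul)
    then show ?case using Suc.IH by (simp add: z_def)
  qed simp
  have "perp 0 L \<subseteq> L"
  proof
    fix x assume x: "x \<in> perp 0 L"
    obtain B where B: "lattice_basis L B" using L is_lattice_iff by blast
    have "finite (representation B x ` B)" using lattice_basis_span[OF B] by simp
    from common_denominator[OF this] obtain a
      where a: "a \<noteq> 0" "\<forall>b\<in>B. a * representation B x b \<in> ideal 0" by auto
    have ax: "a *s x \<in> L" using a mem_lattice_iff[OF B] by (simp add: representation_linear[OF B])
    define k where "k = nat (ord a)"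
    have "inverse a * \<pi> ^ k \<noteq> 0" "ord (inverse a * \<pi> ^ k) = - ord a + int k"
      using a uniformizer ord_mult[of "inverse a" "\<pi> ^ k"] by (simp_all add: ord_inverse ord_power)
    then have "inverse a * \<pi> ^ k \<in> ideal 0" by (simp add: ideal_def k_def)
    then have "(inverse a * \<pi> ^ k) *s (a *s x) \<in> L" by (rule O_submodule_closed(3)[OF Ls _ ax])
    moreover have "inverse a * \<pi> ^ k * a = \<pi> ^ k" using a by simp
    ultimately have "(\<pi> ^ k) *s x \<in> L" by simp
    then show "x \<in> L" by (rule down[OF x])
  qed
  then show "is_lattice L \<and> perp 0 L = L" using L sub by blast
next
  assume L: "is_lattice L \<and> perp 0 L = L"
  have "x \<in> smul \<pi> L" if "x \<in> L" "\<forall>y\<in>L. form x y \<in> \<pi>\<O>" for x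
  proof -
    have "x \<in> perp 1 L" using that by (simp add: perp_def \<pi>\<O>_eq)
    then show ?thesis using smul_\<pi>_perp[of 0 L] L by simp
  qed
  moreover have "form_in L \<O>"
    using L unfolding form_in_def \<O>_eq perp_def by blast
  ultimately show "primitive L" using L by (simp add: primitive_def)
qed

lemma form_in_iff: "form_in L \<pi>\<O> \<longleftrightarrow> L \<subseteq> perp 1 L"
  by (auto simp: form_in_def \<pi>\<O>_eq perp_def)

text \<open>Elements of rank \<open>0\<close> are exactly the \<open>\<pi> L\<^sub>0\<close> with \<open>L\<^sub>0\<close> primitive; here is the \<open>L\<^sub>0\<close> of a given one.\<close>

lemma primitive_neighbour:
  assumes "vertex_lattice M" "perp 2 M = M"
  shows "primitive (perp 1 M)" "smul \<pi> (perp 1 M) = M"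
proof -
  have M: "is_lattice M" using assms vertex_latticeD by blast
  show s: "smul \<pi> (perp 1 M) = M" using assms by (simp add: smul_\<pi>_perp)
  have "perp 0 (perp 1 M) = perp 1 (smul \<pi> (perp 1 M))"
    using perp_smul[OF uniformizer(1), of 1 "perp 1 M"] uniformizer(2) by simp
  then show "primitive (perp 1 M)" using perp_lattice(1)[OF M] by (simp add: primitive_iff s)
qed

lemma vertex_latticeI:
  assumes "is_lattice L" "primitive L\<^sub>0" "form_in L \<pi>\<O>" "smul \<pi> L\<^sub>0 \<subseteq> L"
  shows "vertex_lattice L"
proof -
  have "perp 2 L \<subseteq> perp 2 (smul \<pi> L\<^sub>0)" using assms(4) by (rule perp_antimono)
  also have "\<dots> = perp 1 L\<^sub>0" using perp_smul[OF uniformizer(1)] uniformizer(2) by simp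
  also have "\<dots> = smul \<pi> L\<^sub>0" using assms(2) smul_\<pi>_perp[of 0 L\<^sub>0] by (simp add: primitive_iff)
  finally show ?thesis using assms form_in_iff by (auto simp: vertex_lattice_def)
qed

lemma hclass_eq:
  assumes "L \<in> hclass X"
  shows "hclass L = hclass X"
proof -
  obtain a where a: "a \<noteq> 0" "L = smul a X" using assms by (auto simp: hclass_def)
  have "smul b L \<in> hclass X" if "b \<noteq> 0" for b
    unfolding hclass_def using that a by (intro CollectI exI[of _ "b * a"]) (simp add: smul_smul)
  moreover have "smul b X \<in> hclass L" if "b \<noteq> 0" for b
    unfolding hclass_def using that a by (intro CollectI exI[of _ "b * inverse a"]) (simp add: smul_smul mult.assoc)
  ultimately have "hclass L \<subseteq> hclass X" "hclass X \<subseteq> hclass L"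
    unfolding hclass_def[of L] hclass_def[of X] by blast+
  then show ?thesis by (rule equalityI)
qed

lemma mem_hclass: "L \<in> hclass L"
  unfolding hclass_def by (intro CollectI exI[of _ 1]) (simp add: smul_1)

lemma vertex_iff: "vertex t \<longleftrightarrow> (\<exists>X. vertex_lattice X \<and> t = hclass X)"
proof
  assume "\<exists>X. vertex_lattice X \<and> t = hclass X"
  then obtain X where X: "vertex_lattice X" "t = hclass X" by blast
  obtain M where M: "vertex_lattice M" "M \<subseteq> X" "perp 2 M = M"
    using depth_power_and_self_dual_below[OF X(1)] by blast
  note XD = vertex_latticeD[OF X(1)]
  have "X \<subseteq> perp 1 M" using XD(4) perp_antimono[OF M(2), of 1] by blast
  then show "vertex t"
    unfolding vertex_def using X XD M primitive_neighbour[OF M(1,3)]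
    by (intro exI[of _ X] exI[of _ "perp 1 M"]) (simp add: form_in_iff)
qed (use vertex_latticeI in \<open>auto simp: vertex_def\<close>)

text \<open>
  Scaling \<open>X\<close> by \<open>a\<close> scales its dual by the inverse of \<open>a\<close>. Unless \<open>a\<close> is a unit, the inclusions for \<open>X\<close> and
  \<open>a X\<close> together put a lattice inside its own multiple by \<open>\<pi>\<close>.
\<close>

lemma vertex_lattice_unique:
  assumes X: "vertex_lattice X" and Y: "vertex_lattice (smul a X)" and a: "a \<noteq> 0"
  shows "smul a X = X"
proof -
  note XD = vertex_latticeD[OF X] and YD = vertex_latticeD[OF Y]
  define k where "k = ord a"
  have e: "perp m (smul a X) = smul a (perp (m - 2 * k) X)" for m
    using perp_smul[OF a, of m X] smul_perp[OF a, of "m - 2 * k" X] by (simp add: k_def)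
  have "smul a (perp (2 - 2 * k) X) \<subseteq> smul a X" using YD(3) by (simp only: e)
  then have lo: "perp (2 - 2 * k) X \<subseteq> X" using smul_subset_iff[OF a] by blast
  have "smul a X \<subseteq> smul a (perp (1 - 2 * k) X)" using YD(4) by (simp only: e)
  then have hi: "X \<subseteq> perp (1 - 2 * k) X" using smul_subset_iff[OF a] by blast
  have "\<not> k \<ge> 1"
  proof
    assume "k \<ge> 1"
    then have "perp 0 X \<subseteq> perp (2 - 2 * k) X" by (intro perp_mono_index) simp
    then have "perp 0 X \<subseteq> perp 1 X" using lo XD(4) by blast
    then show False using smul_\<pi>_proper[OF perp_lattice(1)[OF XD(1)], of 0] smul_\<pi>_perp[of 0 X] by simp
  qed
  moreover have "\<not> k \<le> -1"
  proof
    assume "k \<le> -1"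
    then have "perp (1 - 2 * k) X \<subseteq> perp 3 X" by (intro perp_mono_index) simp
    moreover have "perp 3 X = smul \<pi> (perp 2 X)" by (simp add: smul_\<pi>_perp)
    moreover have "smul \<pi> (perp 2 X) \<subseteq> smul \<pi> X" using XD(3) by (rule smul_mono)
    ultimately show False using smul_\<pi>_proper[OF XD(1)] hi by blast
  qed
  ultimately have "ord a = 0" by (simp add: k_def)
  then show ?thesis using smul_unit[OF XD(2) a] by simp
qed

text \<open>The vertex lattice of a vertex; it exists by \<open>vertex_iff\<close> and is unique by \<open>vertex_lattice_unique\<close>.\<close>

definition rep :: "'v set set \<Rightarrow> 'v set" where
  "rep t = (THE X. vertex_lattice X \<and> t = hclass X)"

lemma rep_hclass: "vertex_lattice X \<Longrightarrow> rep (hclass X) = X"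
  unfolding rep_def
proof (rule the_equality)
  fix Y assume X: "vertex_lattice X" and Y: "vertex_lattice Y \<and> hclass X = hclass Y"
  then have "Y \<in> hclass X" using mem_hclass by simp
  then obtain a where "a \<noteq> 0" "Y = smul a X" by (auto simp: hclass_def)
  then show "Y = X" using vertex_lattice_unique X Y by blast
qed simp

lemma rep_vertex:
  assumes "vertex t"
  shows "vertex_lattice (rep t)" "hclass (rep t) = t"
proof -
  obtain X where "vertex_lattice X" "t = hclass X" using assms vertex_iff by blast
  then show "vertex_lattice (rep t)" "hclass (rep t) = t" using rep_hclass by auto
qed

lemma rep_inj: "vertex t \<Longrightarrow> vertex t' \<Longrightarrow> rep t = rep t' \<longleftrightarrow> t = t'"
  using rep_vertex by metis

lemma rep_memberI:
  assumes "vertex t" "L \<in> t" "primitive L\<^sub>0" "form_in L \<pi>\<O>" "smul \<pi> L\<^sub>0 \<subseteq> L"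
  shows "L = rep t"
proof -
  have t: "L \<in> hclass (rep t)" using assms rep_vertex by simp
  then obtain a where "a \<noteq> 0" "L = smul a (rep t)" by (auto simp: hclass_def)
  then have "is_lattice L" using smul_lattice[OF vertex_latticeD(1)[OF rep_vertex(1)[OF assms(1)]]] by simp
  then have "vertex_lattice L" using vertex_latticeI assms by blast
  then show ?thesis using rep_hclass hclass_eq[OF t] rep_vertex[OF assms(1)] by metis
qed

text \<open>
  A lattice of rank \<open>0\<close> below the smaller of the two provides the primitive lattice around both: duality
  turns the lower bound for \<open>rep t'\<close> into the upper bound.
\<close>

lemma comparable_incident:
  assumes "vertex t" "vertex t'" "rep t \<subseteq> rep t'"
  shows "\<exists>L\<^sub>0. primitive L\<^sub>0 \<and> form_in (rep t) \<pi>\<O> \<and> form_in (rep t') \<pi>\<O> \<and>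
     smul \<pi> L\<^sub>0 \<subseteq> rep t \<and> rep t' \<subseteq> L\<^sub>0"
proof -
  note X = rep_vertex(1)[OF assms(1)] and X' = rep_vertex(1)[OF assms(2)]
  obtain M where M: "vertex_lattice M" "M \<subseteq> rep t" "perp 2 M = M"
    using depth_power_and_self_dual_below[OF X] by blast
  have "rep t' \<subseteq> perp 1 M"
    using vertex_latticeD(4)[OF X'] perp_antimono[of M "rep t'" 1] M(2) assms(3) by blast
  then show ?thesis using primitive_neighbour[OF M(1,3)] M(2) vertex_latticeD(4)[OF X] vertex_latticeD(4)[OF X']
    by (intro exI[of _ "perp 1 M"]) (simp add: form_in_iff)
qed

lemma incident_iff:
  assumes "vertex t" "vertex t'"
  shows "incident t t' \<longleftrightarrow> rep t \<subseteq> rep t' \<or> rep t' \<subseteq> rep t"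
proof
  assume "incident t t'"
  then obtain L L' L\<^sub>0 where L: "L \<in> t" "L' \<in> t'" "primitive L\<^sub>0" "form_in L \<pi>\<O>" "form_in L' \<pi>\<O>"
    "smul \<pi> L\<^sub>0 \<subseteq> L \<and> L \<subseteq> L' \<and> L' \<subseteq> L\<^sub>0 \<or> smul \<pi> L\<^sub>0 \<subseteq> L' \<and> L' \<subseteq> L \<and> L \<subseteq> L\<^sub>0"
    by (auto simp: incident_def)
  then have "smul \<pi> L\<^sub>0 \<subseteq> L" "smul \<pi> L\<^sub>0 \<subseteq> L'" by auto
  then have "L = rep t" "L' = rep t'" using rep_memberI assms L by blast+
  then show "rep t \<subseteq> rep t' \<or> rep t' \<subseteq> rep t" using L(6) by auto
next
  have mem: "rep t \<in> t" "rep t' \<in> t'" using rep_vertex(2)[OF assms(1)] rep_vertex(2)[OF assms(2)] mem_hclass by metis+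
  assume "rep t \<subseteq> rep t' \<or> rep t' \<subseteq> rep t"
  then show "incident t t'"
  proof
    assume s: "rep t \<subseteq> rep t'"
    show ?thesis unfolding incident_def using comparable_incident[OF assms s] s mem by blast
  next
    assume s: "rep t' \<subseteq> rep t"
    show ?thesis unfolding incident_def using comparable_incident[OF assms(2,1) s] s mem by blast
  qed
qed

lemma card_vertices: "card {t \<in> Collect vertex. Q (rep t)} = card {X. vertex_lattice X \<and> Q X}"
proof -
  have "rep ` {t \<in> Collect vertex. Q (rep t)} = {X. vertex_lattice X \<and> Q X}"
  proof (intro equalityI subsetI)
    fix X assume "X \<in> {X. vertex_lattice X \<and> Q X}"
    then have X: "vertex_lattice X" "Q X" by auto
    moreover have "vertex (hclass X)" using X vertex_iff by blast
    ultimately show "X \<in> rep ` {t \<in> Collect vertex. Q (rep t)}"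
      using rep_hclass by (intro image_eqI[of _ _ "hclass X"]) auto
  qed (use rep_vertex in auto)
  moreover have "inj_on rep {t \<in> Collect vertex. Q (rep t)}"
    by (rule inj_onI) (use rep_inj in auto)
  then have "card (rep ` {t \<in> Collect vertex. Q (rep t)}) = card {t \<in> Collect vertex. Q (rep t)}"
    by (rule card_image)
  ultimately show ?thesis by simp
qed

text \<open>The lattice-theoretic results, transported to vertices by \<open>rep\<close>.\<close>

lemma vertex_poset:
  "flag_poset (Collect vertex) (\<lambda>t t'. rep t \<subset> rep t') (\<lambda>t. rank (rep t)) n num_lines"
proof
  show "0 < n" using n_pos by simp
  show "rep x \<subset> rep z" if "rep x \<subset> rep y" "rep y \<subset> rep z" for x y z
    using that by (rule psubset_trans)
  show "rank (rep x) \<le> n" if "x \<in> Collect vertex" for x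
    using that depth_eq(2) rep_vertex(1) by simp
  show "rank (rep x) < rank (rep y)" if "x \<in> Collect vertex" "y \<in> Collect vertex" "rep x \<subset> rep y" for x y
    using that rank_less rep_vertex(1) by simp
  show "\<exists>z\<in>Collect vertex. rep x \<subset> rep z \<and> rank (rep z) = Suc (rank (rep x)) \<and> (z = y \<or> rep z \<subset> rep y)"
    if xy: "x \<in> Collect vertex" "y \<in> Collect vertex" "rep x \<subset> rep y" for x y
  proof -
    have X: "vertex_lattice (rep x)" and Y: "vertex_lattice (rep y)" using xy rep_vertex by auto
    obtain v where v: "v \<in> rep y" "v \<notin> rep x" using xy by blast
    have "rep y \<subseteq> perp 1 (rep x)"
      using vertex_latticeD(4)[OF Y] perp_antimono[of "rep x" "rep y" 1] xy(3) by blast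
    then have v1: "v \<in> perp 1 (rep x)" using v by blast
    define Z where "Z = adjoin (rep x) v"
    have Z: "vertex_lattice Z" "index (rep x) Z = q" unfolding Z_def by (rule up_step[OF X v1 v(2)])+
    have sub: "rep x \<subseteq> Z" "v \<in> Z" "Z \<subseteq> rep y"
      unfolding Z_def using adjoin_superset[OF vertex_latticeD(2)[OF X]]
        adjoin_subset[OF vertex_latticeD(2)[OF Y] _ v(1)] xy(3) by blast+
    have "rank Z = Suc (rank (rep x))" using rank_Suc_iff[OF X Z(1) sub(1)] Z(2) by simp
    moreover have "rep (hclass Z) = Z" "vertex (hclass Z)" using rep_hclass Z vertex_iff by blast+
    moreover have "hclass Z = y \<or> Z \<subset> rep y" using sub(3) xy(2) rep_vertex(2) by auto
    moreover have "rep x \<subset> Z" using sub v by blast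
    ultimately show ?thesis by (intro bexI[of _ "hclass Z"]) auto
  qed
  show "card {y \<in> Collect vertex. rep x \<subset> rep y \<and> rank (rep y) = Suc (rank (rep x))} = num_lines (n - rank (rep x))"
    if "x \<in> Collect vertex" for x
    using card_vertices[of "\<lambda>Y. rep x \<subset> Y \<and> rank Y = Suc (rank (rep x))"] upper_covers[of "rep x"] rep_vertex(1) that by simp
  show "card {x \<in> Collect vertex. rep x \<subset> rep y \<and> rank (rep y) = Suc (rank (rep x))} = num_lines (rank (rep y))"
    if "y \<in> Collect vertex" for y
    using card_vertices[of "\<lambda>X. X \<subset> rep y \<and> rank (rep y) = Suc (rank X)"] lower_covers[of "rep y"] rep_vertex(1) that by simp
  show "0 < num_lines i" if "0 < i" for i using num_lines_pos[OF that] .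
  show "y = y'" if "x \<in> Collect vertex" "x' \<in> Collect vertex" "x \<noteq> x'" "y \<in> Collect vertex" "y' \<in> Collect vertex"
    "rank (rep x) = 0" "rank (rep x') = 0" "rank (rep y) = 1" "rank (rep y') = 1"
    "rep x \<subset> rep y" "rep x' \<subset> rep y" "rep x \<subset> rep y'" "rep x' \<subset> rep y'" for x x' y y'
    using join_unique_lattice[of "rep x" "rep x'" "rep y" "rep y'"] that rep_inj rep_vertex(1) by simp
  show "y = y'" if "x \<in> Collect vertex" "x' \<in> Collect vertex" "x \<noteq> x'" "y \<in> Collect vertex" "y' \<in> Collect vertex"
    "rank (rep x) = n" "rank (rep x') = n" "Suc (rank (rep y)) = n" "Suc (rank (rep y')) = n"
    "rep y \<subset> rep x" "rep y \<subset> rep x'" "rep y' \<subset> rep x" "rep y' \<subset> rep x'" for x x' y y'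
    using meet_unique_lattice[of "rep x" "rep x'" "rep y" "rep y'"] that rep_inj rep_vertex(1) by simp
qed

text \<open>
  The poset and its opposite have the same chains. The first interpretation serves the special vertices of
  rank \<open>0\<close>, the second those of rank \<open>n\<close>.
\<close>

sublocale up: flag_poset "Collect vertex" "\<lambda>t t'. rep t \<subset> rep t'" "\<lambda>t. rank (rep t)" n num_lines
  by (rule vertex_poset)

sublocale down: flag_poset "Collect vertex" "\<lambda>t t'. rep t' \<subset> rep t" "\<lambda>t. n - rank (rep t)" n num_lines
  by (rule up.dual)

lemma simplex_iff_chain: "simplex S \<longleftrightarrow> up.chain S"
proof -
  have "incident t t' \<longleftrightarrow> rep t \<subset> rep t' \<or> rep t' \<subset> rep t" if "vertex t" "vertex t'" "t \<noteq> t'" for t t'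
    using incident_iff[OF that(1,2)] rep_inj[OF that(1,2)] that(3) by blast
  then have "pairwise incident S \<longleftrightarrow> pairwise (\<lambda>t t'. rep t \<subset> rep t' \<or> rep t' \<subset> rep t) S"
    if "\<forall>t\<in>S. vertex t" using that by (auto simp: pairwise_def simp del: psubset_eq)
  then have "(\<forall>t\<in>S. vertex t) \<and> pairwise incident S \<longleftrightarrow>
      (\<forall>t\<in>S. vertex t) \<and> pairwise (\<lambda>t t'. rep t \<subset> rep t' \<or> rep t' \<subset> rep t) S"
    by (rule conj_cong[OF refl])
  moreover have "S \<subseteq> Collect vertex \<longleftrightarrow> (\<forall>t\<in>S. vertex t)" by auto
  ultimately show ?thesis by (simp only: simplex_def up.chain_def)
qed

lemma chamber_iff: "chamber C \<longleftrightarrow> up.maxchain C"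
  by (simp add: chamber_def up.maxchain_def simplex_iff_chain)

lemma adjacent_iff: "adjacent C C' \<longleftrightarrow> up.adj C C'"
  by (simp add: adjacent_def up.adj_def simplex_iff_chain chamber_iff)

lemma close_iff: "close t t' \<longleftrightarrow> up.near t t'"
  by (simp add: close_def up.near_def adjacent_iff)

lemma down_eq_up: "down.chain S \<longleftrightarrow> up.chain S" "down.maxchain C \<longleftrightarrow> up.maxchain C"
  "down.adj C C' \<longleftrightarrow> up.adj C C'" "down.near t t' \<longleftrightarrow> up.near t t'"
proof -
  show 1: "down.chain S \<longleftrightarrow> up.chain S" for S
    unfolding up.chain_def down.chain_def by (simp only: disj_commute)
  show 2: "down.maxchain C \<longleftrightarrow> up.maxchain C" for C
    by (simp only: up.maxchain_def down.maxchain_def 1)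
  show 3: "down.adj C C' \<longleftrightarrow> up.adj C C'" for C C'
    by (simp only: up.adj_def down.adj_def 1 2)
  show "down.near t t' \<longleftrightarrow> up.near t t'"
    by (simp only: up.near_def down.near_def 3)
qed

section \<open>Special vertices and the counts\<close>

text \<open>
  Scaling the vectors of a symplectic basis so that the partners' orders always add up to \<open>m\<close> gives a
  lattice that is self-dual for the form divided by \<open>\<pi>\<^sup>m\<close>.
\<close>

lemma lattice_of_perp:
  assumes b: "symplectic_basis u w" and c: "\<And>i. c i \<noteq> 0" "\<And>i. d i \<noteq> 0" "\<And>i. ord (c i) + ord (d i) = m"
  defines "L \<equiv> lattice_of (\<lambda>i. c i *s u i) (\<lambda>i. d i *s w i)"
  shows "perp m L = L" "O_submodule L"
proof -
  have uw: "form (u i) (w j) = (if i = j then 1 else 0)" "form (u i) (u j) = 0" "form (w i) (w j) = 0"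
     if "i < n" "j < n" for i j using b that by (auto simp: symplectic_basis_def)
  have wu: "form (w i) (u j) = (if i = j then -1 else 0)" if "i < n" "j < n" for i j
    by (subst form_swap) (use uw(1)[OF that(2,1)] in auto)
  have fu: "form ((\<Sum>i<n. f i *s u i) + (\<Sum>i<n. g i *s w i)) (u j) = - g j" if "j < n" for f g j
  proof -
    have "form ((\<Sum>i<n. f i *s u i) + (\<Sum>i<n. g i *s w i)) (u j) = (\<Sum>i<n. if i = j then - g j else 0)"
      unfolding form_add_left form_sum_left sum.distrib[symmetric] using that uw wu
      by (intro sum.cong) (auto simp: form_scale_left)
    then show ?thesis using that by simp
  qed
  have fw: "form ((\<Sum>i<n. f i *s u i) + (\<Sum>i<n. g i *s w i)) (w j) = f j" if "j < n" for f g j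
  proof -
    have "form ((\<Sum>i<n. f i *s u i) + (\<Sum>i<n. g i *s w i)) (w j) = (\<Sum>i<n. if i = j then f j else 0)"
      unfolding form_add_left form_sum_left sum.distrib[symmetric] using that uw wu
      by (intro sum.cong) (auto simp: form_scale_left)
    then show ?thesis using that by simp
  qed
  define K where "K = {(\<Sum>i<n. f i *s u i) + (\<Sum>i<n. g i *s w i) | f g.
     (\<forall>i<n. f i \<in> ideal (ord (c i))) \<and> (\<forall>i<n. g i \<in> ideal (ord (d i)))}"
  have LK: "L = K"
  proof
    show "L \<subseteq> K"
    proof
      fix x assume "x \<in> L"
      then obtain f g where x: "x = (\<Sum>i<n. (f i * c i) *s u i) + (\<Sum>i<n. (g i * d i) *s w i)"
        "\<forall>i<n. f i \<in> ideal 0" "\<forall>i<n. g i \<in> ideal 0"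
        by (auto simp: L_def lattice_of_def \<O>_eq)
      have "f i * c i \<in> ideal (ord (c i))" "g i * d i \<in> ideal (ord (d i))" if "i < n" for i
        using x that scale_in_ideal_iff[OF c(1)[of i], of "f i" "ord (c i)"]
          scale_in_ideal_iff[OF c(2)[of i], of "g i" "ord (d i)"] by (simp_all add: mult.commute)
      then show "x \<in> K" unfolding K_def x(1)
        by (intro CollectI exI[of _ "\<lambda>i. f i * c i"] exI[of _ "\<lambda>i. g i * d i"]) simp
    qed
    show "K \<subseteq> L"
    proof
      fix x assume "x \<in> K"
      then obtain f g where x: "x = (\<Sum>i<n. f i *s u i) + (\<Sum>i<n. g i *s w i)"
        "\<forall>i<n. f i \<in> ideal (ord (c i))" "\<forall>i<n. g i \<in> ideal (ord (d i))" by (auto simp: K_def)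
      have int: "inverse (c i) * f i \<in> ideal 0" "inverse (d i) * g i \<in> ideal 0" if "i < n" for i
        using x(2,3) c that by (simp_all add: scale_in_ideal_iff ord_inverse)
      have cancel: "inverse (c i) * f i * c i = f i" "inverse (d i) * g i * d i = g i" for i
        using c(1,2) by simp_all
      show "x \<in> L" unfolding L_def lattice_of_def \<O>_eq
      proof (rule CollectI, rule exI[of _ "\<lambda>i. inverse (c i) * f i"],
          rule exI[of _ "\<lambda>i. inverse (d i) * g i"], intro conjI)
        show "x = (\<Sum>i<n. (inverse (c i) * f i) *s c i *s u i) + (\<Sum>i<n. (inverse (d i) * g i) *s d i *s w i)"
          unfolding x(1) scale_scale cancel ..
      qed (use int in simp_all)
    qed
  qed
  have mem: "x \<in> K \<longleftrightarrow> (\<forall>j<n. form x (c j *s u j) \<in> ideal m \<and> form x (d j *s w j) \<in> ideal m)" for x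
  proof -
    have *: "form x (c j *s u j) \<in> ideal m \<longleftrightarrow> form x (u j) \<in> ideal (ord (d j))"
      "form x (d j *s w j) \<in> ideal m \<longleftrightarrow> form x (w j) \<in> ideal (ord (c j))" for j
      using c(3)[of j] by (simp_all add: form_scale_right scale_in_ideal_iff c(1,2) flip: c(3)[of j])
    show ?thesis unfolding *
    proof
      assume "x \<in> K"
      then obtain f g where "x = (\<Sum>i<n. f i *s u i) + (\<Sum>i<n. g i *s w i)"
        "\<forall>i<n. f i \<in> ideal (ord (c i))" "\<forall>i<n. g i \<in> ideal (ord (d i))" by (auto simp: K_def)
      then show "\<forall>j<n. form x (u j) \<in> ideal (ord (d j)) \<and> form x (w j) \<in> ideal (ord (c j))"
        using fu fw ideal_minus by simp
    next
      assume "\<forall>j<n. form x (u j) \<in> ideal (ord (d j)) \<and> form x (w j) \<in> ideal (ord (c j))"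
      then have "\<forall>j<n. form x (w j) \<in> ideal (ord (c j))" "\<forall>j<n. - form x (u j) \<in> ideal (ord (d j))"
        using ideal_minus by auto
      then show "x \<in> K" unfolding K_def
      proof (intro CollectI exI conjI)
        show "x = (\<Sum>i<n. form x (w i) *s u i) + (\<Sum>i<n. - form x (u i) *s w i)"
          by (rule symplectic_expansion[OF b])
      qed
    qed
  qed
  \<comment> \<open>being the dual of its own generators, \<open>L\<close> is both isotropic and maximal\<close>
  define G where "G = (\<lambda>j. c j *s u j) ` {..<n} \<union> (\<lambda>j. d j *s w j) ` {..<n}"
  have LG: "L = perp m G" unfolding LK by (auto simp: mem perp_def G_def)
  then show sub: "O_submodule L" using perp_submodule by simp
  have cd: "c j * d j \<in> ideal m" "d j * c j \<in> ideal m" for j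
    using c ord_mult[OF c(1)[of j] c(2)[of j]] by (simp_all add: ideal_def mult.commute)
  have cu: "c j *s u j \<in> L" "d j *s w j \<in> L" if "j < n" for j
    unfolding LK mem using uw wu that cd[of j] ideal_minus
    by (simp_all add: form_scale_left form_scale_right zero_in_ideal)
  then have "G \<subseteq> L" by (auto simp: G_def)
  then have "perp m L \<subseteq> L" by (subst (2) LG) (rule perp_antimono)
  moreover have GL: "G \<subseteq> perp m L" using subset_perp_swap[of G m L] LG by simp
  have "L \<subseteq> perp m L"
  proof
    fix x assume "x \<in> L"
    then obtain f g where x: "x = (\<Sum>i<n. f i *s c i *s u i) + (\<Sum>i<n. g i *s d i *s w i)"
      "\<forall>i<n. f i \<in> ideal 0" "\<forall>i<n. g i \<in> ideal 0" unfolding L_def lattice_of_def \<O>_eq by auto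
    have gen: "c i *s u i \<in> perp m L" "d i *s w i \<in> perp m L" if "i < n" for i
      using GL that by (auto simp: G_def)
    have "(\<Sum>i<n. f i *s c i *s u i) \<in> perp m L"
      by (intro O_submodule_sum[OF perp_submodule] O_submodule_closed(3)[OF perp_submodule _ gen(1)])
        (use x(2) in auto)
    moreover have "(\<Sum>i<n. g i *s d i *s w i) \<in> perp m L"
      by (intro O_submodule_sum[OF perp_submodule] O_submodule_closed(3)[OF perp_submodule _ gen(2)])
        (use x(3) in auto)
    ultimately show "x \<in> perp m L" unfolding x(1) by (rule O_submodule_closed(2)[OF perp_submodule])
  qed
  ultimately show "perp m L = L" by (rule equalityI)
qed

text \<open>
  A special class consists of lattices with \<open>\<pi>\<^sup>m L\<^sup># = L\<close> for some \<open>m\<close>. For the vertex lattice in it, the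
  inclusions \<open>\<pi>\<^sup>2 X\<^sup># \<subseteq> X \<subseteq> \<pi> X\<^sup>#\<close> leave only \<open>m = 2\<close>, which is rank \<open>0\<close>, and \<open>m = 1\<close>, which is rank \<open>n\<close>.
\<close>

lemma special_rank:
  assumes "special t"
  shows "vertex t" "rank (rep t) = 0 \<or> rank (rep t) = n"
proof -
  show v: "vertex t" using assms by (simp add: special_def)
  note X = rep_vertex(1)[OF v] note XD = vertex_latticeD[OF X]
  obtain u w a \<mu> where b: "symplectic_basis u w"
    and t: "t = hclass (lattice_of (\<lambda>i. (\<pi> powi a i) *s u i) (\<lambda>i. (\<pi> powi (\<mu> - a i)) *s w i))"
    using assms by (auto simp: special_def)
  define L where "L = lattice_of (\<lambda>i. (\<pi> powi a i) *s u i) (\<lambda>i. (\<pi> powi (\<mu> - a i)) *s w i)"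
  have L: "perp \<mu> L = L" unfolding L_def
    by (rule lattice_of_perp(1)[OF b power_int_nonzero power_int_nonzero]) (simp add: ord_power_int)
  have "rep t \<in> hclass L" using rep_vertex(2)[OF v] mem_hclass t by (metis L_def)
  then obtain s where s: "s \<noteq> 0" "rep t = smul s L" by (auto simp: hclass_def)
  define m where "m = \<mu> + 2 * ord s"
  have e: "perp m (rep t) = rep t"
  proof -
    have "perp m (smul s L) = perp (\<mu> + ord s) L" using perp_smul[OF s(1), of m L] by (simp add: m_def add.commute)
    also have "\<dots> = smul s (perp \<mu> L)" using smul_perp[OF s(1)] by simp
    finally show ?thesis using s L by simp
  qed
  have "m \<le> 2"
  proof (rule ccontr)
    assume "\<not> m \<le> 2"
    then have "perp m (rep t) \<subseteq> perp 3 (rep t)" by (intro perp_mono_index) simp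
    also have "\<dots> = smul \<pi> (perp 2 (rep t))" by (simp add: smul_\<pi>_perp)
    also have "\<dots> \<subseteq> smul \<pi> (rep t)" using XD(3) by (rule smul_mono)
    finally show False using smul_\<pi>_proper[OF XD(1)] e by simp
  qed
  moreover have "1 \<le> m"
  proof (rule ccontr)
    assume "\<not> 1 \<le> m"
    then have "perp 0 (rep t) \<subseteq> perp m (rep t)" by (intro perp_mono_index) simp
    also have "\<dots> \<subseteq> perp 1 (rep t)" using e XD(4) by simp
    also have "\<dots> = smul \<pi> (perp 0 (rep t))" by (simp add: smul_\<pi>_perp)
    finally show False using smul_\<pi>_proper[OF perp_lattice(1)[OF XD(1)]] by simp
  qed
  ultimately have "m = 1 \<or> m = 2" by linarith
  then show "rank (rep t) = 0 \<or> rank (rep t) = n" using e rank_0_iff[OF X] rank_n_iff[OF X] by auto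
qed

lemma primitive_lattice_of:
  assumes b: "symplectic_basis u w"
  shows "primitive (lattice_of u w)"
proof -
  define L where "L = lattice_of u w"
  have p: "perp 0 L = L" "O_submodule L"
    using lattice_of_perp[OF b, of "\<lambda>_. 1" "\<lambda>_. 1" 0] by (simp_all add: L_def ord_1)
  define B where "B = u ` {..<n} \<union> w ` {..<n}"
  have ind: "independent B" "span B = UNIV" using b by (auto simp: symplectic_basis_def B_def)
  have fin: "finite B" by (simp add: B_def)
  have "card B = dim (UNIV :: 'v set)" using dim_eq_card[of B UNIV] ind by simp
  then have cB: "card B = 2 * n" using dim_eq by simp
  have uL: "u i \<in> L" "w i \<in> L" if "i < n" for i
  proof -
    have "u i = (\<Sum>j<n. (if j = i then 1 else 0) *s u j) + (\<Sum>j<n. 0 *s w j)"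
      using that by (simp add: if_distrib[of "\<lambda>c. c *s _"] cong: if_cong)
    then show "u i \<in> L" unfolding L_def lattice_of_def using one_in_\<O> zero_in_ideal
      by (intro CollectI exI[of _ "\<lambda>j. if j = i then 1 else 0"] exI[of _ "\<lambda>_. 0"]) (simp add: \<O>_eq)
    have "w i = (\<Sum>j<n. 0 *s u j) + (\<Sum>j<n. (if j = i then 1 else 0) *s w j)"
      using that by (simp add: if_distrib[of "\<lambda>c. c *s _"] cong: if_cong)
    then show "w i \<in> L" unfolding L_def lattice_of_def using one_in_\<O> zero_in_ideal
      by (intro CollectI exI[of _ "\<lambda>_. 0"] exI[of _ "\<lambda>j. if j = i then 1 else 0"]) (simp add: \<O>_eq)
  qed
  have "O_span B \<subseteq> L" using uL by (intro O_span_minimal p) (auto simp: B_def)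
  moreover have "L \<subseteq> O_span B"
  proof
    fix x assume "x \<in> L"
    then obtain c d where x: "x = (\<Sum>i<n. c i *s u i) + (\<Sum>i<n. d i *s w i)"
      "\<forall>i<n. c i \<in> ideal 0" "\<forall>i<n. d i \<in> ideal 0" by (auto simp: L_def lattice_of_def \<O>_eq)
    have "u i \<in> O_span B" "w i \<in> O_span B" if "i < n" for i
      using that by (intro O_span_superset[OF fin]; simp add: B_def)+
    then show "x \<in> O_span B" unfolding x(1) using x(2,3) O_span_submodule
      by (intro O_submodule_closed(2) O_submodule_sum O_submodule_closed(3)) auto
  qed
  ultimately have "lattice_basis L B" using ind cB by (auto simp: lattice_basis_def)
  then have L: "is_lattice L" using is_lattice_iff by blast
  then show ?thesis using p(1) by (simp add: primitive_iff L_def)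
qed

text \<open>Without a special vertex the definite descriptions of \<open>r\<close> and \<open>\<omega>\<close> would not denote.\<close>

lemma special_exists: "\<exists>t. special t"
proof -
  obtain u w where b: "symplectic_basis u w" using symplectic_basis_exists by blast
  define L where "L = lattice_of u w"
  have pL: "primitive L" using primitive_lattice_of[OF b] by (simp add: L_def)
  then have L: "is_lattice L" and p: "perp 0 L = L" by (auto simp: primitive_iff)
  define M where "M = smul \<pi> L"
  have "form_in M \<pi>\<O>"
  proof -
    have "perp 1 M = perp 0 L" using perp_smul[OF uniformizer(1), of 1 L] uniformizer(2) by (simp add: M_def)
    then show ?thesis using smul_subset[OF lattice_submodule[OF L] \<pi>_in_\<O>] p by (simp add: form_in_iff M_def)
  qed
  moreover have "is_lattice M" using smul_lattice[OF L uniformizer(1)] by (simp add: M_def)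
  ultimately have "vertex_lattice M" using vertex_latticeI[OF _ pL] by (simp add: M_def)
  moreover have "hclass M = hclass L"
    using hclass_eq[of M L] uniformizer(1) by (auto simp: M_def hclass_def)
  ultimately have "vertex (hclass L)" using vertex_iff by metis
  then have "vertex (hclass L) \<and> (\<exists>u w a \<mu>. symplectic_basis u w \<and>
     hclass L = hclass (lattice_of (\<lambda>i. (\<pi> powi a i) *s u i) (\<lambda>i. (\<pi> powi (\<mu> - a i)) *s w i)))"
  proof (rule conjI, intro exI conjI)
    show "symplectic_basis u w" by (rule b)
    show "hclass L = hclass (lattice_of (\<lambda>i. (\<pi> powi (\<lambda>_. 0) i) *s u i)
        (\<lambda>i. (\<pi> powi (0 - (\<lambda>_. 0) i)) *s w i))" by (simp add: L_def)
  qed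
  then have "special (hclass L)" by (simp add: special_def)
  then show ?thesis by blast
qed

text \<open>Rank \<open>0\<close> uses the poset itself, rank \<open>n\<close> its opposite.\<close>

lemma special_counts:
  assumes "special t"
  shows "card {C. chamber C \<and> t \<in> C} = flag_number n"
    and "close t t' \<Longrightarrow> num_galleries t t' = flag_number (n - 1)"
    and "card {t'. vertex t' \<and> close t t'} = num_lines n * q"
proof -
  have v: "t \<in> Collect vertex" using special_rank(1)[OF assms] by simp
  have N: "num_lines n * (num_lines 1 - 1) = num_lines n * q" by (simp only: num_lines_1) simp
  have eqs: "chamber = up.maxchain" "adjacent = up.adj" "close = up.near"
    by (simp_all add: fun_eq_iff chamber_iff adjacent_iff close_iff)
  have "rank (rep t) = 0 \<or> n - rank (rep t) = 0" using special_rank(2)[OF assms] by auto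
  then have "card {C. up.maxchain C \<and> t \<in> C} = flag_number n \<and>
     (up.near t t' \<longrightarrow> card {(C, C'). up.adj C C' \<and> t \<in> C \<and> t' \<in> C'} = flag_number (n - 1)) \<and>
     card {t' \<in> Collect vertex. up.near t t'} = num_lines n * q"
  proof
    assume r0: "rank (rep t) = 0"
    show ?thesis
      using up.card_maxchains[OF v r0] up.card_galleries[OF _ r0] up.card_near[OF v r0] N
      by (simp add: flag_number_def)
  next
    assume r0: "n - rank (rep t) = 0"
    show ?thesis
      using down.card_maxchains[OF v r0] down.card_galleries[OF _ r0] down.card_near[OF v r0] N
      unfolding down_eq_up by (simp add: flag_number_def)
  qed
  then show "card {C. chamber C \<and> t \<in> C} = flag_number n"
    and "close t t' \<Longrightarrow> num_galleries t t' = flag_number (n - 1)"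
    and "card {t'. vertex t' \<and> close t t'} = num_lines n * q"
    by (simp_all add: eqs num_galleries_def)
qed

lemma r_eq: "r = flag_number n"
proof (cases "n = 1")
  case True
  then show ?thesis unfolding r_def if_P[OF True] flag_number_def using num_lines_1 by simp
next
  case False
  obtain t where "special t" using special_exists by blast
  then have "(THE N. \<forall>t. special t \<longrightarrow> card {C. chamber C \<and> t \<in> C} = N) = flag_number n"
    using special_counts(1) by (intro the_equality) auto
  then show ?thesis using False by (simp add: r_def)
qed

lemma \<omega>_eq: "\<omega> = num_lines n * q"
proof -
  obtain t where "special t" using special_exists by blast
  then show ?thesis unfolding \<omega>_def using special_counts(3) by (intro the_equality) auto
qed

lemma flag_number_step: "flag_number n = num_lines n * flag_number (n - 1)" "0 < flag_number m"
proof -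
  obtain k where "n = Suc k" using n_pos by (cases n) auto
  then show "flag_number n = num_lines n * flag_number (n - 1)" by (simp add: flag_number_def mult.commute)
  show "0 < flag_number m" unfolding flag_number_def by (intro prod_pos) (auto intro: num_lines_pos)
qed

end

text \<open>
  Both spaces have the same residue field, so \<open>flag_number (n - 1)\<close>, which counts galleries in the first,
  is the number \<open>r\<close> of the second.
\<close>

theorem proposition2p11:
  fixes ord :: "'k::field \<Rightarrow> int" and \<pi> :: 'k
    and scaleV :: "'k \<Rightarrow> 'v::ab_group_add \<Rightarrow> 'v" and formV :: "'v \<Rightarrow> 'v \<Rightarrow> 'k"
    and scaleW :: "'k \<Rightarrow> 'w::ab_group_add \<Rightarrow> 'w" and formW :: "'w \<Rightarrow> 'w \<Rightarrow> 'k"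
    and e f :: "nat \<Rightarrow> 'v" and n :: nat
  assumes "n \<ge> 2"
    and "symplectic_space ord \<pi> scaleV formV n"
    and "symplectic_space ord \<pi> scaleW formW (n - 1)"
    and "symplectic_space.symplectic_basis scaleV formV n e f"
  shows "(\<forall>t t'. symplectic_space.special ord \<pi> scaleV formV n t \<longrightarrow>
            symplectic_space.special ord \<pi> scaleV formV n t' \<longrightarrow>
            symplectic_space.close ord \<pi> scaleV formV n t t' \<longrightarrow>
            symplectic_space.has_type ord scaleV n e f t 0 \<longrightarrow>
            symplectic_space.num_galleries ord \<pi> scaleV formV n t t' =
              symplectic_space.r ord \<pi> scaleW formW (n - 1)) \<and>
         real (symplectic_space.\<omega> ord \<pi> scaleV formV n) =
           real (symplectic_space.r ord \<pi> scaleV formV n * nonarch_local_field.q ord \<pi>) /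
           real (symplectic_space.r ord \<pi> scaleW formW (n - 1))"
proof -
  interpret V: symplectic_space ord \<pi> scaleV formV n by (rule assms(2))
  interpret W: symplectic_space ord \<pi> scaleW formW "n - 1" by (rule assms(3))
  have "V.num_galleries t t' = W.r" if "V.special t" "V.close t t'" for t t'
    using V.special_counts(2)[OF that] by (simp only: W.r_eq)
  moreover have "real V.\<omega> = real (V.r * V.q) / real W.r"
  proof -
    have "V.r * V.q = V.\<omega> * W.r"
      unfolding V.r_eq W.r_eq V.\<omega>_eq V.flag_number_step(1) by (simp only: ac_simps)
    moreover have "W.r > 0" unfolding W.r_eq by (rule V.flag_number_step(2))
    ultimately show ?thesis by (metis less_irrefl nonzero_mult_div_cancel_right of_nat_eq_0_iff of_nat_mult)
  qed
  ultimately show ?thesis by blast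
qed

end
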